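(* Let $\pi\colon(N,h)\to(M,g)$ be a Riemannian submersion. Then the map $\varphi_\pi:=g_\flat\circ\mathrm{d}\pi\circ h_\flat^{-1}\colon T^*N\to T^*M$ is a Poisson map if and only if the horizontal distribution $\mathcal{H}\subset TN$ of $\pi$ is integrable.
   Context: A smooth submersion $\pi\colon(N,h)\to(M,g)$ between Riemannian manifolds is a Riemannian submersion if for every $q\in N$ the restriction of $\mathrm{d}_q\pi$ to $\mathcal{H}_q=(\ker\mathrm{d}_q\pi)^{\perp_h}\subset T_qN$ is a linear isometry onto $T_{\pi(q)}M$; $\mathcal{H}=(\mathcal{H}_q)_{q\in N}$ is the horizontal distribution. The musical isomorphisms are $g_\flat\colon TM\to T^*M$, $v\mapsto g(v,\cdot)$, and $h_\flat\colon TN\to T^*N$, $v\mapsto h(v,\cdot)$. $T^*N$ and $T^*M$ carry their canonical Poisson brackets; $\varphi_\pi$ is a Poisson map if $\{f_1\circ\varphi_\pi,f_2\circ\varphi_\pi\}_{T^*N}=\{f_1,f_2\}_{T^*M}\circ\varphi_\pi$ for all $f_1,f_2\in C^\infty(T^*M)$. *)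

theory Defs
  imports "HOL-Analysis.Analysis"
begin

text \<open>
  Differential calculus on finite-dimensional manifolds.  A manifold is a Hausdorff second-countable
  type \<open>'p\<close> (the whole type is the manifold) together with a smooth atlas of charts into a
  Euclidean space \<open>'e\<close>, so that its dimension is \<open>DIM('e)\<close>.
\<close>

section \<open>Smooth functions on open subsets of normed spaces\<close>

text \<open>The set \<open>S\<close> is always open and the domain finite-dimensional below, so \<open>C\<^sup>k\<close> may be expressed
  by iterated directional derivatives.\<close>

primrec Ck_on :: "nat \<Rightarrow> 'a::real_normed_vector set \<Rightarrow> ('a \<Rightarrow> 'b::real_normed_vector) \<Rightarrow> bool" where
  "Ck_on 0 S f \<longleftrightarrow> continuous_on S f"
| "Ck_on (Suc k) S f \<longleftrightarrow>
     (\<forall>x\<in>S. f differentiable (at x)) \<and> (\<forall>v. Ck_on k S (\<lambda>x. frechet_derivative f (at x) v))"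

definition smooth_on :: "'a::real_normed_vector set \<Rightarrow> ('a \<Rightarrow> 'b::real_normed_vector) \<Rightarrow> bool" where
  "smooth_on S f \<longleftrightarrow> (\<forall>k. Ck_on k S f)"


section \<open>Charts, atlases and smooth maps\<close>

type_synonym ('p, 'e) chart = "'p set \<times> ('p \<Rightarrow> 'e)"

definition chart_inv :: "('p, 'e) chart \<Rightarrow> 'e \<Rightarrow> 'p" where
  "chart_inv c = inv_into (fst c) (snd c)"

definition is_chart :: "('p::topological_space, 'e::euclidean_space) chart \<Rightarrow> bool" where
  "is_chart c \<longleftrightarrow> open (fst c) \<and> open (snd c ` fst c) \<and>
     homeomorphism (fst c) (snd c ` fst c) (snd c) (chart_inv c)"

definition smooth_atlas ::
    "('p::{t2_space, second_countable_topology}, 'e::euclidean_space) chart set \<Rightarrow> bool" where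
  "smooth_atlas A \<longleftrightarrow> (\<forall>c\<in>A. is_chart c) \<and> (\<Union>c\<in>A. fst c) = UNIV \<and>
     (\<forall>c\<in>A. \<forall>d\<in>A. smooth_on (snd c ` (fst c \<inter> fst d)) (snd d \<circ> chart_inv c))"

definition euclidean_atlas :: "('e::euclidean_space, 'e) chart set" where
  "euclidean_atlas = {(UNIV, \<lambda>x. x)}"

text \<open>Smoothness of \<open>f\<close> on an open subset \<open>W\<close> of a manifold; continuity makes the sets on which
  the coordinate expressions are required to be smooth open.\<close>

definition smooth_map_on ::
    "('p::topological_space, 'e::euclidean_space) chart set \<Rightarrow>
     ('q::topological_space, 'f::euclidean_space) chart set \<Rightarrow> 'p set \<Rightarrow> ('p \<Rightarrow> 'q) \<Rightarrow> bool" where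
  "smooth_map_on A B W f \<longleftrightarrow> continuous_on W f \<and>
     (\<forall>c\<in>A. \<forall>d\<in>B. smooth_on (snd c ` (W \<inter> fst c \<inter> f -` fst d)) (snd d \<circ> f \<circ> chart_inv c))"


section \<open>Tangent and cotangent vectors\<close>

text \<open>
  The tangent space at every point \<open>p\<close> is the model space \<open>'e\<close>, a vector being identified with its
  coordinates in one chart \<open>chart_at A p\<close> around \<open>p\<close> chosen once and for all.  Thus \<open>TM\<close> is the type
  \<open>'p \<times> 'e\<close> and \<open>T\<^sup>*M\<close> the type \<open>'p \<times> ('e \<Rightarrow>\<^sub>L real)\<close>.  Their smooth structures are those given by
  \<open>tangent_coord\<close> and \<open>cotangent_coord\<close> below; the product topology of the types is never used.
\<close>

definition chart_at :: "('p, 'e) chart set \<Rightarrow> 'p \<Rightarrow> ('p, 'e) chart" where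
  "chart_at A p = (SOME c. c \<in> A \<and> p \<in> fst c)"

text \<open>The coordinates in the chart \<open>c\<close> of a tangent vector at \<open>p\<close>, and conversely the tangent vector
  at \<open>p\<close> with given coordinates in \<open>c\<close>.\<close>

definition tangent_coord ::
    "('p, 'e::euclidean_space) chart set \<Rightarrow> ('p, 'e) chart \<Rightarrow> 'p \<Rightarrow> 'e \<Rightarrow> 'e" where
  "tangent_coord A c p =
     frechet_derivative (snd c \<circ> chart_inv (chart_at A p)) (at (snd (chart_at A p) p))"

definition tangent_of_coord ::
    "('p, 'e::euclidean_space) chart set \<Rightarrow> ('p, 'e) chart \<Rightarrow> 'p \<Rightarrow> 'e \<Rightarrow> 'e" where
  "tangent_of_coord A c p =
     frechet_derivative (snd (chart_at A p) \<circ> chart_inv c) (at (snd c p))"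

definition differential ::
    "('p, 'e::euclidean_space) chart set \<Rightarrow> ('q, 'f::euclidean_space) chart set \<Rightarrow>
     ('p \<Rightarrow> 'q) \<Rightarrow> 'p \<Rightarrow> 'e \<Rightarrow> 'f" where
  "differential A B f p =
     frechet_derivative (snd (chart_at B (f p)) \<circ> f \<circ> chart_inv (chart_at A p))
       (at (snd (chart_at A p) p))"

definition tangent_map ::
    "('p, 'e::euclidean_space) chart set \<Rightarrow> ('q, 'f::euclidean_space) chart set \<Rightarrow>
     ('p \<Rightarrow> 'q) \<Rightarrow> 'p \<times> 'e \<Rightarrow> 'q \<times> 'f" where
  "tangent_map A B f = (\<lambda>(p, v). (f p, differential A B f p v))"

text \<open>Canonical coordinates \<open>(x, \<xi>)\<close> on \<open>T\<^sup>*M\<close> over the chart \<open>c\<close>: with \<open>x\<^sub>b = x \<bullet> b\<close> and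
  \<open>\<xi>\<^sub>b = \<xi> \<bullet> b\<close> for \<open>b \<in> Basis\<close>, they belong to the covector \<open>\<Sum>\<^sub>b \<xi>\<^sub>b dx\<^sub>b\<close> at the point with
  coordinates \<open>x\<close>.\<close>

definition cotangent_coord ::
    "('p, 'e::euclidean_space) chart set \<Rightarrow> ('p, 'e) chart \<Rightarrow> 'p \<times> ('e \<Rightarrow>\<^sub>L real) \<Rightarrow> 'e \<times> 'e" where
  "cotangent_coord A c = (\<lambda>(p, \<alpha>).
     (snd c p, \<Sum>b\<in>Basis. blinfun_apply \<alpha> (tangent_of_coord A c p b) *\<^sub>R b))"

definition cotangent_of_coord ::
    "('p, 'e::euclidean_space) chart set \<Rightarrow> ('p, 'e) chart \<Rightarrow> 'e \<times> 'e \<Rightarrow> 'p \<times> ('e \<Rightarrow>\<^sub>L real)" where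
  "cotangent_of_coord A c = (\<lambda>(x, \<xi>).
     (chart_inv c x, Blinfun (\<lambda>v. \<xi> \<bullet> tangent_coord A c (chart_inv c x) v)))"

definition smooth_on_cotangent ::
    "('p, 'e::euclidean_space) chart set \<Rightarrow> ('p \<times> ('e \<Rightarrow>\<^sub>L real) \<Rightarrow> real) \<Rightarrow> bool" where
  "smooth_on_cotangent A f \<longleftrightarrow>
     (\<forall>c\<in>A. smooth_on ((snd c ` fst c) \<times> UNIV) (f \<circ> cotangent_of_coord A c))"

text \<open>The canonical Poisson bracket
  \<open>\<Sum>\<^sub>b (\<partial>f\<^sub>1/\<partial>x\<^sub>b \<partial>f\<^sub>2/\<partial>\<xi>\<^sub>b - \<partial>f\<^sub>1/\<partial>\<xi>\<^sub>b \<partial>f\<^sub>2/\<partial>x\<^sub>b)\<close>, evaluated at a covector over \<open>p\<close> in the canonical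
  coordinates of the chart \<open>chart_at A p\<close>; as usual the value is the same in all charts.\<close>

definition poisson_bracket ::
    "('p, 'e::euclidean_space) chart set \<Rightarrow> ('p \<times> ('e \<Rightarrow>\<^sub>L real) \<Rightarrow> real) \<Rightarrow>
     ('p \<times> ('e \<Rightarrow>\<^sub>L real) \<Rightarrow> real) \<Rightarrow> 'p \<times> ('e \<Rightarrow>\<^sub>L real) \<Rightarrow> real" where
  "poisson_bracket A f\<^sub>1 f\<^sub>2 z =
     (let c = chart_at A (fst z);
          D\<^sub>1 = frechet_derivative (f\<^sub>1 \<circ> cotangent_of_coord A c) (at (cotangent_coord A c z));
          D\<^sub>2 = frechet_derivative (f\<^sub>2 \<circ> cotangent_of_coord A c) (at (cotangent_coord A c z))
      in \<Sum>b\<in>Basis. D\<^sub>1 (b, 0) * D\<^sub>2 (0, b) - D\<^sub>1 (0, b) * D\<^sub>2 (b, 0))"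

definition poisson_map ::
    "('q, 'f::euclidean_space) chart set \<Rightarrow> ('p, 'e::euclidean_space) chart set \<Rightarrow>
     ('q \<times> ('f \<Rightarrow>\<^sub>L real) \<Rightarrow> 'p \<times> ('e \<Rightarrow>\<^sub>L real)) \<Rightarrow> bool" where
  "poisson_map B A \<phi> \<longleftrightarrow>
     (\<forall>f\<^sub>1 f\<^sub>2. smooth_on_cotangent A f\<^sub>1 \<longrightarrow> smooth_on_cotangent A f\<^sub>2 \<longrightarrow>
        poisson_bracket B (f\<^sub>1 \<circ> \<phi>) (f\<^sub>2 \<circ> \<phi>) = poisson_bracket A f\<^sub>1 f\<^sub>2 \<circ> \<phi>)"


section \<open>Distributions\<close>

text \<open>An integral manifold of the distribution \<open>D\<close>, as an injectively immersed submanifold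
  parametrised by an open subset \<open>W\<close> of the Euclidean space \<open>'k\<close>; since \<open>ds\<^sub>x\<close> is required to be an
  isomorphism onto \<open>D (s x)\<close>, the rank of \<open>D\<close> there is \<open>DIM('k)\<close>.\<close>

definition integral_manifold ::
    "('q::topological_space, 'f::euclidean_space) chart set \<Rightarrow> ('q \<Rightarrow> 'f set) \<Rightarrow>
     'k::euclidean_space set \<Rightarrow> ('k \<Rightarrow> 'q) \<Rightarrow> bool" where
  "integral_manifold B D W s \<longleftrightarrow> open W \<and> inj_on s W \<and> smooth_map_on euclidean_atlas B W s \<and>
     (\<forall>x\<in>W. inj (differential euclidean_atlas B s x) \<and>
             range (differential euclidean_atlas B s x) = D (s x))"

text \<open>A distribution of rank \<open>DIM('k)\<close> is integrable if every point lies on an integral manifold.\<close>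

definition integrable_distribution ::
    "'k::euclidean_space itself \<Rightarrow> ('q::topological_space, 'f::euclidean_space) chart set \<Rightarrow>
     ('q \<Rightarrow> 'f set) \<Rightarrow> bool" where
  "integrable_distribution (_ :: 'k itself) B D \<longleftrightarrow>
     (\<forall>q. \<exists>(W :: 'k set) s. integral_manifold B D W s \<and> q \<in> s ` W)"


section \<open>Riemannian metrics and Riemannian submersions\<close>

text \<open>\<open>g p\<close> is the inner product on the tangent space at \<open>p\<close>, curried, so that \<open>g p v\<close> is the
  covector \<open>g(v, \<cdot>)\<close>.\<close>

definition riemannian_metric ::
    "('p, 'e::euclidean_space) chart set \<Rightarrow> ('p \<Rightarrow> 'e \<Rightarrow>\<^sub>L 'e \<Rightarrow>\<^sub>L real) \<Rightarrow> bool" where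
  "riemannian_metric A g \<longleftrightarrow>
     (\<forall>p v w. g p v w = g p w v) \<and> (\<forall>p v. v \<noteq> 0 \<longrightarrow> g p v v > 0) \<and>
     (\<forall>c\<in>A. \<forall>v w. smooth_on (snd c ` fst c)
        (\<lambda>x. let p = chart_inv c x in g p (tangent_of_coord A c p v) (tangent_of_coord A c p w)))"

definition flat :: "('p \<Rightarrow> 'e \<Rightarrow>\<^sub>L 'e \<Rightarrow>\<^sub>L real) \<Rightarrow> 'p \<times> 'e::euclidean_space \<Rightarrow> 'p \<times> ('e \<Rightarrow>\<^sub>L real)" where
  "flat g = (\<lambda>(p, v). (p, blinfun_apply (g p) v))"

definition horizontal ::
    "('q, 'f::euclidean_space) chart set \<Rightarrow> ('q \<Rightarrow> 'f \<Rightarrow>\<^sub>L 'f \<Rightarrow>\<^sub>L real) \<Rightarrow>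
     ('p, 'e::euclidean_space) chart set \<Rightarrow> ('q \<Rightarrow> 'p) \<Rightarrow> 'q \<Rightarrow> 'f set" where
  "horizontal B h A \<pi> q = {v. \<forall>w. differential B A \<pi> q w = 0 \<longrightarrow> h q v w = 0}"

definition smooth_submersion ::
    "('q::topological_space, 'f::euclidean_space) chart set \<Rightarrow>
     ('p::topological_space, 'e::euclidean_space) chart set \<Rightarrow> ('q \<Rightarrow> 'p) \<Rightarrow> bool" where
  "smooth_submersion B A \<pi> \<longleftrightarrow>
     smooth_map_on B A UNIV \<pi> \<and> (\<forall>q. surj (differential B A \<pi> q))"

definition riemannian_submersion ::
    "('q::topological_space, 'f::euclidean_space) chart set \<Rightarrow> ('q \<Rightarrow> 'f \<Rightarrow>\<^sub>L 'f \<Rightarrow>\<^sub>L real) \<Rightarrow>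
     ('p::topological_space, 'e::euclidean_space) chart set \<Rightarrow> ('p \<Rightarrow> 'e \<Rightarrow>\<^sub>L 'e \<Rightarrow>\<^sub>L real) \<Rightarrow>
     ('q \<Rightarrow> 'p) \<Rightarrow> bool" where
  "riemannian_submersion B h A g \<pi> \<longleftrightarrow> smooth_submersion B A \<pi> \<and>
     (\<forall>q. differential B A \<pi> q ` horizontal B h A \<pi> q = UNIV \<and>
          (\<forall>v\<in>horizontal B h A \<pi> q. \<forall>w\<in>horizontal B h A \<pi> q.
             g (\<pi> q) (differential B A \<pi> q v) (differential B A \<pi> q w) = h q v w))"

definition cotangent_pushforward ::
    "('q, 'f::euclidean_space) chart set \<Rightarrow> ('q \<Rightarrow> 'f \<Rightarrow>\<^sub>L 'f \<Rightarrow>\<^sub>L real) \<Rightarrow>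
     ('p, 'e::euclidean_space) chart set \<Rightarrow> ('p \<Rightarrow> 'e \<Rightarrow>\<^sub>L 'e \<Rightarrow>\<^sub>L real) \<Rightarrow>
     ('q \<Rightarrow> 'p) \<Rightarrow> 'q \<times> ('f \<Rightarrow>\<^sub>L real) \<Rightarrow> 'p \<times> ('e \<Rightarrow>\<^sub>L real)" where
  "cotangent_pushforward B h A g \<pi> = flat g \<circ> tangent_map B A \<pi> \<circ> inv (flat h)"

end

theory Submission
  imports Defs
begin

text \<open>
  The pushforward \<open>\<phi>\<close> is fibrewise the transpose of the horizontal lift: it sends a covector \<open>\<alpha>\<close> at \<open>q\<close>
  to the covector \<open>\<alpha> \<circ> lift q\<close> at \<open>\<pi> q\<close>. In canonical coordinates, pulling back along \<open>\<phi>\<close> therefore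
  changes the Poisson bracket exactly by the pairing of the covector with the commutator of the lifts
  of two coordinate vector fields, so \<open>\<phi>\<close> is Poisson iff these lifts commute; the fibre gradients of
  two test functions at a covector can be prescribed with the help of a bump function.

  An integral manifold \<open>\<sigma>\<close> satisfies \<open>D\<sigma> = L(\<sigma>) \<circ> D(\<pi> \<circ> \<sigma>)\<close>, with \<open>L\<close> the lift in coordinates, and the
  symmetry of the second derivatives of \<open>\<sigma>\<close> and \<open>\<pi> \<circ> \<sigma>\<close> says that the lifts commute. Conversely, if
  they commute, the total differential equation \<open>D\<sigma> = L(\<sigma>)\<close> is solved along the rays from the
  origin by a fixed point argument, and commutation shows that the radial solution solves the full
  equation; it is injective, since \<open>\<pi> \<circ> \<sigma>\<close> is a translation in coordinates.
\<close>

section \<open>Calculus of smooth functions\<close>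

text \<open>Integrability amounts to vanishing commutators because the lifts of two coordinate
  fields are \<pi>-related to commuting fields: their bracket is always vertical, so it is
  horizontal only if it is zero. The lift is chosen pointwise, so its smoothness has to be earned:
  h(v, lift u) = g(d\<pi> v, u) expresses it through the inverse Gram matrix of \<open>h\<close>,
  and inverting a smooth family of linear maps preserves smoothness. Tangent vectors and brackets
  are read in one preferred chart per point, whereas the differential equation lives in a single
  chart over an open set. Flatness must therefore be carried between charts, which succeeds because
  second derivatives of transition maps are symmetric. Solving along rays yields radial derivatives
  only. Flatness bounds the error of the first-order expansion in an arbitrary increment by a
  multiple of its squared norm, and this bound is itself differentiability. In the direction from
  Poisson to flat, the covector is taken to be the commutator \<xi> itself, so the defect of the
  bracket becomes a nonzero multiple of |\<xi>|^2.\<close>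

abbreviation fderiv :: "('a::real_normed_vector \<Rightarrow> 'b::real_normed_vector) \<Rightarrow> 'a \<Rightarrow> 'a \<Rightarrow> 'b" where
  "fderiv f x \<equiv> frechet_derivative f (at x)"

lemma fderiv_eqI: "(f has_derivative f') (at x) \<Longrightarrow> fderiv f x = f'"
  using frechet_derivative_at by metis

lemma has_fderiv: "f differentiable at x \<Longrightarrow> (f has_derivative fderiv f x) (at x)"
  using frechet_derivative_works by blast

lemma fderiv_cong:
  assumes "open S" "x \<in> S" "\<And>y. y \<in> S \<Longrightarrow> f y = g y"
  shows "fderiv f x = fderiv g x"
proof -
  have "(f has_derivative f') (at x) \<longleftrightarrow> (g has_derivative f') (at x)" for f'
    using assms by (metis has_derivative_transform_within_open)
  then show ?thesis
    unfolding frechet_derivative_def by simp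
qed

lemma linear_basis_expansion:
  fixes T :: "'a::euclidean_space \<Rightarrow> 'b::real_vector"
  assumes "linear T"
  shows "T w = (\<Sum>b\<in>Basis. (w \<bullet> b) *\<^sub>R T b)"
  by (metis (no_types, lifting) assms euclidean_representation linear_sum linear_cmul sum.cong)

section \<open>Closure properties of the classes \<open>Ck_on k\<close>\<close>

lemma Ck_on_cong:
  assumes "open S" "\<And>x. x \<in> S \<Longrightarrow> f x = g x" "Ck_on k S f"
  shows "Ck_on k S g"
  using assms(2,3)
proof (induction k arbitrary: f g)
  case 0
  then show ?case by (simp cong: continuous_on_cong)
next
  case (Suc k)
  have "g differentiable at x" if "x \<in> S" for x
    using Suc.prems that assms(1) by (metis Ck_on.simps(2) differentiable_def has_derivative_transform_within_open)
  moreover have "Ck_on k S (\<lambda>x. fderiv g x v)" for v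
  proof (rule Suc.IH)
    show "fderiv f x v = fderiv g x v" if "x \<in> S" for x
      using fderiv_cong[OF assms(1) that, of f g] Suc.prems(1) by simp
    show "Ck_on k S (\<lambda>x. fderiv f x v)"
      using Suc.prems by simp
  qed
  ultimately show ?case by simp
qed

lemma Ck_on_subset: "Ck_on k S f \<Longrightarrow> T \<subseteq> S \<Longrightarrow> Ck_on k T f"
  by (induction k arbitrary: f) (auto intro: continuous_on_subset)

lemma Ck_on_local:
  assumes "\<And>x. x \<in> S \<Longrightarrow> \<exists>T. open T \<and> x \<in> T \<and> Ck_on k T f"
  shows "Ck_on k S f"
  using assms
proof (induction k arbitrary: f)
  case 0
  then show ?case
    by (metis Ck_on.simps(1) continuous_at_imp_continuous_on continuous_on_eq_continuous_at)
next
  case (Suc k)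
  have "f differentiable at x" if "x \<in> S" for x
    using Suc.prems[OF that] by auto
  moreover have "Ck_on k S (\<lambda>x. fderiv f x v)" for v
    using Suc.prems by (intro Suc.IH) (metis Ck_on.simps(2))
  ultimately show ?case by simp
qed

text \<open>\<open>Ck_on (Suc k)\<close> does not mention the lower orders; they return because
  differentiability gives continuity at the bottom of the induction.\<close>

lemma Ck_on_SucD: "Ck_on (Suc k) S f \<Longrightarrow> Ck_on k S f"
proof (induction k arbitrary: f)
  case 0
  then show ?case
    by (auto intro!: continuous_at_imp_continuous_on differentiable_imp_continuous_within)
next
  case (Suc k)
  then show ?case by (metis Ck_on.simps(2))
qed

lemma Ck_on_const: "Ck_on k S (\<lambda>x. c)"
  by (induction k arbitrary: c) auto

lemma Ck_on_linear: "bounded_linear f \<Longrightarrow> Ck_on k S f"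
proof (cases k)
  case (Suc j)
  assume f: "bounded_linear f"
  then have "fderiv f x = f" for x
    by (intro fderiv_eqI bounded_linear_imp_has_derivative)
  then show ?thesis
    using f Suc by (simp add: Ck_on_const bounded_linear_imp_differentiable)
qed (simp add: linear_continuous_on)

lemma Ck_on_add:
  assumes "Ck_on k S f" "Ck_on k S g" "open S"
  shows "Ck_on k S (\<lambda>x. f x + g x)"
  using assms(1,2)
proof (induction k arbitrary: f g)
  case 0
  then show ?case by (simp add: continuous_on_add)
next
  case (Suc k)
  have "Ck_on k S (\<lambda>x. fderiv (\<lambda>x. f x + g x) x v)" for v
  proof (rule Ck_on_cong[OF assms(3)])
    show "Ck_on k S (\<lambda>x. fderiv f x v + fderiv g x v)"
      using Suc by simp
    show "fderiv f x v + fderiv g x v = fderiv (\<lambda>x. f x + g x) x v" if "x \<in> S" for x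
      using Suc.prems that
      by (subst fderiv_eqI[OF has_derivative_add[OF has_fderiv has_fderiv]]) auto
  qed
  then show ?case using Suc.prems by simp
qed

lemma Ck_on_bilinear:
  assumes "bounded_bilinear pr" "Ck_on k S f" "Ck_on k S g" "open S"
  shows "Ck_on k S (\<lambda>x. pr (f x) (g x))"
  using assms(2,3)
proof (induction k arbitrary: f g)
  case 0
  then show ?case by (simp add: bounded_bilinear.continuous_on[OF assms(1)])
next
  case (Suc k)
  have d: "((\<lambda>x. pr (f x) (g x)) has_derivative
      (\<lambda>v. pr (f x) (fderiv g x v) + pr (fderiv f x v) (g x))) (at x)" if "x \<in> S" for x
    using Suc.prems that by (intro bounded_bilinear.FDERIV[OF assms(1)] has_fderiv) auto
  have "Ck_on k S (\<lambda>x. fderiv (\<lambda>x. pr (f x) (g x)) x v)" for v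
  proof (rule Ck_on_cong[OF assms(4)])
    show "Ck_on k S (\<lambda>x. pr (f x) (fderiv g x v) + pr (fderiv f x v) (g x))"
      using Suc.prems Ck_on_SucD[of k S f] Ck_on_SucD[of k S g] by (intro Ck_on_add Suc.IH assms) auto
    show "pr (f x) (fderiv g x v) + pr (fderiv f x v) (g x) = fderiv (\<lambda>x. pr (f x) (g x)) x v"
      if "x \<in> S" for x
      using fderiv_eqI[OF d[OF that]] by simp
  qed
  then show ?case using d by (auto simp: differentiable_def)
qed

lemma Ck_on_sum:
  assumes "\<And>i. i \<in> I \<Longrightarrow> Ck_on k S (f i)" "open S"
  shows "Ck_on k S (\<lambda>x. \<Sum>i\<in>I. f i x)"
  using assms(1) by (induction I rule: infinite_finite_induct) (auto simp: Ck_on_const Ck_on_add assms(2))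

text \<open>The chain rule produces \<open>fderiv f (g x)\<close> in the direction
  \<open>fderiv g x v\<close>, which moves with \<open>x\<close>, while the induction hypothesis
  handles fixed directions only. Expanding the direction in a basis separates the two dependences,
  hence the Euclidean intermediate space.\<close>

lemma Ck_on_compose:
  fixes g :: "'a::real_normed_vector \<Rightarrow> 'b::euclidean_space"
  assumes "Ck_on k T f" "Ck_on k S g" "g ` S \<subseteq> T" "open S" "open T"
  shows "Ck_on k S (\<lambda>x. f (g x))"
  using assms(1,2)
proof (induction k arbitrary: f)
  case 0
  then show ?case using continuous_on_compose2[of T f S g] assms(3) by simp
next
  case (Suc k)
  have d: "((\<lambda>x. f (g x)) has_derivative (\<lambda>v. fderiv f (g x) (fderiv g x v))) (at x)" if "x \<in> S" for x
    using Suc.prems that assms(3) by (intro has_derivative_compose[OF has_fderiv has_fderiv]) auto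
  have "Ck_on k S (\<lambda>x. fderiv (\<lambda>x. f (g x)) x v)" for v
  proof (rule Ck_on_cong[OF assms(4)])
    have f: "Ck_on k S (\<lambda>x. fderiv f (g x) b)" for b
      using Suc.prems Ck_on_SucD[of k S g] Suc.IH[of "\<lambda>y. fderiv f y b"] by simp
    have g: "Ck_on k S (\<lambda>x. fderiv g x v)"
      using Suc.prems by simp
    show "Ck_on k S (\<lambda>x. \<Sum>b\<in>Basis. (fderiv g x v \<bullet> b) *\<^sub>R fderiv f (g x) b)"
      by (rule Ck_on_sum[OF Ck_on_bilinear[OF bounded_bilinear_scaleR
              Ck_on_bilinear[OF bounded_bilinear_inner g Ck_on_const assms(4)] f assms(4)] assms(4)])
    show "(\<Sum>b\<in>Basis. (fderiv g x v \<bullet> b) *\<^sub>R fderiv f (g x) b) = fderiv (\<lambda>x. f (g x)) x v"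
      if "x \<in> S" for x
    proof -
      have "linear (fderiv f (g x))"
        using Suc.prems that assms(3) by (intro linear_frechet_derivative) auto
      then show ?thesis
        unfolding fderiv_eqI[OF d[OF that]] by (rule linear_basis_expansion[symmetric])
    qed
  qed
  then show ?case using d by (auto simp: differentiable_def)
qed

lemma smooth_on_cong:
  "open S \<Longrightarrow> (\<And>x. x \<in> S \<Longrightarrow> f x = g x) \<Longrightarrow> smooth_on S f \<Longrightarrow> smooth_on S g"
  unfolding smooth_on_def using Ck_on_cong by blast

lemma smooth_on_subset: "smooth_on S f \<Longrightarrow> T \<subseteq> S \<Longrightarrow> smooth_on T f"
  unfolding smooth_on_def using Ck_on_subset by blast

lemma smooth_on_local:
  assumes "\<And>x. x \<in> S \<Longrightarrow> \<exists>T. open T \<and> x \<in> T \<and> smooth_on T f"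
  shows "smooth_on S f"
  unfolding smooth_on_def
proof
  show "Ck_on k S f" for k
    by (rule Ck_on_local) (use assms in \<open>auto simp: smooth_on_def\<close>)
qed

lemma smooth_on_const: "smooth_on S (\<lambda>x. c)"
  by (simp add: smooth_on_def Ck_on_const)

lemma smooth_on_linear: "bounded_linear f \<Longrightarrow> smooth_on S f"
  by (simp add: smooth_on_def Ck_on_linear)

lemma smooth_on_add: "smooth_on S f \<Longrightarrow> smooth_on S g \<Longrightarrow> open S \<Longrightarrow> smooth_on S (\<lambda>x. f x + g x)"
  by (simp add: smooth_on_def Ck_on_add)

lemma smooth_on_sum:
  "(\<And>i. i \<in> I \<Longrightarrow> smooth_on S (f i)) \<Longrightarrow> open S \<Longrightarrow> smooth_on S (\<lambda>x. \<Sum>i\<in>I. f i x)"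
  by (simp add: smooth_on_def Ck_on_sum)

lemma smooth_on_bilinear:
  "bounded_bilinear pr \<Longrightarrow> smooth_on S f \<Longrightarrow> smooth_on S g \<Longrightarrow> open S \<Longrightarrow>
    smooth_on S (\<lambda>x. pr (f x) (g x))"
  by (simp add: smooth_on_def Ck_on_bilinear)

lemmas smooth_on_scaleR = smooth_on_bilinear[OF bounded_bilinear_scaleR]
lemmas smooth_on_inner = smooth_on_bilinear[OF bounded_bilinear_inner]
lemmas smooth_on_mult = smooth_on_bilinear[OF bounded_bilinear_mult]

lemma smooth_on_compose:
  fixes g :: "'a::real_normed_vector \<Rightarrow> 'b::euclidean_space"
  shows "smooth_on T f \<Longrightarrow> smooth_on S g \<Longrightarrow> g ` S \<subseteq> T \<Longrightarrow> open S \<Longrightarrow> open T \<Longrightarrow>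
    smooth_on S (\<lambda>x. f (g x))"
  unfolding smooth_on_def using Ck_on_compose by blast

lemma smooth_on_iff_fderiv:
  "smooth_on S f \<longleftrightarrow>
    (\<forall>x\<in>S. f differentiable at x) \<and> (\<forall>v. smooth_on S (\<lambda>x. fderiv f x v))"
proof
  assume "smooth_on S f"
  then have "Ck_on (Suc k) S f" for k
    unfolding smooth_on_def by blast
  then show "(\<forall>x\<in>S. f differentiable at x) \<and> (\<forall>v. smooth_on S (\<lambda>x. fderiv f x v))"
    by (auto simp: smooth_on_def)
next
  assume "(\<forall>x\<in>S. f differentiable at x) \<and> (\<forall>v. smooth_on S (\<lambda>x. fderiv f x v))"
  then have "Ck_on (Suc k) S f" for k
    by (auto simp: smooth_on_def)
  then show "smooth_on S f"
    unfolding smooth_on_def using Ck_on_SucD by blast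
qed

lemma smooth_on_differentiable: "smooth_on S f \<Longrightarrow> x \<in> S \<Longrightarrow> f differentiable at x"
  and smooth_on_fderiv: "smooth_on S f \<Longrightarrow> smooth_on S (\<lambda>x. fderiv f x v)"
  using smooth_on_iff_fderiv by blast+

lemma smooth_on_has_fderiv: "smooth_on S f \<Longrightarrow> x \<in> S \<Longrightarrow> (f has_derivative fderiv f x) (at x)"
  by (rule has_fderiv) (rule smooth_on_differentiable)

lemma smooth_on_linear_fderiv: "smooth_on S f \<Longrightarrow> x \<in> S \<Longrightarrow> linear (fderiv f x)"
  by (rule linear_frechet_derivative) (rule smooth_on_differentiable)

lemma smooth_on_continuous_on: "smooth_on S f \<Longrightarrow> continuous_on S f"
  unfolding smooth_on_def by (metis Ck_on.simps(1))

lemma smooth_on_componentwise: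
  fixes f :: "'a::real_normed_vector \<Rightarrow> 'b::euclidean_space"
  assumes "\<And>b. b \<in> Basis \<Longrightarrow> smooth_on S (\<lambda>x. f x \<bullet> b)" "open S"
  shows "smooth_on S f"
proof (rule smooth_on_cong[OF assms(2)])
  show "smooth_on S (\<lambda>x. \<Sum>b\<in>Basis. (f x \<bullet> b) *\<^sub>R b)"
    by (intro smooth_on_sum smooth_on_scaleR smooth_on_const assms)
qed (simp add: euclidean_representation)

subsection \<open>Smooth families of linear maps\<close>

text \<open>Families of linear maps are kept as functions \<open>T x w\<close> that are smooth in
  \<open>x\<close> for each fixed \<open>w\<close>, never as maps into an operator space. A moving
  argument is handled by expanding it in the basis; the same device gives the product rule
  \<open>has_derivative_family_apply\<close>.\<close>

lemma smooth_on_family_apply: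
  fixes T :: "'a::real_normed_vector \<Rightarrow> 'b::euclidean_space \<Rightarrow> 'c::real_normed_vector"
  assumes "open S" "\<And>x. x \<in> S \<Longrightarrow> linear (T x)" "\<And>w. smooth_on S (\<lambda>x. T x w)" "smooth_on S v"
  shows "smooth_on S (\<lambda>x. T x (v x))"
proof (rule smooth_on_cong[OF assms(1)])
  show "smooth_on S (\<lambda>x. \<Sum>b\<in>Basis. (v x \<bullet> b) *\<^sub>R T x b)"
    by (intro smooth_on_sum smooth_on_scaleR smooth_on_inner smooth_on_const assms)
qed (rule linear_basis_expansion[OF assms(2), symmetric])

lemma fderiv_family_expansion:
  fixes T :: "'a::real_normed_vector \<Rightarrow> 'b::euclidean_space \<Rightarrow> 'c::real_normed_vector"
  assumes "open S" "x \<in> S" "\<And>y. y \<in> S \<Longrightarrow> linear (T y)" "\<And>w. (\<lambda>y. T y w) differentiable at x"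
  shows "fderiv (\<lambda>y. T y w) x u = (\<Sum>b\<in>Basis. (w \<bullet> b) *\<^sub>R fderiv (\<lambda>y. T y b) x u)"
proof -
  have "((\<lambda>y. \<Sum>b\<in>Basis. (w \<bullet> b) *\<^sub>R T y b) has_derivative
      (\<lambda>u. \<Sum>b\<in>Basis. (w \<bullet> b) *\<^sub>R fderiv (\<lambda>y. T y b) x u)) (at x)"
    by (intro has_derivative_sum has_derivative_scaleR_right has_fderiv assms)
  from fderiv_eqI[OF this]
  have "fderiv (\<lambda>y. \<Sum>b\<in>Basis. (w \<bullet> b) *\<^sub>R T y b) x u =
      (\<Sum>b\<in>Basis. (w \<bullet> b) *\<^sub>R fderiv (\<lambda>y. T y b) x u)"
    by simp
  moreover have "fderiv (\<lambda>y. T y w) x = fderiv (\<lambda>y. \<Sum>b\<in>Basis. (w \<bullet> b) *\<^sub>R T y b) x"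
    by (rule fderiv_cong[OF assms(1,2)]) (rule linear_basis_expansion[OF assms(3)])
  ultimately show ?thesis
    by simp
qed

lemma fderiv_family_linear:
  fixes T :: "'a::real_normed_vector \<Rightarrow> 'b::euclidean_space \<Rightarrow> 'c::real_normed_vector"
  assumes "open S" "x \<in> S" "\<And>y. y \<in> S \<Longrightarrow> linear (T y)" "\<And>w. (\<lambda>y. T y w) differentiable at x"
  shows "linear (\<lambda>w. fderiv (\<lambda>y. T y w) x u)"
  by (subst fderiv_family_expansion[OF assms])
    (auto intro!: linearI simp: inner_add_left scaleR_add_left sum.distrib scaleR_sum_right)

lemma has_derivative_family_apply:
  fixes T :: "'a::real_normed_vector \<Rightarrow> 'b::euclidean_space \<Rightarrow> 'c::real_normed_vector"
  assumes "open S" "x \<in> S" "\<And>y. y \<in> S \<Longrightarrow> linear (T y)" "\<And>w. (\<lambda>y. T y w) differentiable at x"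
    and v: "(v has_derivative v') (at x)"
  shows "((\<lambda>y. T y (v y)) has_derivative (\<lambda>u. fderiv (\<lambda>y. T y (v x)) x u + T x (v' u))) (at x)"
proof (rule has_derivative_transform_within_open[OF _ assms(1,2)])
  show "((\<lambda>y. \<Sum>b\<in>Basis. (v y \<bullet> b) *\<^sub>R T y b) has_derivative
      (\<lambda>u. fderiv (\<lambda>y. T y (v x)) x u + T x (v' u))) (at x)"
  proof (rule has_derivative_eq_rhs)
    show "((\<lambda>y. \<Sum>b\<in>Basis. (v y \<bullet> b) *\<^sub>R T y b) has_derivative
        (\<lambda>u. \<Sum>b\<in>Basis. (v x \<bullet> b) *\<^sub>R fderiv (\<lambda>y. T y b) x u + (v' u \<bullet> b) *\<^sub>R T x b)) (at x)"
      by (intro has_derivative_sum has_derivative_scaleR has_derivative_inner_left has_fderiv assms)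
    have "fderiv (\<lambda>y. T y (v x)) x u = (\<Sum>b\<in>Basis. (v x \<bullet> b) *\<^sub>R fderiv (\<lambda>y. T y b) x u)" for u
      by (rule fderiv_family_expansion[OF assms(1-4)])
    moreover have "T x (v' u) = (\<Sum>b\<in>Basis. (v' u \<bullet> b) *\<^sub>R T x b)" for u
      by (rule linear_basis_expansion[OF assms(3)[OF assms(2)]])
    ultimately show "(\<lambda>u. \<Sum>b\<in>Basis. (v x \<bullet> b) *\<^sub>R fderiv (\<lambda>y. T y b) x u + (v' u \<bullet> b) *\<^sub>R T x b) =
        (\<lambda>u. fderiv (\<lambda>y. T y (v x)) x u + T x (v' u))"
      by (simp only: sum.distrib)
  qed
qed (rule linear_basis_expansion[OF assms(3), symmetric])

subsection \<open>First and second order estimates\<close>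

lemma smooth_on_fderiv_bound:
  fixes f :: "'a::euclidean_space \<Rightarrow> 'b::real_normed_vector"
  assumes f: "smooth_on U f" and K: "compact K" "K \<subseteq> U"
  obtains C where "C \<ge> 0" "\<And>x u. x \<in> K \<Longrightarrow> norm (fderiv f x u) \<le> C * norm u"
proof -
  have "\<exists>C. \<forall>x\<in>K. norm (fderiv f x b) \<le> C" for b
  proof -
    have "continuous_on K (\<lambda>x. fderiv f x b)"
      using smooth_on_continuous_on[OF smooth_on_fderiv[OF f]] K(2) continuous_on_subset by blast
    then have "bounded ((\<lambda>x. fderiv f x b) ` K)"
      using K(1) compact_continuous_image compact_imp_bounded by blast
    then show ?thesis
      by (auto simp: bounded_iff)
  qed
  then obtain C where C: "\<And>x b. x \<in> K \<Longrightarrow> norm (fderiv f x b) \<le> C b"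
    by metis
  have "norm (fderiv f x u) \<le> (\<Sum>b\<in>Basis. \<bar>C b\<bar>) * norm u" if "x \<in> K" for x u
  proof -
    have "linear (fderiv f x)"
      using smooth_on_linear_fderiv[OF f] that K(2) by blast
    then have "fderiv f x u = (\<Sum>b\<in>Basis. (u \<bullet> b) *\<^sub>R fderiv f x b)"
      by (rule linear_basis_expansion)
    also have "norm \<dots> \<le> (\<Sum>b\<in>Basis. norm u * \<bar>C b\<bar>)"
    proof (rule sum_norm_le)
      fix b :: 'a assume "b \<in> Basis"
      then have "\<bar>u \<bullet> b\<bar> \<le> norm u"
        by (rule Basis_le_norm)
      moreover have "norm (fderiv f x b) \<le> \<bar>C b\<bar>"
        using C[OF that, of b] by linarith
      ultimately show "norm ((u \<bullet> b) *\<^sub>R fderiv f x b) \<le> norm u * \<bar>C b\<bar>"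
        by (simp add: mult_mono)
    qed
    finally show ?thesis
      by (simp add: sum_distrib_left mult.commute)
  qed
  then show ?thesis
    by (rule that[rotated]) (auto intro: sum_nonneg)
qed

lemma smooth_on_lipschitz_bound:
  fixes f :: "'a::euclidean_space \<Rightarrow> 'b::real_normed_vector"
  assumes f: "smooth_on U f" and K: "compact K" "convex K" "K \<subseteq> U"
  obtains C where "C \<ge> 0" "\<And>x y. x \<in> K \<Longrightarrow> y \<in> K \<Longrightarrow> norm (f y - f x) \<le> C * norm (y - x)"
proof -
  obtain C where C: "C \<ge> 0" "\<And>x u. x \<in> K \<Longrightarrow> norm (fderiv f x u) \<le> C * norm u"
    using smooth_on_fderiv_bound[OF f K(1,3)] by blast
  have "norm (f y - f x) \<le> C * norm (y - x)" if "x \<in> K" "y \<in> K" for x y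
  proof (rule differentiable_bound[OF K(2) _ _ that(2,1)])
    show "(f has_derivative fderiv f z) (at z within K)" if "z \<in> K" for z
      using smooth_on_has_fderiv[OF f] that K(3) has_derivative_at_withinI by blast
    show "onorm (fderiv f z) \<le> C" if "z \<in> K" for z
      using C(2)[OF that] by (rule onorm_le)
  qed
  with C(1) show ?thesis by (rule that)
qed

text \<open>The derivative is Lipschitz on \<open>K\<close>, uniformly over unit directions by
  summing over the basis; the mean value inequality for \<open>f\<close> minus its linearization
  along the segment then gives a quadratic error.\<close>

lemma smooth_on_taylor_bound:
  fixes f :: "'a::euclidean_space \<Rightarrow> 'b::real_normed_vector"
  assumes f: "smooth_on U f" and K: "compact K" "convex K" "K \<subseteq> U"
  obtains C where "C \<ge> 0"
    "\<And>x y. x \<in> K \<Longrightarrow> y \<in> K \<Longrightarrow> norm (f y - f x - fderiv f x (y - x)) \<le> C * (norm (y - x))\<^sup>2"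
proof -
  have "\<exists>C\<ge>0. \<forall>x\<in>K. \<forall>y\<in>K. norm (fderiv f y b - fderiv f x b) \<le> C * norm (y - x)" for b
    using smooth_on_lipschitz_bound[OF smooth_on_fderiv[OF f] K] by metis
  then obtain C where C: "\<And>b. C b \<ge> 0"
    "\<And>b x y. x \<in> K \<Longrightarrow> y \<in> K \<Longrightarrow> norm (fderiv f y b - fderiv f x b) \<le> C b * norm (y - x)"
    by metis
  define C' where "C' = (\<Sum>b\<in>Basis. C b)"
  have C'0: "C' \<ge> 0"
    unfolding C'_def by (intro sum_nonneg C(1))
  have lin: "linear (fderiv f x)" if "x \<in> K" for x
    using smooth_on_linear_fderiv[OF f] that K(3) by blast
  have C': "norm (fderiv f y u - fderiv f x u) \<le> C' * norm (y - x) * norm u" if "x \<in> K" "y \<in> K" for x y u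
  proof -
    have "linear (\<lambda>u. fderiv f y u - fderiv f x u)"
      by (intro linear_compose_sub lin that)
    then have "fderiv f y u - fderiv f x u = (\<Sum>b\<in>Basis. (u \<bullet> b) *\<^sub>R (fderiv f y b - fderiv f x b))"
      by (rule linear_basis_expansion)
    also have "norm \<dots> \<le> (\<Sum>b\<in>Basis. norm u * (C b * norm (y - x)))"
    proof (rule sum_norm_le)
      fix b :: 'a assume "b \<in> Basis"
      then have "\<bar>u \<bullet> b\<bar> \<le> norm u"
        by (rule Basis_le_norm)
      then show "norm ((u \<bullet> b) *\<^sub>R (fderiv f y b - fderiv f x b)) \<le> norm u * (C b * norm (y - x))"
        using C(2)[OF that, of b] by (simp add: mult_mono)
    qed
    finally show ?thesis
      by (simp add: C'_def sum_distrib_left sum_distrib_right mult_ac)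
  qed
  have "norm (f y - f x - fderiv f x (y - x)) \<le> C' * (norm (y - x))\<^sup>2" if xy: "x \<in> K" "y \<in> K" for x y
  proof -
    let ?S = "closed_segment x y"
    have S: "?S \<subseteq> K"
      using xy K(2) by (simp add: closed_segment_subset)
    have "norm (f y - f x - fderiv f x (y - x)) \<le> norm (y - x) * (C' * norm (y - x))"
    proof (rule differentiable_bound_linearization)
      show "x + t *\<^sub>R (y - x) \<in> ?S" if "t \<in> {0..1}" for t
        using that by (auto simp: in_segment algebra_simps intro!: exI[of _ t])
      show "(f has_derivative fderiv f z) (at z within ?S)" if "z \<in> ?S" for z
        using smooth_on_has_fderiv[OF f] that S K(3) has_derivative_at_withinI by blast
      show "x \<in> ?S" by simp
      show "onorm (fderiv f z - fderiv f x) \<le> C' * norm (y - x)" if z: "z \<in> ?S" for z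
      proof (rule onorm_le)
        fix u
        have "norm ((fderiv f z - fderiv f x) u) \<le> C' * norm (z - x) * norm u"
          using C'[OF xy(1), of z u] z S by auto
        also have "norm (z - x) \<le> norm (y - x)"
          using segment_bound1[OF z] by (simp add: norm_minus_commute)
        finally show "norm ((fderiv f z - fderiv f x) u) \<le> C' * norm (y - x) * norm u"
          using C'0 by (simp add: mult_left_mono mult_right_mono)
      qed
    qed
    then show ?thesis
      by (simp add: power2_eq_square mult_ac)
  qed
  with C'0 show ?thesis by (rule that)
qed

section \<open>Symmetry of second derivatives\<close>

lemma mean_value_norm:
  fixes f :: "real \<Rightarrow> 'b::real_normed_vector"
  assumes "\<And>t. t \<in> {0..1} \<Longrightarrow> (f has_vector_derivative f' t) (at t within {0..1})"
    and "\<And>t. t \<in> {0..1} \<Longrightarrow> norm (f' t) \<le> B" and "s \<in> {0..1}"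
  shows "norm (f s - f 0) \<le> B * s"
proof -
  have "norm (f s - f 0) \<le> B * norm (s - 0)"
  proof (rule differentiable_bound[where S = "{0..1}" and f' = "\<lambda>t h. h *\<^sub>R f' t"])
    show "onorm (\<lambda>h. h *\<^sub>R f' t) \<le> B" if "t \<in> {0..1}" for t
      using assms(2)[OF that] by (intro onorm_le) (simp add: mult.commute[of B] mult_left_mono)
  qed (use assms in \<open>auto simp: has_vector_derivative_def\<close>)
  then show ?thesis
    using assms(3) by simp
qed

text \<open>One difference is turned into a derivative by the mean value inequality. The other is a
  difference of values of \<open>g = \<partial>f/\<partial>u\<close> near \<open>x\<close>: in their
  Taylor expansions at \<open>x\<close> the linear parts differ by exactly
  \<open>s *\<^sub>R A\<close>, and the two quadratic remainders cost a factor
  \<open>s\<^sup>2\<close> each besides the outer \<open>s\<close>.\<close>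

lemma second_difference_bound:
  fixes f :: "'a::euclidean_space \<Rightarrow> 'b::real_normed_vector"
  assumes f: "smooth_on U f" and U: "open U" "x \<in> U"
  obtains C d where "C \<ge> 0" "d > 0" "\<And>s. 0 < s \<Longrightarrow> s \<le> d \<Longrightarrow>
    norm (f (x + s *\<^sub>R u + s *\<^sub>R v) - f (x + s *\<^sub>R u) - f (x + s *\<^sub>R v) + f x
      - s\<^sup>2 *\<^sub>R fderiv (\<lambda>y. fderiv f y u) x v) \<le> C * s ^ 3"
proof -
  obtain r where r: "r > 0" "cball x r \<subseteq> U"
    using U open_contains_cball by blast
  define g where "g = (\<lambda>y. fderiv f y u)"
  have g: "smooth_on U g"
    unfolding g_def by (rule smooth_on_fderiv[OF f])
  obtain C where C: "C \<ge> 0" "\<And>y z. y \<in> cball x r \<Longrightarrow> z \<in> cball x r \<Longrightarrow>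
      norm (g z - g y - fderiv g y (z - y)) \<le> C * (norm (z - y))\<^sup>2"
    using smooth_on_taylor_bound[OF g compact_cball convex_cball r(2)] by blast
  \<comment> \<open>\<open>m\<close> bounds all displacements in units of \<open>s\<close>; the
    summand 1 keeps it positive, so that \<open>s \<le> r / m\<close> keeps every point inside the
    ball.\<close>
  define m where "m = norm u + norm v + 1"
  have m: "m > 0" "norm u \<le> m" "norm v \<le> m" "norm u + norm v \<le> m"
    by (auto simp: m_def add_nonneg_pos)
  define A where "A = fderiv g x v"
  have lin: "linear (fderiv g x)"
    using smooth_on_linear_fderiv[OF g U(2)] .
  have "norm (f (x + s *\<^sub>R u + s *\<^sub>R v) - f (x + s *\<^sub>R u) - f (x + s *\<^sub>R v) + f x - s\<^sup>2 *\<^sub>R A)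
      \<le> (2 * C * m\<^sup>2) * s ^ 3" if s: "0 < s" "s \<le> r / m" for s
  proof -
    have sm: "s * m \<le> r"
      using s m by (simp add: field_simps)
    have nb: "norm ((t * s) *\<^sub>R u + s *\<^sub>R v) \<le> s * m" "norm ((t * s) *\<^sub>R u) \<le> s * m" if "t \<in> {0..1}" for t
    proof -
      have "t * s \<le> s"
        using that s by (simp add: mult_left_le_one_le)
      then have a: "norm ((t * s) *\<^sub>R u) \<le> s * norm u"
        using that s by (simp add: mult_right_mono)
      also have "\<dots> \<le> s * m"
        using s m by simp
      finally show "norm ((t * s) *\<^sub>R u) \<le> s * m" .
      have "norm ((t * s) *\<^sub>R u + s *\<^sub>R v) \<le> s * norm u + s * norm v"
        using norm_triangle_mono[OF a, of "s *\<^sub>R v" "s * norm v"] s by simp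
      also have "\<dots> \<le> s * m"
        using s m(4) by (simp flip: distrib_left)
      finally show "norm ((t * s) *\<^sub>R u + s *\<^sub>R v) \<le> s * m" .
    qed
    have gb: "norm (g (x + w) - g x - fderiv g x w) \<le> C * (s * m)\<^sup>2" if "norm w \<le> s * m" for w
    proof -
      have "norm (g (x + w) - g x - fderiv g x (x + w - x)) \<le> C * (norm (x + w - x))\<^sup>2"
        using that sm r(1) by (intro C(2)) (auto simp: dist_norm)
      also have "\<dots> \<le> C * (s * m)\<^sup>2"
        using that C(1) by (intro mult_left_mono power_mono) auto
      finally show ?thesis by simp
    qed
    \<comment> \<open>\<open>\<psi>\<close> interpolates the difference in direction
      \<open>u\<close>, with the expected value \<open>s\<^sup>2 *\<^sub>R A\<close> subtracted at
      constant speed; \<open>\<psi> 1 - \<psi> 0\<close> is the quantity to be bounded.\<close>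
    define \<psi> where "\<psi> t = f (x + ((t * s) *\<^sub>R u + s *\<^sub>R v)) - f (x + (t * s) *\<^sub>R u) - t *\<^sub>R (s\<^sup>2 *\<^sub>R A)" for t
    define \<psi>' where "\<psi>' t = s *\<^sub>R g (x + ((t * s) *\<^sub>R u + s *\<^sub>R v)) - s *\<^sub>R g (x + (t * s) *\<^sub>R u) - s\<^sup>2 *\<^sub>R A" for t
    have df: "((\<lambda>t. f (x + ((t * s) *\<^sub>R u + w))) has_vector_derivative s *\<^sub>R g (x + ((t * s) *\<^sub>R u + w))) (at t)"
      if "norm ((t * s) *\<^sub>R u + w) \<le> s * m" for t w
    proof -
      have "norm (x + ((t * s) *\<^sub>R u + w) - x) \<le> r"
        using that sm by simp
      then have xU: "x + ((t * s) *\<^sub>R u + w) \<in> U"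
        using r(2) by (metis dist_commute dist_norm mem_cball subsetD)
      have 1: "((\<lambda>t. x + ((t * s) *\<^sub>R u + w)) has_derivative (\<lambda>h. (h * s) *\<^sub>R u)) (at t)"
        by (auto intro!: derivative_eq_intros)
      show ?thesis
        unfolding has_vector_derivative_def
        by (rule has_derivative_eq_rhs[OF has_derivative_compose[OF 1 smooth_on_has_fderiv[OF f xU]]])
          (simp add: g_def linear_cmul[OF smooth_on_linear_fderiv[OF f xU]])
    qed
    have "norm (\<psi> 1 - \<psi> 0) \<le> (2 * C * m\<^sup>2 * s ^ 3) * 1"
    proof (rule mean_value_norm)
      fix t :: real assume t: "t \<in> {0..1}"
      have "(\<psi> has_vector_derivative \<psi>' t) (at t)"
        unfolding \<psi>_def \<psi>'_def
        using df[of t "s *\<^sub>R v"] df[of t 0] nb[OF t]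
        by (intro has_vector_derivative_diff) (auto intro!: derivative_eq_intros)
      then show "(\<psi> has_vector_derivative \<psi>' t) (at t within {0..1})"
        by (rule has_vector_derivative_at_within)
      let ?w = "(t * s) *\<^sub>R u"
      have "\<psi>' t = s *\<^sub>R ((g (x + (?w + s *\<^sub>R v)) - g x - fderiv g x (?w + s *\<^sub>R v)) - (g (x + ?w) - g x - fderiv g x ?w))"
        by (simp add: \<psi>'_def A_def linear_add[OF lin] linear_cmul[OF lin] algebra_simps power2_eq_square)
      also have "norm \<dots> \<le> s * (C * (s * m)\<^sup>2 + C * (s * m)\<^sup>2)"
        unfolding norm_scaleR
        using s add_mono[OF gb[OF nb(1)[OF t]] gb[OF nb(2)[OF t]], THEN order_trans[OF norm_triangle_ineq4]]
        by simp
      also have "\<dots> = 2 * C * m\<^sup>2 * s ^ 3"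
        by (simp add: power2_eq_square power3_eq_cube)
      finally show "norm (\<psi>' t) \<le> 2 * C * m\<^sup>2 * s ^ 3" .
    qed auto
    moreover have "\<psi> 1 - \<psi> 0 =
        f (x + s *\<^sub>R u + s *\<^sub>R v) - f (x + s *\<^sub>R u) - f (x + s *\<^sub>R v) + f x - s\<^sup>2 *\<^sub>R A"
      by (simp add: \<psi>_def algebra_simps)
    ultimately show ?thesis by simp
  qed
  then show ?thesis
    using C(1) r(1) m(1) by (intro that[of "2 * C * m\<^sup>2" "r / m"]) (auto simp: A_def g_def)
qed

text \<open>The second difference is symmetric in \<open>u\<close> and \<open>v\<close> and
  approximates \<open>s\<^sup>2\<close> times either mixed derivative up to order
  \<open>s ^ 3\<close>; dividing by \<open>s\<^sup>2\<close> and letting \<open>s\<close> tend to 0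
  identifies the two.\<close>

lemma fderiv_fderiv_commute:
  fixes f :: "'a::euclidean_space \<Rightarrow> 'b::real_normed_vector"
  assumes f: "smooth_on U f" and U: "open U" "x \<in> U"
  shows "fderiv (\<lambda>y. fderiv f y u) x v = fderiv (\<lambda>y. fderiv f y v) x u"
proof -
  define A B where "A = fderiv (\<lambda>y. fderiv f y u) x v" and "B = fderiv (\<lambda>y. fderiv f y v) x u"
  obtain C1 d1 where 1: "C1 \<ge> 0" "d1 > 0" "\<And>s. 0 < s \<Longrightarrow> s \<le> d1 \<Longrightarrow>
    norm (f (x + s *\<^sub>R u + s *\<^sub>R v) - f (x + s *\<^sub>R u) - f (x + s *\<^sub>R v) + f x - s\<^sup>2 *\<^sub>R A) \<le> C1 * s ^ 3"
    using second_difference_bound[OF assms, of u v] unfolding A_def by blast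
  obtain C2 d2 where 2: "C2 \<ge> 0" "d2 > 0" "\<And>s. 0 < s \<Longrightarrow> s \<le> d2 \<Longrightarrow>
    norm (f (x + s *\<^sub>R v + s *\<^sub>R u) - f (x + s *\<^sub>R v) - f (x + s *\<^sub>R u) + f x - s\<^sup>2 *\<^sub>R B) \<le> C2 * s ^ 3"
    using second_difference_bound[OF assms, of v u] unfolding B_def by blast
  have le: "norm (A - B) \<le> (C1 + C2) * s" if s: "0 < s" "s \<le> min d1 d2" for s
  proof -
    let ?D = "f (x + s *\<^sub>R u + s *\<^sub>R v) - f (x + s *\<^sub>R u) - f (x + s *\<^sub>R v) + f x"
    have a: "norm (?D - s\<^sup>2 *\<^sub>R A) \<le> C1 * s ^ 3" 
      using 1(3)[of s] s by simp
    have b: "norm (?D - s\<^sup>2 *\<^sub>R B) \<le> C2 * s ^ 3"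
      using 2(3)[of s] s by (simp add: algebra_simps)
    have "s\<^sup>2 * norm (A - B) = norm ((?D - s\<^sup>2 *\<^sub>R B) - (?D - s\<^sup>2 *\<^sub>R A))"
      using s by (simp flip: scaleR_diff_right)
    also have "\<dots> \<le> C2 * s ^ 3 + C1 * s ^ 3"
      using norm_triangle_ineq4 a b by (meson add_mono order_trans)
    also have "\<dots> = s\<^sup>2 * ((C1 + C2) * s)"
      by (simp add: power2_eq_square power3_eq_cube algebra_simps)
    finally show ?thesis
      using s by simp
  qed
  have "norm (A - B) \<le> 0"
  proof (rule tendsto_lowerbound)
    have "((\<lambda>s. (C1 + C2) * s) \<longlongrightarrow> (C1 + C2) * 0) (at_right 0)"
      by (intro tendsto_intros)
    then show "((\<lambda>s. (C1 + C2) * s) \<longlongrightarrow> 0) (at_right 0)" by simp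
    have "\<forall>\<^sub>F s in at_right 0. s \<in> {0<..<min d1 d2}"
      using 1(2) 2(2) by (intro eventually_at_right_real) auto
    then show "\<forall>\<^sub>F s in at_right 0. norm (A - B) \<le> (C1 + C2) * s"
      by eventually_elim (use le in auto)
  qed simp
  then show ?thesis by (simp add: A_def B_def)
qed

subsection \<open>Inverses of smooth families of linear maps\<close>

text \<open>Where the scalar factor vanishes, continuity of the other factor suffices for the
  product rule. For an inverse family this breaks the circle: it is differentiated while only its
  continuity is known.\<close>

lemma has_derivative_scaleR_zero:
  fixes a :: "'a::real_normed_vector \<Rightarrow> real" and f :: "'a \<Rightarrow> 'b::real_normed_vector"
  assumes a: "(a has_derivative a') (at x)" "a x = 0" and f: "continuous (at x) f"
  shows "((\<lambda>y. a y *\<^sub>R f y) has_derivative (\<lambda>u. a' u *\<^sub>R f x)) (at x)"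
proof -
  obtain B where B: "B > 0" "\<And>u. norm (a' u) \<le> norm u * B"
    using bounded_linear.pos_bounded[OF has_derivative_bounded_linear[OF a(1)]] by blast
  obtain d where d: "d > 0" "\<And>y. norm (y - x) < d \<Longrightarrow> norm (a y - a x - a' (y - x)) \<le> 1 * norm (y - x)"
    using a(1) unfolding has_derivative_at_alt using zero_less_one by blast
  have lip: "\<bar>a y\<bar> \<le> (B + 1) * norm (y - x)" if "norm (y - x) < d" for y
    using d(2)[OF that] B(2)[of "y - x"] a(2) by (simp add: algebra_simps)
  have "((\<lambda>y. a y *\<^sub>R (f y - f x)) has_derivative (\<lambda>u. 0)) (at x)"
    unfolding has_derivative_at_alt
  proof (intro conjI allI impI)
    fix e :: real assume e: "e > 0"
    then have "e / (B + 1) > 0" using B(1) by simp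
    then obtain d' where d': "d' > 0" "\<And>y. norm (y - x) < d' \<Longrightarrow> norm (f y - f x) < e / (B + 1)"
      using f unfolding continuous_at_eps_delta dist_norm by metis
    have "norm (a y *\<^sub>R (f y - f x) - a x *\<^sub>R (f x - f x) - 0) \<le> e * norm (y - x)"
      if "norm (y - x) < min d d'" for y
    proof -
      have "\<bar>a y\<bar> * norm (f y - f x) \<le> ((B + 1) * norm (y - x)) * (e / (B + 1))"
        using lip[of y] d'(2)[of y] that B(1) by (intro mult_mono) auto
      then show ?thesis using B(1) by (simp add: mult.commute)
    qed
    then show "\<exists>d>0. \<forall>y. norm (y - x) < d \<longrightarrow>
        norm (a y *\<^sub>R (f y - f x) - a x *\<^sub>R (f x - f x) - 0) \<le> e * norm (y - x)"
      using d(1) d'(1) by (intro exI[of _ "min d d'"]) auto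
  qed simp
  from has_derivative_add[OF has_derivative_scaleR_left[OF a(1), of "f x"] this]
  have "((\<lambda>y. a y *\<^sub>R f x + a y *\<^sub>R (f y - f x)) has_derivative (\<lambda>u. a' u *\<^sub>R f x)) (at x)"
    by simp
  moreover have "(\<lambda>y. a y *\<^sub>R f x + a y *\<^sub>R (f y - f x)) = (\<lambda>y. a y *\<^sub>R f y)"
    by (simp add: scaleR_diff_right)
  ultimately show ?thesis by simp
qed

text \<open>Everything rests on the identity K(y) - K(x) = K(y) (H(x) - H(y)) K(x). With a local
  bound on \<open>K\<close> it gives continuity, then differentiability with derivative - K (DH) K,
  and since this contains only \<open>K\<close> and derivatives of \<open>H\<close>, all orders
  follow by induction.\<close>

lemma smooth_on_inverse_family:
  fixes H K :: "'a::real_normed_vector \<Rightarrow> 'e::euclidean_space \<Rightarrow> 'e"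
  assumes S: "open S" and H: "\<And>x. x \<in> S \<Longrightarrow> linear (H x)" "\<And>w. smooth_on S (\<lambda>x. H x w)"
    and HK: "\<And>x w. x \<in> S \<Longrightarrow> H x (K x w) = w" and KH: "\<And>x w. x \<in> S \<Longrightarrow> K x (H x w) = w"
  shows "smooth_on S (\<lambda>x. K x w)"
proof -
  have K: "linear (K x)" if x: "x \<in> S" for x
  proof (rule linearI)
    fix u v :: 'e and c :: real
    have "K x (H x (K x u + K x v)) = K x (u + v)"
      using linear_add[OF H(1)[OF x]] HK[OF x] by simp
    then show "K x (u + v) = K x u + K x v"
      using KH[OF x] by simp
    have "K x (H x (c *\<^sub>R K x u)) = K x (c *\<^sub>R u)"
      using linear_cmul[OF H(1)[OF x]] HK[OF x] by simp
    then show "K x (c *\<^sub>R u) = c *\<^sub>R K x u"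
      using KH[OF x] by simp
  qed
  have H_tendsto: "((\<lambda>y. H y w) \<longlongrightarrow> H x w) (at x)" if "x \<in> S" for x w
    using smooth_on_continuous_on[OF H(2)[of w]] that S
    by (simp add: continuous_on_eq_continuous_at continuous_at)
  have bound: "\<exists>C. \<forall>\<^sub>F y in at x. \<forall>w. norm (K y w) \<le> C * norm w" if x: "x \<in> S" for x
  proof -
    obtain B where B: "B > 0" "\<And>w. norm (K x w) \<le> B * norm w"
      using linear_bounded_pos[OF K[OF x]] by blast
    \<comment> \<open>Near \<open>x\<close> the perturbation H(y) - H(x) has norm below 1/(2B), so
      |z| \<le> B |H(x) z| \<le> B |H(y) z| + |z|/2, and the last term is absorbed.\<close>
    have "((\<lambda>y. \<Sum>b\<in>Basis. norm (H y b - H x b)) \<longlongrightarrow> (\<Sum>b\<in>Basis. norm (H x b - H x b))) (at x)"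
      by (intro tendsto_intros H_tendsto x)
    then have "\<forall>\<^sub>F y in at x. (\<Sum>b\<in>Basis. norm (H y b - H x b)) < 1 / (2 * B)"
      by (rule order_tendstoD) (simp add: B)
    moreover have "\<forall>\<^sub>F y in at x. y \<in> S"
      using S x by (simp add: eventually_at_in_open')
    ultimately have "\<forall>\<^sub>F y in at x. \<forall>w. norm (K y w) \<le> (2 * B) * norm w"
    proof eventually_elim
      case (elim y)
      have "norm (K y w) \<le> (2 * B) * norm w" for w
      proof -
        define z where "z = K y w"
        have lin: "linear (\<lambda>u. H y u - H x u)"
          by (intro linear_compose_sub H(1) x elim)
        have "norm (H y z - H x z) \<le> (\<Sum>b\<in>Basis. norm z * norm (H y b - H x b))"
          unfolding linear_basis_expansion[OF lin, of z]
          by (rule sum_norm_le) (simp add: Basis_le_norm mult_right_mono)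
        also have "\<dots> = norm z * (\<Sum>b\<in>Basis. norm (H y b - H x b))"
          by (simp add: sum_distrib_left)
        also have "\<dots> \<le> norm z * (1 / (2 * B))"
          using elim by (intro mult_left_mono) auto
        finally have "norm (H x z) \<le> norm (H y z) + norm z * (1 / (2 * B))"
          using norm_triangle_ineq2[of "H x z" "H y z"] by (simp add: norm_minus_commute)
        moreover have "norm z \<le> B * norm (H x z)"
          using B(2)[of "H x z"] KH[OF x] by simp
        ultimately have "norm z \<le> B * (norm (H y z) + norm z * (1 / (2 * B)))"
          using B(1) by (meson mult_left_mono order_trans less_imp_le)
        then have "norm z \<le> 2 * B * norm (H y z)"
          using B(1) by (simp add: field_simps)
        then show ?thesis
          using HK[OF elim(2)] by (simp add: z_def)
      qed
      then show ?case by blast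
    qed
    then show ?thesis by blast
  qed
  have diff: "K y w - K x w = K y (H x (K x w) - H y (K x w))" if "x \<in> S" "y \<in> S" for x y w
    using HK[OF that(1)] KH[OF that(2)] linear_diff[OF K[OF that(2)]] by simp
  have cont: "continuous (at x) (\<lambda>y. K y w)" if x: "x \<in> S" for x w
  proof -
    obtain C where C: "\<forall>\<^sub>F y in at x. \<forall>w. norm (K y w) \<le> C * norm w"
      using bound[OF x] by blast
    moreover have "\<forall>\<^sub>F y in at x. y \<in> S"
      using S x by (simp add: eventually_at_in_open')
    ultimately have le: "\<forall>\<^sub>F y in at x. norm (K y w - K x w) \<le> C * norm (H x (K x w) - H y (K x w))"
      by eventually_elim (simp only: diff[OF x])
    have "((\<lambda>y. C * norm (H x (K x w) - H y (K x w))) \<longlongrightarrow> C * norm (H x (K x w) - H x (K x w))) (at x)"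
      by (intro tendsto_intros H_tendsto x)
    then have "((\<lambda>y. C * norm (H x (K x w) - H y (K x w))) \<longlongrightarrow> 0) (at x)"
      by simp
    then have "((\<lambda>y. K y w - K x w) \<longlongrightarrow> 0) (at x)"
      by (rule Lim_null_comparison[OF le])
    then show ?thesis
      by (simp add: continuous_at LIM_zero_iff)
  qed
  define K' where "K' w x v = (\<Sum>b\<in>Basis. ((- fderiv (\<lambda>y. H y (K x w)) x v) \<bullet> b) *\<^sub>R K x b)" for w x v
  have deriv: "((\<lambda>y. K y w) has_derivative K' w x) (at x)" if x: "x \<in> S" for x w
  proof -
    define m where "m y = H x (K x w) - H y (K x w)" for y
    have dm: "(m has_derivative (\<lambda>v. - fderiv (\<lambda>y. H y (K x w)) x v)) (at x)"
      unfolding m_def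
      using has_derivative_diff[OF has_derivative_const smooth_on_has_fderiv[OF H(2) x]] by simp
    have "((\<lambda>y. \<Sum>b\<in>Basis. (m y \<bullet> b) *\<^sub>R K y b) has_derivative K' w x) (at x)"
      unfolding K'_def
      by (intro has_derivative_sum has_derivative_scaleR_zero has_derivative_inner_left dm cont x)
        (simp add: m_def)
    then have "((\<lambda>y. K y (m y)) has_derivative K' w x) (at x)"
      by (rule has_derivative_transform_within_open[OF _ S x])
        (rule linear_basis_expansion[OF K, symmetric])
    then have "((\<lambda>y. K y w - K x w) has_derivative K' w x) (at x)"
      by (rule has_derivative_transform_within_open[OF _ S x]) (simp add: m_def diff[OF x])
    from has_derivative_add[OF this has_derivative_const[of "K x w"]] show ?thesis by simp
  qed
  have "Ck_on k S (\<lambda>x. K x w)" for k w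
  proof (induction k arbitrary: w)
    case 0
    show ?case
      using cont by (auto intro: continuous_at_imp_continuous_on)
  next
    case (Suc k)
    have "Ck_on k S (\<lambda>x. fderiv (\<lambda>y. K y w) x v)" for v
    proof (rule Ck_on_cong[OF S])
      have H': "Ck_on k S (\<lambda>x. fderiv (\<lambda>y. H y c) x v)" for c
        using smooth_on_fderiv[OF H(2)] by (simp add: smooth_on_def)
      have "Ck_on k S (\<lambda>x. \<Sum>b\<in>Basis. (K x w \<bullet> b) *\<^sub>R fderiv (\<lambda>y. H y b) x v)"
        by (rule Ck_on_sum[OF Ck_on_bilinear[OF bounded_bilinear_scaleR
              Ck_on_bilinear[OF bounded_bilinear_inner Suc.IH Ck_on_const S] H' S] S])
      \<comment> \<open>The minus sign of - K (DH) K is put on the constant vector \<open>b\<close>,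
        so that closure under bilinear products covers it.\<close>
      then show "Ck_on k S (\<lambda>x. \<Sum>b\<in>Basis.
          ((\<Sum>b\<in>Basis. (K x w \<bullet> b) *\<^sub>R fderiv (\<lambda>y. H y b) x v) \<bullet> (- b)) *\<^sub>R K x b)"
        by (rule Ck_on_sum[OF Ck_on_bilinear[OF bounded_bilinear_scaleR
              Ck_on_bilinear[OF bounded_bilinear_inner _ Ck_on_const S] Suc.IH S] S])
      show "(\<Sum>b\<in>Basis. ((\<Sum>b\<in>Basis. (K x w \<bullet> b) *\<^sub>R fderiv (\<lambda>y. H y b) x v) \<bullet> (- b)) *\<^sub>R K x b) =
          fderiv (\<lambda>x. K x w) x v" if x: "x \<in> S" for x
      proof -
        have "fderiv (\<lambda>y. H y (K x w)) x v = (\<Sum>b\<in>Basis. (K x w \<bullet> b) *\<^sub>R fderiv (\<lambda>y. H y b) x v)"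
          by (rule fderiv_family_expansion[OF S x H(1) smooth_on_differentiable[OF H(2) x]])
        then show ?thesis
          unfolding fderiv_eqI[OF deriv[OF x]] K'_def by simp
      qed
    qed
    then show ?case
      using deriv by (auto simp: differentiable_def)
  qed
  then show ?thesis by (simp add: smooth_on_def)
qed

subsection \<open>Bump functions\<close>

text \<open>The powers of \<open>inverse t\<close> make the family closed under differentiation up
  to linear combinations, so the smoothness of all members is one induction.\<close>

definition flat_exp :: "nat \<Rightarrow> real \<Rightarrow> real" where
  "flat_exp k t = (if t \<le> 0 then 0 else exp (- inverse t) * inverse t ^ k)"

lemma flat_exp_deriv:
  "(flat_exp k has_real_derivative flat_exp (k + 2) t - real k * flat_exp (k + 1) t) (at t)"
proof -
  consider "t < 0" | "t = 0" | "t > 0" by linarith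
  then show ?thesis
  proof cases
    case 1
    have "(flat_exp k has_real_derivative 0) (at t)"
      by (rule has_field_derivative_transform_within_open[OF DERIV_const[of 0], where S = "{..<0}"])
        (use 1 in \<open>auto simp: flat_exp_def\<close>)
    then show ?thesis using 1 by (simp add: flat_exp_def)
  next
    case 2
    \<comment> \<open>With x = 1/h the right difference quotient at the origin is x^(k+1) / exp x,
      which tends to 0 as x grows; the left one is identically 0.\<close>
    have "((\<lambda>h. flat_exp k h / h) \<longlongrightarrow> 0) (at_right 0)"
    proof (rule Lim_transform_eventually)
      have "((\<lambda>h. inverse h ^ (k + 1) / exp (inverse h)) \<longlongrightarrow> 0) (at_right (0::real))"
        by (rule filterlim_compose[OF tendsto_power_div_exp_0 filterlim_inverse_at_top_right])
      then show "((\<lambda>h. inverse h ^ (k + 1) / exp (inverse h)) \<longlongrightarrow> 0) (at_right (0::real))" .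
      show "\<forall>\<^sub>F h in at_right (0::real). inverse h ^ (k + 1) / exp (inverse h) = flat_exp k h / h"
        by (rule eventually_at_right_less[of 0, THEN eventually_mono])
          (auto simp: flat_exp_def exp_minus field_simps)
    qed
    moreover have "((\<lambda>h. flat_exp k h / h) \<longlongrightarrow> 0) (at_left 0)"
    proof (rule Lim_transform_eventually[OF tendsto_const])
      show "\<forall>\<^sub>F h in at_left (0::real). 0 = flat_exp k h / h"
        by (auto simp: eventually_at_filter flat_exp_def)
    qed
    ultimately have "((\<lambda>h. flat_exp k h / h) \<longlongrightarrow> 0) (at 0)"
      by (rule filterlim_split_at[rotated])
    then show ?thesis using 2 by (simp add: DERIV_def flat_exp_def)
  next
    case 3
    have "((\<lambda>t. exp (- inverse t) * inverse t ^ k) has_real_derivative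
        exp (- inverse t) * inverse t ^ (k + 2) - real k * (exp (- inverse t) * inverse t ^ (k + 1))) (at t)"
    proof -
      have i: "(inverse has_real_derivative - (inverse t ^ 2)) (at t)"
        using DERIV_inverse[of t UNIV] 3 by (simp add: numeral_2_eq_2)
      have k: "e * - (- r\<^sup>2) * r ^ k + real k * (- r\<^sup>2 * r ^ (k - Suc 0)) * e =
          e * r ^ (k + 2) - real k * (e * r ^ (k + 1))" for e r :: real
        by (cases k) (simp_all add: power2_eq_square algebra_simps)
      show ?thesis
        by (rule DERIV_cong[OF DERIV_mult[OF DERIV_fun_exp[OF DERIV_minus[OF i]] DERIV_power[OF i]] k])
    qed
    then have "(flat_exp k has_real_derivative
        exp (- inverse t) * inverse t ^ (k + 2) - real k * (exp (- inverse t) * inverse t ^ (k + 1))) (at t)"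
      by (rule has_field_derivative_transform_within_open[where S = "{0<..}"])
        (use 3 in \<open>auto simp: flat_exp_def\<close>)
    then show ?thesis using 3 by (simp add: flat_exp_def)
  qed
qed

lemma smooth_on_flat_exp: "smooth_on UNIV (flat_exp j)"
proof -
  have d: "(flat_exp j has_derivative (\<lambda>v. v * (flat_exp (j + 2) t - real j * flat_exp (j + 1) t))) (at t)" for j t
    using flat_exp_deriv[of j t] by (simp add: has_field_derivative_def mult_commute_abs)
  have "Ck_on k UNIV (flat_exp j)" for k
  proof (induction k arbitrary: j)
    case 0
    show ?case
      using DERIV_isCont[OF flat_exp_deriv] by (auto intro!: continuous_at_imp_continuous_on)
  next
    case (Suc k)
    have "Ck_on k UNIV (\<lambda>x. fderiv (flat_exp j) x v)" for v
    proof (rule Ck_on_cong[OF open_UNIV])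
      show "Ck_on k UNIV (\<lambda>t. v * flat_exp (j + 2) t + (- v * real j) * flat_exp (j + 1) t)"
        by (intro Ck_on_add Ck_on_bilinear[OF bounded_bilinear_mult] Ck_on_const Suc.IH open_UNIV)
      show "v * flat_exp (j + 2) t + (- v * real j) * flat_exp (j + 1) t = fderiv (flat_exp j) t v" for t
        unfolding fderiv_eqI[OF d] by (simp add: algebra_simps)
    qed
    then show ?case using d by (auto simp: differentiable_def)
  qed
  then show ?thesis by (simp add: smooth_on_def)
qed

text \<open>\<open>flat_exp 0\<close> is applied to r^2 - |y - x|^2. The support lies in a compact
  ball inside \<open>V\<close>, which later allows extension by zero from a chart to the whole
  manifold.\<close>

lemma smooth_bump:
  fixes x :: "'a::euclidean_space"
  assumes "open V" "x \<in> V"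
  obtains \<beta> :: "'a \<Rightarrow> real" and r where "smooth_on UNIV \<beta>" "\<beta> x \<noteq> 0" "r > 0" "cball x r \<subseteq> V"
    "\<And>y. y \<notin> cball x r \<Longrightarrow> \<beta> y = 0"
proof -
  obtain r where r: "r > 0" "cball x r \<subseteq> V"
    using assms open_contains_cball by blast
  define \<beta> where "\<beta> y = flat_exp 0 (r\<^sup>2 + (- 1) * ((y + (- x)) \<bullet> (y + (- x))))" for y
  have "smooth_on UNIV (\<lambda>y. r\<^sup>2 + (- 1) * ((y + (- x)) \<bullet> (y + (- x))))"
    by (intro smooth_on_add smooth_on_mult smooth_on_inner smooth_on_const open_UNIV
        smooth_on_linear bounded_linear_ident)
  then have "smooth_on UNIV \<beta>"
    unfolding \<beta>_def by (rule smooth_on_compose[OF smooth_on_flat_exp]) auto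
  moreover have "\<beta> x \<noteq> 0"
    using r by (simp add: \<beta>_def flat_exp_def)
  moreover have "\<beta> y = 0" if "y \<notin> cball x r" for y
  proof -
    have "r\<^sup>2 \<le> (norm (y - x))\<^sup>2"
      using that r by (intro power_mono) (auto simp: dist_norm norm_minus_commute)
    then show ?thesis
      by (simp add: \<beta>_def flat_exp_def flip: power2_norm_eq_inner)
  qed
  ultimately show ?thesis
    using r that by blast
qed

section \<open>Integrating a flat family\<close>

lemma linear_norm_le_basis:
  fixes F :: "'a::euclidean_space \<Rightarrow> 'b::real_normed_vector"
  assumes "linear F" "\<And>b. b \<in> Basis \<Longrightarrow> norm (F b) \<le> c b * k"
  shows "norm (F a) \<le> (\<Sum>b\<in>Basis. c b) * k * norm a"
proof -
  have "norm (F a) \<le> (\<Sum>b\<in>Basis. norm a * (c b * k))"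
    unfolding linear_basis_expansion[OF assms(1), of a]
  proof (rule sum_norm_le)
    fix b :: 'a assume b: "b \<in> Basis"
    show "norm ((a \<bullet> b) *\<^sub>R F b) \<le> norm a * (c b * k)"
      using assms(2)[OF b] Basis_le_norm[OF b, of a] by (simp add: mult_mono)
  qed
  then show ?thesis
    by (simp add: sum_distrib_left sum_distrib_right mult_ac)
qed

lemma smooth_family_bounds:
  fixes T :: "'a::euclidean_space \<Rightarrow> 'b::euclidean_space \<Rightarrow> 'c::real_normed_vector"
  assumes U: "open U" and T: "\<And>x. x \<in> U \<Longrightarrow> linear (T x)" "\<And>w. smooth_on U (\<lambda>x. T x w)"
    and K: "compact K" "convex K" "K \<subseteq> U"
  obtains C where "C > 0"
    "\<And>x a. x \<in> K \<Longrightarrow> norm (T x a) \<le> C * norm a"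
    "\<And>x y a. x \<in> K \<Longrightarrow> y \<in> K \<Longrightarrow> norm (T y a - T x a) \<le> C * norm (y - x) * norm a"
    "\<And>x y a. x \<in> K \<Longrightarrow> y \<in> K \<Longrightarrow>
      norm (T y a - T x a - fderiv (\<lambda>z. T z a) x (y - x)) \<le> C * (norm (y - x))\<^sup>2 * norm a"
    "\<And>x u a. x \<in> K \<Longrightarrow> norm (fderiv (\<lambda>z. T z a) x u) \<le> C * norm u * norm a"
proof -
  have "\<exists>C\<ge>0. \<forall>x\<in>K. norm (T x b) \<le> C" for b
  proof -
    have "bounded ((\<lambda>x. T x b) ` K)"
      using continuous_on_subset[OF smooth_on_continuous_on[OF T(2)] K(3)] K(1)
        compact_continuous_image compact_imp_bounded by blast
    then obtain C where C: "\<forall>x\<in>K. norm (T x b) \<le> C"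
      by (auto simp: bounded_iff)
    then show ?thesis
      by (intro exI[of _ "max 0 C"]) (auto intro: max.coboundedI2)
  qed
  then obtain C1 where C1: "\<And>b. C1 b \<ge> 0" "\<And>b x. x \<in> K \<Longrightarrow> norm (T x b) \<le> C1 b"
    by metis
  have "\<exists>C\<ge>0. \<forall>x\<in>K. \<forall>y\<in>K. norm (T y b - T x b) \<le> C * norm (y - x)" for b
    using smooth_on_lipschitz_bound[OF T(2) K] by metis
  then obtain C2 where C2: "\<And>b. C2 b \<ge> 0"
    "\<And>b x y. x \<in> K \<Longrightarrow> y \<in> K \<Longrightarrow> norm (T y b - T x b) \<le> C2 b * norm (y - x)"
    by metis
  have "\<exists>C\<ge>0. \<forall>x\<in>K. \<forall>y\<in>K. norm (T y b - T x b - fderiv (\<lambda>z. T z b) x (y - x)) \<le> C * (norm (y - x))\<^sup>2" for b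
    using smooth_on_taylor_bound[OF T(2) K] by metis
  then obtain C3 where C3: "\<And>b. C3 b \<ge> 0" "\<And>b x y. x \<in> K \<Longrightarrow> y \<in> K \<Longrightarrow>
      norm (T y b - T x b - fderiv (\<lambda>z. T z b) x (y - x)) \<le> C3 b * (norm (y - x))\<^sup>2"
    by metis
  have "\<exists>C\<ge>0. \<forall>x\<in>K. \<forall>u. norm (fderiv (\<lambda>z. T z b) x u) \<le> C * norm u" for b
    using smooth_on_fderiv_bound[OF T(2) K(1,3)] by metis
  then obtain C4 where C4: "\<And>b. C4 b \<ge> 0"
    "\<And>b x u. x \<in> K \<Longrightarrow> norm (fderiv (\<lambda>z. T z b) x u) \<le> C4 b * norm u"
    by metis
  define s where "s c = (\<Sum>b\<in>Basis. c b)" for c :: "'b \<Rightarrow> real"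
  \<comment> \<open>One constant dominates all four bounds; the summand 1 makes it positive, as
    later divisions by \<open>C\<close> require.\<close>
  define C where "C = s C1 + s C2 + s C3 + s C4 + 1"
  have pos: "s C1 \<ge> 0" "s C2 \<ge> 0" "s C3 \<ge> 0" "s C4 \<ge> 0"
    unfolding s_def by (intro sum_nonneg C1 C2 C3 C4)+
  have le: "norm (F a) \<le> C * k * norm a"
    if "linear F" "\<And>b. b \<in> Basis \<Longrightarrow> norm (F b) \<le> c b * k" "s c \<le> C" "k \<ge> 0"
    for F :: "'b \<Rightarrow> 'c" and c k a
  proof -
    have "norm (F a) \<le> s c * k * norm a"
      unfolding s_def by (rule linear_norm_le_basis[OF that(1,2)])
    also have "\<dots> \<le> C * k * norm a"
      using that by (intro mult_right_mono) auto
    finally show ?thesis .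
  qed
  have dT: "linear (\<lambda>a. fderiv (\<lambda>z. T z a) x u)" if "x \<in> K" for x u
    using that K(3) by (intro fderiv_family_linear[OF U _ T(1)] smooth_on_differentiable[OF T(2)]) auto
  have lin: "linear (T x)" if "x \<in> K" for x
    using that K(3) T(1) by blast
  show ?thesis
  proof (rule that)
    show "C > 0" using pos by (simp add: C_def)
    show "norm (T x a) \<le> C * norm a" if x: "x \<in> K" for x a
      using le[of "T x" C1 1 a, OF lin[OF x]] C1(2)[OF x] pos by (simp add: C_def)
    show "norm (T y a - T x a) \<le> C * norm (y - x) * norm a" if "x \<in> K" "y \<in> K" for x y a
      using C2(2)[OF that] pos
      by (intro le[of "\<lambda>a. T y a - T x a" C2] linear_compose_sub lin that) (auto simp: C_def)
    show "norm (T y a - T x a - fderiv (\<lambda>z. T z a) x (y - x)) \<le> C * (norm (y - x))\<^sup>2 * norm a"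
      if "x \<in> K" "y \<in> K" for x y a
      using C3(2)[OF that] pos
      by (intro le[of "\<lambda>a. T y a - T x a - fderiv (\<lambda>z. T z a) x (y - x)" C3]
          linear_compose_sub lin dT that) (auto simp: C_def)
    show "norm (fderiv (\<lambda>z. T z a) x u) \<le> C * norm u * norm a" if "x \<in> K" for x u a
      using C4(2)[OF that] pos
      by (intro le[of "\<lambda>a. fderiv (\<lambda>z. T z a) x u" C4] dT that) (auto simp: C_def)
  qed
qed

text \<open>At a point \<open>m\<close> where |f| is maximal the mean value inequality gives |f m|
  \<le> |f m|/2 + B. The coefficient 1/2 on the unit interval lets the maximum absorb itself, which
  replaces the exponential of the usual Gronwall argument.\<close>

lemma half_gronwall:
  fixes f :: "real \<Rightarrow> 'b::real_normed_vector"
  assumes f: "\<And>t. t \<in> {0..1} \<Longrightarrow> (f has_vector_derivative f' t) (at t within {0..1})" "f 0 = 0"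
    and le: "\<And>t. t \<in> {0..1} \<Longrightarrow> norm (f' t) \<le> norm (f t) / 2 + B" and t: "t \<in> {0..1}"
  shows "norm (f t) \<le> 2 * B"
proof -
  have "continuous_on {0..1} f"
    using f(1) has_vector_derivative_continuous continuous_on_eq_continuous_within by blast
  then have "continuous_on {0..1} (\<lambda>t. norm (f t))"
    by (rule continuous_on_norm)
  then obtain m where m: "m \<in> {0..1}" "\<And>t. t \<in> {0..1} \<Longrightarrow> norm (f t) \<le> norm (f m)"
    using continuous_attains_sup[of "{0..1::real}" "\<lambda>t. norm (f t)"] by auto
  have *: "norm (f' s) \<le> norm (f m) / 2 + B" if "s \<in> {0..1}" for s
    using le[OF that] m(2)[OF that] by simp
  then have "0 \<le> norm (f m) / 2 + B"
    using order_trans[OF norm_ge_zero] m(1) by blast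
  have "norm (f m - f 0) \<le> (norm (f m) / 2 + B) * m"
    by (rule mean_value_norm[OF f(1) * m(1)])
  also have "\<dots> \<le> norm (f m) / 2 + B"
    using m(1) \<open>0 \<le> norm (f m) / 2 + B\<close> by (simp add: mult_left_le)
  finally show ?thesis
    using m(2)[OF t] f(2) by simp
qed

text \<open>All rays are treated at once: the unknown is a function of the endpoint
  \<open>v\<close>, and y(v) = x0 + integral over [0,1] of L(y(tv)) v is a fixed point equation in
  the complete space of bounded continuous functions.\<close>

lemma radial_solution:
  fixes L :: "'n::euclidean_space \<Rightarrow> 'm::euclidean_space \<Rightarrow> 'n"
  assumes lin: "\<And>x. x \<in> cball x0 \<rho> \<Longrightarrow> linear (L x)"
    and cont: "\<And>a. continuous_on (cball x0 \<rho>) (\<lambda>x. L x a)"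
    and C: "C > 0" "\<And>x a. x \<in> cball x0 \<rho> \<Longrightarrow> norm (L x a) \<le> C * norm a"
    and lip: "\<And>x y a. x \<in> cball x0 \<rho> \<Longrightarrow> y \<in> cball x0 \<rho> \<Longrightarrow>
      norm (L y a - L x a) \<le> C * norm (y - x) * norm a"
    and r: "r > 0" "C * r \<le> \<rho>" "C * r \<le> 1 / 2"
  obtains y where "y 0 = x0" "\<And>v. norm v \<le> r \<Longrightarrow> y v \<in> cball x0 \<rho>"
    "\<And>v t. norm v \<le> r \<Longrightarrow> t \<in> {0..1} \<Longrightarrow>
      ((\<lambda>t. y (t *\<^sub>R v)) has_vector_derivative L (y (t *\<^sub>R v)) v) (at t within {0..1})"
proof -
  let ?K = "cball x0 \<rho>" and ?B = "cball 0 r :: 'm set"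
  have \<rho>: "\<rho> > 0"
    using r C(1) by (meson less_le_trans mult_pos_pos)
  \<comment> \<open>Projecting values by \<open>Q\<close> and arguments by \<open>R\<close> defines
    the integral operator on all bounded continuous functions on the whole space. \<open>Q\<close>
    does not increase distances, so the contraction factor remains C r \<le> 1/2.\<close>
  define Q where "Q = closest_point ?K"
  define R where "R = closest_point ?B"
  have K: "convex ?K" "closed ?K" "?K \<noteq> {}" and B: "convex ?B" "closed ?B" "?B \<noteq> {}"
    using \<rho> r(1) by auto
  have Q: "Q x \<in> ?K" "continuous_on S Q" "dist (Q x) (Q y) \<le> dist x y" "x \<in> ?K \<Longrightarrow> Q x = x" for x y S
    unfolding Q_def using K
    by (auto intro: closest_point_in_set continuous_on_closest_point closest_point_lipschitz
        simp: closest_point_self simp del: mem_cball)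
  have R: "norm (R v) \<le> r" "continuous_on S' R" "norm v \<le> r \<Longrightarrow> R v = v" for v S'
    unfolding R_def using closest_point_in_set[OF B(2,3), of v] B
    by (auto intro: continuous_on_closest_point simp: closest_point_self)
  have L_cont: "continuous_on S (\<lambda>z. L (f z) (g z))"
    if "continuous_on S f" "continuous_on S g" "f ` S \<subseteq> ?K" for S :: "'z::topological_space set" and f g
  proof -
    have "continuous_on S (\<lambda>z. \<Sum>b\<in>Basis. (g z \<bullet> b) *\<^sub>R L (f z) b)"
      using continuous_on_compose2[OF cont that(1,3)]
      by (intro continuous_intros that)
    then show ?thesis
    proof (rule continuous_on_eq)
      fix z assume "z \<in> S"
      then have "linear (L (f z))"
        using that(3) lin by blast
      then show "(\<Sum>b\<in>Basis. (g z \<bullet> b) *\<^sub>R L (f z) b) = L (f z) (g z)"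
        by (rule linear_basis_expansion[symmetric])
    qed
  qed
  define G where "G w v t = L (Q (apply_bcontfun w (t *\<^sub>R R v))) (R v)" for w v and t :: real
  have G_cont: "continuous_on S (\<lambda>z. G w (f z) (g z))"
    if "continuous_on S f" "continuous_on S g" for S :: "'z::topological_space set" and w f g
    unfolding G_def using that
    by (intro L_cont continuous_on_compose2[OF Q(2)[of UNIV]] continuous_on_compose2[OF R(2)[of UNIV]]
        continuous_on_compose2[OF continuous_on_apply_bcontfun[of UNIV]] continuous_intros)
      (use Q(1) in \<open>auto simp del: mem_cball\<close>)
  have G_bound: "norm (G w v t) \<le> C * r" for w v t
    unfolding G_def using C(1) R(1) by (intro order_trans[OF C(2)[OF Q(1)]]) simp
  define T where "T w v = x0 + integral {0..1} (G w v)" for w v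
  have G_int: "G w v integrable_on {0..1}" for w v
    by (intro integrable_continuous_real G_cont continuous_intros)
  have T_dist: "norm (T w v - x0) \<le> C * r" for w v
    unfolding T_def using integral_bound[of 0 1 "G w v" "C * r"] G_bound
    by (simp add: G_cont continuous_on_id)
  have "T w \<in> bcontfun" for w
  proof (rule bcontfun_normI)
    have "continuous_on UNIV (\<lambda>v. integral (cbox 0 (1::real)) (G w v))"
      by (rule integral_continuous_on_param) (auto simp: split_beta intro!: G_cont continuous_intros)
    then show "continuous_on UNIV (T w)"
      unfolding T_def by (intro continuous_intros) simp
    show "norm (T w v) \<le> norm x0 + C * r" for v
      using T_dist[of w v] norm_triangle_sub[of "T w v" x0] by simp
  qed
  then have app: "apply_bcontfun (Bcontfun (T w)) = T w" for w
    by (rule Bcontfun_inverse)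
  have "\<exists>!w. Bcontfun (T w) = w"
  proof (rule banach_fix_type[of "1 / 2"])
    have "dist (T w v) (T w' v) \<le> 1 / 2 * dist w w'" for w w' v
    proof -
      have "norm (G w v t - G w' v t) \<le> 1 / 2 * dist w w'" for t
      proof -
        let ?u = "apply_bcontfun w (t *\<^sub>R R v)" and ?u' = "apply_bcontfun w' (t *\<^sub>R R v)"
        have "norm (G w v t - G w' v t) \<le> C * norm (Q ?u - Q ?u') * norm (R v)"
          unfolding G_def by (rule lip[OF Q(1) Q(1)])
        also have "norm (Q ?u - Q ?u') \<le> dist w w'"
          using Q(3)[of ?u ?u'] dist_bounded[of w "t *\<^sub>R R v" w'] by (simp add: dist_norm)
        also have "C * dist w w' * norm (R v) \<le> C * dist w w' * r"
          using C(1) R(1) by (intro mult_left_mono) auto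
        also have "\<dots> = (C * r) * dist w w'" by simp
        also have "\<dots> \<le> 1 / 2 * dist w w'"
          using r(3) by (intro mult_right_mono) auto
        finally show ?thesis
          using C(1) by (simp add: mult_left_mono mult_right_mono)
      qed
      then have "norm (integral {0..1} (\<lambda>t. G w v t - G w' v t)) \<le> 1 / 2 * dist w w' * (1 - 0)"
        by (intro integral_bound continuous_intros G_cont) auto
      then show ?thesis
        by (simp add: T_def dist_norm integral_diff[OF G_int G_int])
    qed
    then show "\<forall>w w'. dist (Bcontfun (T w)) (Bcontfun (T w')) \<le> 1 / 2 * dist w w'"
      by (intro allI dist_bound) (simp only: app)
  qed auto
  then obtain w where "Bcontfun (T w) = w" by blast
  define y where "y = apply_bcontfun w"
  have y: "y v = T w v" for v
    using app[of w] \<open>Bcontfun (T w) = w\<close> by (simp add: y_def)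
  \<comment> \<open>The fixed point stays within C r \<le> \<rho> of \<open>x0\<close>, so
    \<open>Q\<close> acts on it as the identity; \<open>R\<close> likewise disappears once |v| \<le>
    r.\<close>
  have yK: "y v \<in> ?K" for v
    using T_dist[of w v] r(2) by (simp add: y dist_norm norm_minus_commute)
  show ?thesis
  proof (rule that[of y])
    show "y 0 = x0"
    proof -
      have "R 0 = 0" using R(3)[of 0] r(1) by simp
      then have "G w 0 = (\<lambda>t. 0)"
        unfolding G_def using linear_0[OF lin[OF Q(1)]] by (simp add: fun_eq_iff)
      then show ?thesis by (simp add: y T_def)
    qed
    show "y v \<in> ?K" for v by (rule yK)
  next
    fix v :: 'm and t :: real assume v: "norm v \<le> r" and t: "t \<in> {0..1}"
    define f where "f t = L (y (t *\<^sub>R v)) v" for t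
    have f_cont: "continuous_on {0..1} f"
      unfolding f_def using yK
      by (intro L_cont continuous_intros continuous_on_compose2[OF continuous_on_apply_bcontfun[of UNIV], of _ _ w, folded y_def])
        auto
    define F where "F s = integral {0..s} f" for s
    have F: "(F has_vector_derivative f s) (at s within {0..1})" if "s \<in> {0..1}" for s
      unfolding F_def by (rule integral_has_vector_derivative[OF f_cont that])
    have eq: "y (s *\<^sub>R v) = x0 + F s" if s: "s \<in> {0..1}" for s
    proof -
      have sv: "norm (s *\<^sub>R v) \<le> r"
        using s v mult_left_le_one_le[of "norm v" s] by simp
      \<comment> \<open>Linearity of \<open>L\<close> pulls the factor \<open>s\<close> out, and the
        integrand becomes the derivative of \<tau> \<mapsto> F(\<tau> s). The integral over [0,1] at
        the endpoint \<open>s *\<^sub>R v\<close> is thus the integral of \<open>f\<close> over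
        [0,s]; the case \<open>s = 0\<close> is included.\<close>
      have G: "G w (s *\<^sub>R v) \<tau> = s *\<^sub>R f (\<tau> * s)" for \<tau>
        unfolding G_def f_def y_def[symmetric] R(3)[OF sv] Q(4)[OF yK]
        by (simp add: linear_cmul[OF lin[OF yK]])
      have "((\<lambda>\<tau>. s *\<^sub>R f (\<tau> * s)) has_integral (F (1 * s) - F (0 * s))) {0..1}"
      proof (rule fundamental_theorem_of_calculus)
        fix \<tau> :: real assume \<tau>: "\<tau> \<in> {0..1}"
        have sub: "(\<lambda>\<tau>. \<tau> * s) ` {0..1} \<subseteq> {0..1}"
          using s by (auto simp: mult_le_one)
        have "((F \<circ> (\<lambda>\<tau>. \<tau> * s)) has_vector_derivative (s *\<^sub>R f (\<tau> * s))) (at \<tau> within {0..1})"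
        proof (rule vector_diff_chain_within)
          show "((\<lambda>\<tau>. \<tau> * s) has_vector_derivative s) (at \<tau> within {0..1})"
            by (auto intro!: derivative_eq_intros)
          show "(F has_vector_derivative f (\<tau> * s)) (at (\<tau> * s) within (\<lambda>\<tau>. \<tau> * s) ` {0..1})"
            using s \<tau> by (intro has_vector_derivative_within_subset[OF F sub]) (auto simp: mult_le_one)
        qed
        then show "((\<lambda>\<tau>. F (\<tau> * s)) has_vector_derivative s *\<^sub>R f (\<tau> * s)) (at \<tau> within {0..1})"
          by (simp add: o_def)
      qed simp
      moreover have F0: "F (1 * s) - F (0 * s) = F s"
        by (simp add: F_def)
      ultimately have "integral {0..1} (\<lambda>\<tau>. s *\<^sub>R f (\<tau> * s)) = F s"
        using integral_unique by (metis F0)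
      moreover have "G w (s *\<^sub>R v) = (\<lambda>\<tau>. s *\<^sub>R f (\<tau> * s))"
        using G by blast
      ultimately show ?thesis
        by (simp add: y T_def)
    qed
    have "((\<lambda>s. x0 + F s) has_vector_derivative f t) (at t within {0..1})"
      using has_vector_derivative_add[OF has_vector_derivative_const F[OF t]] by simp
    then show "((\<lambda>t. y (t *\<^sub>R v)) has_vector_derivative L (y (t *\<^sub>R v)) v) (at t within {0..1})"
      unfolding f_def[symmetric]
      by (rule has_vector_derivative_transform[OF t, rotated]) (rule eq)
  qed
qed

text \<open>Along the ray \<open>p\<close>, flatness turns \<open>d/dt L(p)h\<close> into the derivative of \<open>L\<close> in direction \<open>L(p)h\<close>, so that
  \<open>E(t) = y(t(v + h)) - y(tv) - t L(y(tv))h\<close> satisfies a linear differential inequality with a quadratic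
  inhomogeneity.\<close>

lemma flat_family_estimate:
  fixes L :: "'n::euclidean_space \<Rightarrow> 'm::euclidean_space \<Rightarrow> 'n"
  assumes U: "open U" and lin: "\<And>x. x \<in> U \<Longrightarrow> linear (L x)" and L: "\<And>a. smooth_on U (\<lambda>x. L x a)"
    and flat: "\<And>x a b. x \<in> U \<Longrightarrow> fderiv (\<lambda>z. L z a) x (L x b) = fderiv (\<lambda>z. L z b) x (L x a)"
    and K: "K \<subseteq> U" and C: "C > 0"
    and b1: "\<And>x a. x \<in> K \<Longrightarrow> norm (L x a) \<le> C * norm a"
    and b2: "\<And>x y a. x \<in> K \<Longrightarrow> y \<in> K \<Longrightarrow> norm (L y a - L x a) \<le> C * norm (y - x) * norm a"
    and b3: "\<And>x y a. x \<in> K \<Longrightarrow> y \<in> K \<Longrightarrow>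
      norm (L y a - L x a - fderiv (\<lambda>z. L z a) x (y - x)) \<le> C * (norm (y - x))\<^sup>2 * norm a"
    and b4: "\<And>x u a. x \<in> K \<Longrightarrow> norm (fderiv (\<lambda>z. L z a) x u) \<le> C * norm u * norm a"
    and r: "r > 0" "C * r \<le> 1 / 2"
    and y0: "y 0 = x0" and yK: "\<And>v. norm v \<le> r \<Longrightarrow> y v \<in> K"
    and dy: "\<And>v t. norm v \<le> r \<Longrightarrow> t \<in> {0..1} \<Longrightarrow>
      ((\<lambda>t. y (t *\<^sub>R v)) has_vector_derivative L (y (t *\<^sub>R v)) v) (at t within {0..1})"
    and v: "norm v \<le> r" and vh: "norm (v + h) \<le> r"
  shows "norm (y (v + h) - y v - L (y v) h) \<le> 2 * (4 * C ^ 3 * r + 2 * C\<^sup>2) * (norm h)\<^sup>2"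
proof -
  define p q where "p t = y (t *\<^sub>R v)" and "q t = y (t *\<^sub>R (v + h))" for t
  have pq: "p t \<in> K" "q t \<in> K" if "t \<in> {0..1}" for t
  proof -
    have "t * norm w \<le> r" if "norm w \<le> r" for w :: 'm
      using \<open>t \<in> {0..1}\<close> that mult_left_le_one_le[of "norm w" t] by auto
    then show "p t \<in> K" "q t \<in> K"
      unfolding p_def q_def using v vh \<open>t \<in> {0..1}\<close> by (auto intro!: yK)
  qed
  have dp: "(p has_vector_derivative L (p t) v) (at t within {0..1})"
    and dq: "(q has_vector_derivative L (q t) (v + h)) (at t within {0..1})" if "t \<in> {0..1}" for t
    unfolding p_def q_def using dy[OF v that] dy[OF vh that] by auto
  \<comment> \<open>A first-order bound on the distance between the two rays; inserted in the
    remainders below, it makes them quadratic in \<open>h\<close>.\<close>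
  have dle: "norm (q t - p t) \<le> 2 * (C * norm h)" if t: "t \<in> {0..1}" for t
  proof (rule half_gronwall[OF has_vector_derivative_diff[OF dq dp] _ _ t])
    show "q 0 - p 0 = 0" by (simp add: p_def q_def)
    fix t :: real assume t: "t \<in> {0..1}"
    have "L (q t) (v + h) - L (p t) v = (L (q t) v - L (p t) v) + L (q t) h"
      using linear_add[OF lin] pq[OF t] K by (simp add: subset_iff)
    also have "norm \<dots> \<le> C * norm (q t - p t) * norm v + C * norm h"
      by (intro norm_triangle_mono b1 b2 pq t)
    also have "C * norm (q t - p t) * norm v \<le> C * norm (q t - p t) * r"
      using C v by (intro mult_left_mono) auto
    also have "\<dots> = (C * r) * norm (q t - p t)" by simp
    also have "\<dots> \<le> 1 / 2 * norm (q t - p t)"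
      using r(2) by (intro mult_right_mono) auto
    finally show "norm (L (q t) (v + h) - L (p t) v) \<le> norm (q t - p t) / 2 + C * norm h"
      by simp
  qed
  define E where "E t = q t - p t - t *\<^sub>R L (p t) h" for t
  define E' where "E' t = L (q t) (v + h) - L (p t) v
      - (L (p t) h + t *\<^sub>R fderiv (\<lambda>z. L z h) (p t) (L (p t) v))" for t
  have dE: "(E has_vector_derivative E' t) (at t within {0..1})" if t: "t \<in> {0..1}" for t
  proof -
    have pU: "p t \<in> U" using pq(1)[OF t] K by blast
    have "((\<lambda>t. L (p t) h) has_vector_derivative fderiv (\<lambda>z. L z h) (p t) (L (p t) v)) (at t within {0..1})"
      using has_derivative_compose[OF dp[OF t, unfolded has_vector_derivative_def] smooth_on_has_fderiv[OF L pU, of h]]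
      by (simp add: has_vector_derivative_def linear_cmul[OF smooth_on_linear_fderiv[OF L pU]])
    from has_vector_derivative_scaleR[OF DERIV_ident this]
    have "((\<lambda>t. t *\<^sub>R L (p t) h) has_vector_derivative
        (L (p t) h + t *\<^sub>R fderiv (\<lambda>z. L z h) (p t) (L (p t) v))) (at t within {0..1})"
      by (simp add: add.commute)
    from has_vector_derivative_diff[OF has_vector_derivative_diff[OF dq[OF t] dp[OF t]] this]
    show ?thesis unfolding E_def E'_def .
  qed
  have "norm (E 1) \<le> 2 * ((4 * C ^ 3 * r + 2 * C\<^sup>2) * (norm h)\<^sup>2)"
  proof (rule half_gronwall[OF dE])
    show "E 0 = 0" by (simp add: E_def p_def q_def)
    fix t :: real assume t: "t \<in> {0..1}"
    have pU: "p t \<in> U" "q t \<in> U" using pq[OF t] K by blast+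
    let ?D = "fderiv (\<lambda>z. L z v) (p t)"
    have lD: "linear ?D" by (rule smooth_on_linear_fderiv[OF L pU(1)])
    have "t *\<^sub>R fderiv (\<lambda>z. L z h) (p t) (L (p t) v) = ?D (t *\<^sub>R L (p t) h)"
      using flat[OF pU(1), of h v] linear_cmul[OF lD] by simp
    also have "\<dots> = ?D (q t - p t) - ?D (E t)"
      by (simp add: E_def flip: linear_diff[OF lD])
    \<comment> \<open>The three groups are a Taylor remainder of \<open>L\<close> along q - p, the
      linear feedback of \<open>E\<close>, and a Lipschitz difference multiplied by
      \<open>h\<close>. Only the middle one is not already quadratic in \<open>h\<close>.\<close>
    finally have "E' t = (L (q t) v - L (p t) v - ?D (q t - p t)) + (?D (E t) + (L (q t) h - L (p t) h))"
      unfolding E'_def using linear_add[OF lin[OF pU(2)]] by simp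
    also have "norm \<dots> \<le> C * (norm (q t - p t))\<^sup>2 * norm v +
        (C * norm (E t) * norm v + C * norm (q t - p t) * norm h)"
      by (intro norm_triangle_mono b2 b3 b4 pq t)
    \<comment> \<open>With |q - p| \<le> 2 C |h|, the Taylor remainder contributes 4 C^3 r |h|^2 and
      the Lipschitz difference 2 C^2 |h|^2; the feedback has coefficient C r \<le> 1/2, the form
      that \<open>half_gronwall\<close> expects.\<close>
    also have "\<dots> \<le> C * (2 * (C * norm h))\<^sup>2 * r +
        (norm (E t) / 2 + C * (2 * (C * norm h)) * norm h)"
    proof (intro add_mono)
      show "C * (norm (q t - p t))\<^sup>2 * norm v \<le> C * (2 * (C * norm h))\<^sup>2 * r"
        using C v dle[OF t] by (intro mult_mono power_mono) auto
      have "C * norm (E t) * norm v \<le> C * norm (E t) * r"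
        using C v by (intro mult_left_mono) auto
      also have "\<dots> = (C * r) * norm (E t)" by simp
      also have "\<dots> \<le> 1 / 2 * norm (E t)"
        using r(2) by (intro mult_right_mono) auto
      finally show "C * norm (E t) * norm v \<le> norm (E t) / 2" by simp
      show "C * norm (q t - p t) * norm h \<le> C * (2 * (C * norm h)) * norm h"
        using C dle[OF t] by (intro mult_right_mono mult_left_mono) auto
    qed
    also have "\<dots> = norm (E t) / 2 + (4 * C ^ 3 * r + 2 * C\<^sup>2) * (norm h)\<^sup>2"
      by (simp add: power2_eq_square power3_eq_cube algebra_simps)
    finally show "norm (E' t) \<le> norm (E t) / 2 + (4 * C ^ 3 * r + 2 * C\<^sup>2) * (norm h)\<^sup>2" .
  qed auto
  then show ?thesis
    by (simp only: E_def p_def q_def scaleR_one mult.assoc)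
qed

lemma has_derivative_quadratic_bound:
  fixes f :: "'a::real_normed_vector \<Rightarrow> 'b::real_normed_vector"
  assumes "bounded_linear f'" "r > 0"
    and le: "\<And>h. norm h \<le> r \<Longrightarrow> norm (f (x + h) - f x - f' h) \<le> C * (norm h)\<^sup>2"
  shows "(f has_derivative f') (at x)"
  unfolding has_derivative_at_alt
proof (intro conjI allI impI assms(1))
  fix e :: real assume e: "e > 0"
  let ?d = "min r (e / (\<bar>C\<bar> + 1))"
  have "norm (f y - f x - f' (y - x)) \<le> e * norm (y - x)" if y: "norm (y - x) < ?d" for y
  proof -
    have "norm (f y - f x - f' (y - x)) \<le> C * (norm (y - x))\<^sup>2"
      using le[of "y - x"] y by simp
    also have "\<dots> \<le> (\<bar>C\<bar> + 1) * (norm (y - x) * norm (y - x))"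
      unfolding power2_eq_square by (intro mult_right_mono) auto
    also have "\<dots> = ((\<bar>C\<bar> + 1) * norm (y - x)) * norm (y - x)" by simp
    also have "\<dots> \<le> e * norm (y - x)"
      using y by (intro mult_right_mono) (auto simp: field_simps)
    finally show ?thesis .
  qed
  moreover have "?d > 0" using assms(2) e by simp
  ultimately show "\<exists>d>0. \<forall>y. norm (y - x) < d \<longrightarrow> norm (f y - f x - f' (y - x)) \<le> e * norm (y - x)"
    by blast
qed

text \<open>Bootstrapping: the directional derivatives of \<sigma> are
  \<open>L (\<sigma> v) a\<close>, hence of class C^k as soon as \<sigma> is.\<close>

lemma smooth_on_flow_solution:
  fixes L :: "'n::euclidean_space \<Rightarrow> 'm::real_normed_vector \<Rightarrow> 'n"
  assumes "open W" "open U" "\<And>a. smooth_on U (\<lambda>x. L x a)" "\<sigma> ` W \<subseteq> U"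
    and d: "\<And>v. v \<in> W \<Longrightarrow> (\<sigma> has_derivative L (\<sigma> v)) (at v)"
  shows "smooth_on W \<sigma>"
proof -
  have "Ck_on k W \<sigma>" for k
  proof (induction k)
    case 0
    show ?case
      using has_derivative_continuous[OF d] by (auto intro!: continuous_at_imp_continuous_on)
  next
    case (Suc k)
    have "Ck_on k W (\<lambda>x. fderiv \<sigma> x a)" for a
    proof (rule Ck_on_cong[OF assms(1)])
      have "Ck_on k U (\<lambda>x. L x a)"
        using assms(3) by (simp add: smooth_on_def)
      then show "Ck_on k W (\<lambda>v. L (\<sigma> v) a)"
        by (rule Ck_on_compose[OF _ Suc assms(4,1,2)])
      show "L (\<sigma> v) a = fderiv \<sigma> v a" if "v \<in> W" for v
        using fderiv_eqI[OF d[OF that]] by simp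
    qed
    then show ?case
      using d by (auto simp: differentiable_def)
  qed
  then show ?thesis by (simp add: smooth_on_def)
qed

theorem flat_family_integral:
  fixes L :: "'n::euclidean_space \<Rightarrow> 'm::euclidean_space \<Rightarrow> 'n"
  assumes U: "open U" "x0 \<in> U" and lin: "\<And>x. x \<in> U \<Longrightarrow> linear (L x)"
    and L: "\<And>a. smooth_on U (\<lambda>x. L x a)"
    and flat: "\<And>x a b. x \<in> U \<Longrightarrow> fderiv (\<lambda>z. L z a) x (L x b) = fderiv (\<lambda>z. L z b) x (L x a)"
  obtains r \<sigma> where "r > 0" "\<sigma> 0 = x0" "\<sigma> ` ball 0 r \<subseteq> U" "smooth_on (ball 0 r) \<sigma>"
    "\<And>v. v \<in> ball 0 r \<Longrightarrow> (\<sigma> has_derivative L (\<sigma> v)) (at v)"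
proof -
  obtain \<rho> where \<rho>: "\<rho> > 0" "cball x0 \<rho> \<subseteq> U"
    using U open_contains_cball by blast
  let ?K = "cball x0 \<rho>"
  obtain C where C: "C > 0"
    "\<And>x a. x \<in> ?K \<Longrightarrow> norm (L x a) \<le> C * norm a"
    "\<And>x y a. x \<in> ?K \<Longrightarrow> y \<in> ?K \<Longrightarrow> norm (L y a - L x a) \<le> C * norm (y - x) * norm a"
    "\<And>x y a. x \<in> ?K \<Longrightarrow> y \<in> ?K \<Longrightarrow>
      norm (L y a - L x a - fderiv (\<lambda>z. L z a) x (y - x)) \<le> C * (norm (y - x))\<^sup>2 * norm a"
    "\<And>x u a. x \<in> ?K \<Longrightarrow> norm (fderiv (\<lambda>z. L z a) x u) \<le> C * norm u * norm a"
    using smooth_family_bounds[OF U(1) lin L compact_cball convex_cball \<rho>(2)] by blast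
  \<comment> \<open>C r \<le> \<rho> keeps the solution in the ball where the bounds hold; C r \<le>
    1/2 serves both the contraction and the Gronwall absorption.\<close>
  define r where "r = min \<rho> (1 / 2) / C"
  have r: "r > 0" "C * r \<le> \<rho>" "C * r \<le> 1 / 2"
    using C(1) \<rho>(1) by (auto simp: r_def)
  have linK: "linear (L x)" if "x \<in> ?K" for x
    using lin that \<rho>(2) by blast
  have contK: "continuous_on ?K (\<lambda>x. L x a)" for a
    using smooth_on_continuous_on[OF L] \<rho>(2) continuous_on_subset by blast
  obtain y where y: "y 0 = x0" "\<And>v. norm v \<le> r \<Longrightarrow> y v \<in> ?K"
    "\<And>v t. norm v \<le> r \<Longrightarrow> t \<in> {0..1} \<Longrightarrow>
      ((\<lambda>t. y (t *\<^sub>R v)) has_vector_derivative L (y (t *\<^sub>R v)) v) (at t within {0..1})"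
    using radial_solution[OF linK contK C(1-3) r] by metis
  have d: "(y has_derivative L (y v)) (at v)" if "v \<in> ball 0 r" for v
  proof (rule has_derivative_quadratic_bound)
    show "bounded_linear (L (y v))"
      using linK[OF y(2)] that by (simp add: linear_conv_bounded_linear)
    show "r - norm v > 0" using that by simp
    \<comment> \<open>Differentiability in all directions is read off from the quadratic estimate;
      |h| \<le> r - |v| keeps the second ray inside the ball.\<close>
    show "norm (y (v + h) - y v - L (y v) h) \<le> 2 * (4 * C ^ 3 * r + 2 * C\<^sup>2) * (norm h)\<^sup>2"
      if h: "norm h \<le> r - norm v" for h
    proof (rule flat_family_estimate[OF U(1) lin L flat \<rho>(2) C r(1,3) y])
      show "norm v \<le> r" using \<open>v \<in> ball 0 r\<close> by simp
      show "norm (v + h) \<le> r" using h norm_triangle_ineq[of v h] by simp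
    qed
  qed
  moreover have sub: "y ` ball 0 r \<subseteq> U"
    using y(2) \<rho>(2) by auto
  moreover have "smooth_on (ball 0 r) y"
    by (rule smooth_on_flow_solution[OF open_ball U(1) L sub d])
  ultimately show ?thesis
    using that r(1) y(1) by blast
qed

section \<open>Charts and coordinate derivatives\<close>

text \<open>With arbitrary charts on both sides, this one notion contains
  \<open>differential\<close> and, for \<open>f = id\<close>, both coordinate changes of tangent
  vectors, so a single chain rule yields all transition formulas.\<close>

definition dcoord :: "('p, 'e::euclidean_space) chart \<Rightarrow> ('q, 'f::euclidean_space) chart \<Rightarrow>
    ('p \<Rightarrow> 'q) \<Rightarrow> 'p \<Rightarrow> 'e \<Rightarrow> 'f" where
  "dcoord c d f p = fderiv (snd d \<circ> f \<circ> chart_inv c) (snd c p)"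

lemma tangent_coord_eq: "tangent_coord A c p = dcoord (chart_at A p) c id p"
  and tangent_of_coord_eq: "tangent_of_coord A c p = dcoord c (chart_at A p) id p"
  and differential_eq: "differential A B f p = dcoord (chart_at A p) (chart_at B (f p)) f p"
  by (simp_all add: tangent_coord_def tangent_of_coord_def differential_def dcoord_def)

lemma chart_inv_left: "is_chart c \<Longrightarrow> p \<in> fst c \<Longrightarrow> chart_inv c (snd c p) = p"
  and chart_inv_right: "is_chart c \<Longrightarrow> x \<in> snd c ` fst c \<Longrightarrow> snd c (chart_inv c x) = x"
  and chart_inv_in: "is_chart c \<Longrightarrow> x \<in> snd c ` fst c \<Longrightarrow> chart_inv c x \<in> fst c"
  by (auto simp: is_chart_def homeomorphism_def)

lemma open_chart_image:
  assumes c: "is_chart c" and X: "open X"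
  shows "open (snd c ` (fst c \<inter> X))"
proof -
  have "snd c ` (fst c \<inter> X) = (snd c ` fst c) \<inter> chart_inv c -` X"
    using chart_inv_left[OF c] by auto
  moreover have "open ((snd c ` fst c) \<inter> chart_inv c -` X)"
    using c X by (intro continuous_open_preimage) (auto simp: is_chart_def homeomorphism_def)
  ultimately show ?thesis by simp
qed

lemma smooth_atlas_chart: "smooth_atlas A \<Longrightarrow> c \<in> A \<Longrightarrow> is_chart c"
  by (simp add: smooth_atlas_def)

lemma chart_at:
  assumes "smooth_atlas A"
  shows "chart_at A p \<in> A" "p \<in> fst (chart_at A p)"
proof -
  have "\<exists>c. c \<in> A \<and> p \<in> fst c"
    using assms UNIV_I[of p] unfolding smooth_atlas_def by blast
  then have "chart_at A p \<in> A \<and> p \<in> fst (chart_at A p)"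
    unfolding chart_at_def by (rule someI_ex)
  then show "chart_at A p \<in> A" "p \<in> fst (chart_at A p)" by auto
qed

lemma smooth_map_on_id: "smooth_atlas A \<Longrightarrow> smooth_map_on A A UNIV id"
  by (simp add: smooth_atlas_def smooth_map_on_def)

lemma smooth_map_on_open:
  assumes A: "smooth_atlas A" and B: "smooth_atlas B" and f: "smooth_map_on A B W f" "open W"
    and c: "c \<in> A" and d: "d \<in> B"
  shows "open (W \<inter> fst c \<inter> f -` fst d)" "open (snd c ` (W \<inter> fst c \<inter> f -` fst d))"
proof -
  have "open (fst c)" "open (fst d)"
    using smooth_atlas_chart[OF A c] smooth_atlas_chart[OF B d] by (auto simp: is_chart_def)
  moreover from this have "open (W \<inter> f -` fst d)"
    using f by (intro continuous_open_preimage) (auto simp: smooth_map_on_def)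
  ultimately show "open (W \<inter> fst c \<inter> f -` fst d)"
    by (metis inf_assoc inf_commute open_Int)
  then have "open (snd c ` (fst c \<inter> (W \<inter> fst c \<inter> f -` fst d)))"
    by (rule open_chart_image[OF smooth_atlas_chart[OF A c]])
  then show "open (snd c ` (W \<inter> fst c \<inter> f -` fst d))"
    by (simp only: Int_absorb1 Int_lower2 le_infI1)
qed

lemma smooth_map_on_rep:
  assumes "smooth_map_on A B W f" "c \<in> A" "d \<in> B"
  shows "smooth_on (snd c ` (W \<inter> fst c \<inter> f -` fst d)) (snd d \<circ> f \<circ> chart_inv c)"
  using assms by (simp add: smooth_map_on_def)

lemma has_derivative_dcoord:
  assumes "smooth_map_on A B W f" "c \<in> A" "d \<in> B" "p \<in> W" "p \<in> fst c" "f p \<in> fst d"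
  shows "((snd d \<circ> f \<circ> chart_inv c) has_derivative dcoord c d f p) (at (snd c p))"
  unfolding dcoord_def using assms by (intro smooth_on_has_fderiv[OF smooth_map_on_rep]) auto

lemma linear_dcoord:
  assumes "smooth_map_on A B W f" "c \<in> A" "d \<in> B" "p \<in> W" "p \<in> fst c" "f p \<in> fst d"
  shows "linear (dcoord c d f p)"
  using has_derivative_dcoord[OF assms] by (rule has_derivative_linear)

lemma smooth_on_dcoord:
  assumes A: "smooth_atlas A" and B: "smooth_atlas B" and f: "smooth_map_on A B W f" "open W"
    and c: "c \<in> A" and d: "d \<in> B"
  shows "smooth_on (snd c ` (W \<inter> fst c \<inter> f -` fst d)) (\<lambda>x. dcoord c d f (chart_inv c x) v)"
proof (rule smooth_on_cong[OF smooth_map_on_open(2)[OF assms]])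
  show "smooth_on (snd c ` (W \<inter> fst c \<inter> f -` fst d)) (\<lambda>x. fderiv (snd d \<circ> f \<circ> chart_inv c) x v)"
    by (rule smooth_on_fderiv[OF smooth_map_on_rep[OF f(1) c d]])
  fix x assume "x \<in> snd c ` (W \<inter> fst c \<inter> f -` fst d)"
  then have "x \<in> snd c ` fst c" by blast
  then show "fderiv (snd d \<circ> f \<circ> chart_inv c) x v = dcoord c d f (chart_inv c x) v"
    by (simp add: dcoord_def chart_inv_right[OF smooth_atlas_chart[OF A c]])
qed

lemma dcoord_chain:
  assumes A: "smooth_atlas A" and B: "smooth_atlas B"
    and f: "smooth_map_on A B W f" "open W" "p \<in> W" and g: "smooth_map_on B C V g" "f p \<in> V"
    and c: "c \<in> A" "p \<in> fst c" and d: "d \<in> B" "f p \<in> fst d" and e: "e \<in> C" "g (f p) \<in> fst e"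
  shows "dcoord c e (g \<circ> f) p v = dcoord d e g (f p) (dcoord c d f p v)"
proof -
  let ?F = "snd d \<circ> f \<circ> chart_inv c" and ?G = "snd e \<circ> g \<circ> chart_inv d"
  let ?S = "snd c ` (W \<inter> fst c \<inter> f -` fst d)"
  note ic = smooth_atlas_chart[OF A c(1)] and id = smooth_atlas_chart[OF B d(1)]
  have F: "?F (snd c p) = snd d (f p)"
    by (simp add: chart_inv_left[OF ic c(2)])
  have "((\<lambda>x. ?G (?F x)) has_derivative (\<lambda>v. dcoord d e g (f p) (dcoord c d f p v))) (at (snd c p))"
    by (rule has_derivative_compose[OF has_derivative_dcoord[OF f(1) c(1) d(1) f(3) c(2) d(2)]])
      (unfold F, rule has_derivative_dcoord[OF g(1) d(1) e(1) g(2) d(2) e(2)])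
  then have "((snd e \<circ> (g \<circ> f) \<circ> chart_inv c) has_derivative
      (\<lambda>v. dcoord d e g (f p) (dcoord c d f p v))) (at (snd c p))"
  proof (rule has_derivative_transform_within_open)
    show "open ?S" by (rule smooth_map_on_open(2)[OF A B f(1,2) c(1) d(1)])
    show "snd c p \<in> ?S" using f c d by blast
    show "?G (?F x) = (snd e \<circ> (g \<circ> f) \<circ> chart_inv c) x" if "x \<in> ?S" for x
      using that by (auto simp: chart_inv_left[OF ic] chart_inv_left[OF id])
  qed
  then show ?thesis
    unfolding dcoord_def[of c e] by (simp add: fderiv_eqI)
qed

lemma dcoord_id:
  assumes A: "smooth_atlas A" and c: "c \<in> A" "p \<in> fst c"
  shows "dcoord c c id p v = v"
proof -
  have "fderiv (snd c \<circ> id \<circ> chart_inv c) (snd c p) = fderiv (\<lambda>x. x) (snd c p)"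
    using smooth_atlas_chart[OF A c(1)] c(2)
    by (intro fderiv_cong[where S = "snd c ` fst c"])
      (auto simp: is_chart_def chart_inv_right[OF smooth_atlas_chart[OF A c(1)]])
  then show ?thesis by (simp add: dcoord_def)
qed

lemma dcoord_id_trans:
  assumes A: "smooth_atlas A" and "c \<in> A" "d \<in> A" "e \<in> A" "p \<in> fst c" "p \<in> fst d" "p \<in> fst e"
  shows "dcoord d e id p (dcoord c d id p v) = dcoord c e id p v"
  using dcoord_chain[OF A A smooth_map_on_id[OF A] open_UNIV UNIV_I smooth_map_on_id[OF A] UNIV_I, of c p d e v]
    assms by simp

lemma dcoord_id_inverse:
  assumes A: "smooth_atlas A" and "c \<in> A" "d \<in> A" "p \<in> fst c" "p \<in> fst d"
  shows "dcoord d c id p (dcoord c d id p v) = v"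
  using dcoord_id_trans[OF A, of c d c p v] dcoord_id[OF A, of c p v] assms by simp

lemma linear_dcoord_id:
  assumes A: "smooth_atlas A" and "c \<in> A" "d \<in> A" "p \<in> fst c" "p \<in> fst d"
  shows "linear (dcoord c d id p)"
  using assms by (intro linear_dcoord[OF smooth_map_on_id[OF A]]) auto

lemma fderiv_dcoord_commute:
  assumes A: "smooth_atlas A" and B: "smooth_atlas B" and f: "smooth_map_on A B W f" "open W" "p \<in> W"
    and c: "c \<in> A" "p \<in> fst c" and d: "d \<in> B" "f p \<in> fst d"
  shows "fderiv (\<lambda>x. dcoord c d f (chart_inv c x) u) (snd c p) v =
    fderiv (\<lambda>x. dcoord c d f (chart_inv c x) v) (snd c p) u"
proof -
  let ?F = "snd d \<circ> f \<circ> chart_inv c" and ?S = "snd c ` (W \<inter> fst c \<inter> f -` fst d)"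
  have S: "open ?S" "snd c p \<in> ?S"
    using smooth_map_on_open(2)[OF A B f(1,2) c(1) d(1)] f(3) c(2) d(2) by auto
  have eq: "fderiv (\<lambda>x. dcoord c d f (chart_inv c x) u) (snd c p) = fderiv (\<lambda>x. fderiv ?F x u) (snd c p)" for u
  proof (rule fderiv_cong[OF S])
    fix x assume "x \<in> ?S"
    then have "x \<in> snd c ` fst c" by blast
    then show "dcoord c d f (chart_inv c x) u = fderiv ?F x u"
      by (simp add: dcoord_def chart_inv_right[OF smooth_atlas_chart[OF A c(1)]])
  qed
  show ?thesis
    unfolding eq by (rule fderiv_fderiv_commute[OF smooth_map_on_rep[OF f(1) c(1) d(1)] S])
qed

lemma smooth_atlas_euclidean: "smooth_atlas (euclidean_atlas :: ('e::euclidean_space, 'e) chart set)"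
proof -
  have inv: "chart_inv (UNIV, \<lambda>x::'e. x) = (\<lambda>x. x)"
    unfolding chart_inv_def by (auto intro!: inv_into_f_eq)
  have "smooth_on UNIV (\<lambda>x::'e. x)"
    by (rule smooth_on_linear[OF bounded_linear_ident])
  then show ?thesis
    by (simp add: smooth_atlas_def euclidean_atlas_def is_chart_def inv homeomorphism_def comp_def continuous_on_id)
qed

lemma euclidean_chart:
  "chart_at (euclidean_atlas :: ('e::euclidean_space, 'e) chart set) x = (UNIV, \<lambda>x. x)"
  "chart_inv (UNIV, \<lambda>x::'e::euclidean_space. x) = (\<lambda>x. x)"
  by (auto simp: chart_at_def euclidean_atlas_def chart_inv_def intro!: inv_into_f_eq)

section \<open>Horizontal lifts\<close>

locale submersion =
  fixes B :: "('q::{t2_space, second_countable_topology}, 'n::euclidean_space) chart set"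
    and h :: "'q \<Rightarrow> 'n \<Rightarrow>\<^sub>L 'n \<Rightarrow>\<^sub>L real"
    and A :: "('p::{t2_space, second_countable_topology}, 'm::euclidean_space) chart set"
    and g :: "'p \<Rightarrow> 'm \<Rightarrow>\<^sub>L 'm \<Rightarrow>\<^sub>L real"
    and \<pi> :: "'q \<Rightarrow> 'p"
  assumes atlas_B: "smooth_atlas B" and metric_h: "riemannian_metric B h"
    and atlas_A: "smooth_atlas A" and metric_g: "riemannian_metric A g"
    and submersion: "riemannian_submersion B h A g \<pi>"
begin

abbreviation "hor \<equiv> horizontal B h A \<pi>"
abbreviation "d\<pi> \<equiv> differential B A \<pi>"
abbreviation "cB \<equiv> chart_at B"
abbreviation "cA \<equiv> chart_at A"

lemmas chart_B = smooth_atlas_chart[OF atlas_B]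
  and chart_A = smooth_atlas_chart[OF atlas_A]
  and cB = chart_at[OF atlas_B]
  and cA = chart_at[OF atlas_A]

lemma smooth_pi: "smooth_map_on B A UNIV \<pi>"
  using submersion by (simp add: riemannian_submersion_def smooth_submersion_def)

lemma linear_dpi: "linear (d\<pi> q)"
  unfolding differential_eq by (rule linear_dcoord[OF smooth_pi]) (auto simp: cA cB)

lemma h_sym: "h q v w = h q w v"
  and h_pos: "v \<noteq> 0 \<Longrightarrow> h q v v > 0"
  using metric_h by (auto simp: riemannian_metric_def)

lemma linear_h_left: "linear (\<lambda>v. h q v w)"
  by (rule linearI) (auto simp: blinfun.add_left blinfun.add_right blinfun.scaleR_left blinfun.scaleR_right)

lemma linear_g_left: "linear (\<lambda>v. g p v w)"
  by (rule linearI) (auto simp: blinfun.add_left blinfun.add_right blinfun.scaleR_left blinfun.scaleR_right)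

lemma hor_add: "v \<in> hor q \<Longrightarrow> w \<in> hor q \<Longrightarrow> v + w \<in> hor q"
  and hor_scaleR: "v \<in> hor q \<Longrightarrow> k *\<^sub>R v \<in> hor q"
  and hor_diff: "v \<in> hor q \<Longrightarrow> w \<in> hor q \<Longrightarrow> v - w \<in> hor q"
  by (auto simp: horizontal_def linear_add[OF linear_h_left] linear_cmul[OF linear_h_left]
      linear_diff[OF linear_h_left])

text \<open>The difference of the two vectors is both horizontal and vertical, hence orthogonal to
  itself.\<close>

lemma hor_inj:
  assumes "v \<in> hor q" "w \<in> hor q" "d\<pi> q v = d\<pi> q w"
  shows "v = w"
proof (rule ccontr)
  assume "v \<noteq> w"
  then have "h q (v - w) (v - w) > 0" by (simp add: h_pos)
  moreover have "d\<pi> q (v - w) = 0" by (simp add: linear_diff[OF linear_dpi] assms)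
  then have "h q (v - w) (v - w) = 0"
    using hor_diff[OF assms(1,2)] by (simp add: horizontal_def)
  ultimately show False by simp
qed

definition lift :: "'q \<Rightarrow> 'm \<Rightarrow> 'n" where
  "lift q u = (SOME v. v \<in> hor q \<and> d\<pi> q v = u)"

lemma lift: "lift q u \<in> hor q" "d\<pi> q (lift q u) = u"
proof -
  have "u \<in> d\<pi> q ` hor q"
    using submersion by (simp add: riemannian_submersion_def)
  then have "\<exists>v. v \<in> hor q \<and> d\<pi> q v = u" by blast
  then have "lift q u \<in> hor q \<and> d\<pi> q (lift q u) = u"
    unfolding lift_def by (rule someI_ex)
  then show "lift q u \<in> hor q" "d\<pi> q (lift q u) = u" by auto
qed

lemma lift_dpi: "v \<in> hor q \<Longrightarrow> lift q (d\<pi> q v) = v"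
  by (rule hor_inj) (auto simp: lift)

lemma range_lift: "range (lift q) = hor q"
  using lift(1) lift_dpi by (metis image_subset_iff rangeI subsetI subset_antisym)

lemma linear_lift: "linear (lift q)"
  by (rule linearI; rule hor_inj[where q = q])
    (auto simp: lift hor_add hor_scaleR linear_add[OF linear_dpi] linear_cmul[OF linear_dpi])

text \<open>The vertical part of \<open>v\<close> is orthogonal to the lift, and on the horizontal
  part \<pi> is isometric. So the lift is the metric adjoint of \<open>d\<pi>\<close>, which gives
  both the formula for the pushforward and the smoothness of the lift.\<close>

lemma h_lift: "h q v (lift q u) = g (\<pi> q) (d\<pi> q v) u"
proof -
  let ?w = "lift q (d\<pi> q v)"
  have "d\<pi> q (v - ?w) = 0" by (simp add: linear_diff[OF linear_dpi] lift)
  then have "h q (lift q u) (v - ?w) = 0"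
    using lift(1)[of q u] by (simp add: horizontal_def)
  then have "h q v (lift q u) = h q ?w (lift q u)"
    using linear_diff[OF linear_h_left, of q v ?w "lift q u"] h_sym[of q "v - ?w" "lift q u"] by simp
  also have "\<dots> = g (\<pi> q) (d\<pi> q v) u"
    using submersion lift[of q] by (metis riemannian_submersion_def)
  finally show ?thesis .
qed

subsection \<open>Horizontal lifts in charts\<close>

definition chart_dom :: "('q, 'n) chart \<Rightarrow> ('p, 'm) chart \<Rightarrow> 'n set" where
  "chart_dom c d = snd c ` (fst c \<inter> \<pi> -` fst d)"

definition clift :: "('q, 'n) chart \<Rightarrow> ('p, 'm) chart \<Rightarrow> 'q \<Rightarrow> 'm \<Rightarrow> 'n" where
  "clift c d q u = dcoord (cB q) c id q (lift q (dcoord d (cA (\<pi> q)) id (\<pi> q) u))"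

lemma open_dom: "c \<in> B \<Longrightarrow> d \<in> A \<Longrightarrow> open (chart_dom c d)"
  using smooth_map_on_open(2)[OF atlas_B atlas_A smooth_pi open_UNIV] by (simp add: chart_dom_def)

lemma dom_point:
  assumes "c \<in> B" "x \<in> chart_dom c d"
  shows "chart_inv c x \<in> fst c" "\<pi> (chart_inv c x) \<in> fst d" "snd c (chart_inv c x) = x"
  using assms chart_inv_left[OF chart_B[OF assms(1)]] by (auto simp: chart_dom_def)

lemma in_dom: "q \<in> fst c \<Longrightarrow> \<pi> q \<in> fst d \<Longrightarrow> snd c q \<in> chart_dom c d"
  by (auto simp: chart_dom_def)

lemma dpi_chart:
  assumes "c \<in> B" "d \<in> A" "q \<in> fst c" "\<pi> q \<in> fst d"
  shows "dcoord c d \<pi> q v = dcoord (cA (\<pi> q)) d id (\<pi> q) (d\<pi> q (dcoord c (cB q) id q v))"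
proof -
  have "dcoord c d \<pi> q v = dcoord (cA (\<pi> q)) d id (\<pi> q) (dcoord c (cA (\<pi> q)) \<pi> q v)"
    using dcoord_chain[OF atlas_B atlas_A smooth_pi open_UNIV UNIV_I smooth_map_on_id[OF atlas_A] UNIV_I,
        of c q "cA (\<pi> q)" d v] assms cA by simp
  also have "dcoord c (cA (\<pi> q)) \<pi> q v = d\<pi> q (dcoord c (cB q) id q v)"
    unfolding differential_eq
    using dcoord_chain[OF atlas_B atlas_B smooth_map_on_id[OF atlas_B] open_UNIV UNIV_I smooth_pi UNIV_I,
        of c q "cB q" "cA (\<pi> q)" v] assms cA cB by simp
  finally show ?thesis .
qed

lemma dpi_clift:
  assumes "c \<in> B" "d \<in> A" "q \<in> fst c" "\<pi> q \<in> fst d"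
  shows "dcoord c d \<pi> q (clift c d q u) = u"
  using assms cA cB
  by (simp add: dpi_chart clift_def dcoord_id_inverse[OF atlas_B] dcoord_id_inverse[OF atlas_A] lift)

lemma clift_dpi:
  assumes "c \<in> B" "d \<in> A" "q \<in> fst c" "\<pi> q \<in> fst d" "v \<in> hor q"
  shows "clift c d q (dcoord c d \<pi> q (dcoord (cB q) c id q v)) = dcoord (cB q) c id q v"
  using assms cA cB
  by (simp add: dpi_chart clift_def dcoord_id_inverse[OF atlas_B] dcoord_id_inverse[OF atlas_A] lift_dpi)

lemma linear_clift:
  assumes "c \<in> B" "d \<in> A" "q \<in> fst c" "\<pi> q \<in> fst d"
  shows "linear (clift c d q)"
proof -
  have "linear (dcoord (cB q) c id q \<circ> (lift q \<circ> dcoord d (cA (\<pi> q)) id (\<pi> q)))"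
    using assms cA cB
    by (intro linear_compose linear_lift linear_dcoord_id[OF atlas_A] linear_dcoord_id[OF atlas_B]) auto
  then show ?thesis by (simp add: clift_def[abs_def] comp_def)
qed

lemma linear_dpi_chart:
  assumes "c \<in> B" "d \<in> A" "q \<in> fst c" "\<pi> q \<in> fst d"
  shows "linear (dcoord c d \<pi> q)"
  using assms by (intro linear_dcoord[OF smooth_pi]) auto

definition pi_rep :: "('q, 'n) chart \<Rightarrow> ('p, 'm) chart \<Rightarrow> 'n \<Rightarrow> 'm" where
  "pi_rep c d = snd d \<circ> \<pi> \<circ> chart_inv c"

lemma smooth_pi_rep: "c \<in> B \<Longrightarrow> d \<in> A \<Longrightarrow> smooth_on (chart_dom c d) (pi_rep c d)"
  using smooth_map_on_rep[OF smooth_pi] by (simp add: chart_dom_def pi_rep_def)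

lemma has_derivative_pi_rep:
  assumes "c \<in> B" "d \<in> A" "q \<in> fst c" "\<pi> q \<in> fst d"
  shows "(pi_rep c d has_derivative dcoord c d \<pi> q) (at (snd c q))"
  unfolding pi_rep_def using assms by (intro has_derivative_dcoord[OF smooth_pi]) auto

lemma smooth_dpi_chart:
  "c \<in> B \<Longrightarrow> d \<in> A \<Longrightarrow> smooth_on (chart_dom c d) (\<lambda>x. dcoord c d \<pi> (chart_inv c x) v)"
  using smooth_on_dcoord[OF atlas_B atlas_A smooth_pi open_UNIV] by (simp add: chart_dom_def)

lemma pi_rep_point:
  assumes "c \<in> B" "d \<in> A" "x \<in> chart_dom c d"
  shows "pi_rep c d x \<in> snd d ` fst d" "chart_inv d (pi_rep c d x) = \<pi> (chart_inv c x)"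
  using dom_point[OF assms(1,3)] chart_inv_left[OF chart_A[OF assms(2)]] by (auto simp: pi_rep_def)

lemma open_chart_range: "c \<in> B \<Longrightarrow> open (snd c ` fst c)" "d \<in> A \<Longrightarrow> open (snd d ` fst d)"
  using chart_A chart_B by (auto simp: is_chart_def)

section \<open>The Gram matrix of \<open>h\<close> in a chart and the smoothness of the lift\<close>

definition gram :: "('q, 'n) chart \<Rightarrow> 'q \<Rightarrow> 'n \<Rightarrow> 'n" where
  "gram c q w = (\<Sum>b\<in>Basis. h q (dcoord c (cB q) id q w) (dcoord c (cB q) id q b) *\<^sub>R b)"

lemma gram_inner:
  assumes "c \<in> B" "q \<in> fst c"
  shows "gram c q w \<bullet> w' = h q (dcoord c (cB q) id q w) (dcoord c (cB q) id q w')"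
proof -
  let ?k = "\<lambda>w'. h q (dcoord c (cB q) id q w) (dcoord c (cB q) id q w')"
  have "linear (blinfun_apply (h q (dcoord c (cB q) id q w)) \<circ> dcoord c (cB q) id q)"
    using assms cB by (intro linear_compose linear_dcoord_id[OF atlas_B] 
        bounded_linear.linear[OF blinfun.bounded_linear_right]) auto
  then have "?k w' = (\<Sum>b\<in>Basis. (w' \<bullet> b) *\<^sub>R ?k b)"
    unfolding comp_def by (rule linear_basis_expansion)
  also have "\<dots> = gram c q w \<bullet> w'"
    by (simp add: gram_def inner_sum_left inner_commute[of w'] mult.commute)
  finally show ?thesis by simp
qed

lemma linear_gram:
  assumes "c \<in> B" "q \<in> fst c"
  shows "linear (gram c q)"
proof -
  have "linear (dcoord c (cB q) id q)"
    using assms cB by (intro linear_dcoord_id[OF atlas_B]) auto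
  then show ?thesis
    unfolding gram_def
    by (intro linearI)
      (auto simp: linear_add[OF linear_h_left] linear_cmul[OF linear_h_left] linear_add linear_cmul
        scaleR_add_left sum.distrib scaleR_sum_right)
qed

lemma bij_gram:
  assumes c: "c \<in> B" "q \<in> fst c"
  shows "bij (gram c q)"
proof -
  have "w = 0" if "gram c q w = 0" for w
  proof (rule ccontr)
    assume "w \<noteq> 0"
    let ?v = "dcoord c (cB q) id q w"
    have "linear (dcoord (cB q) c id q)"
      using c cB by (intro linear_dcoord_id[OF atlas_B]) auto
    moreover have "dcoord (cB q) c id q ?v = w"
      using c cB by (intro dcoord_id_inverse[OF atlas_B]) auto
    ultimately have "?v \<noteq> 0"
      using \<open>w \<noteq> 0\<close> linear_0 by metis
    then have "gram c q w \<bullet> w > 0"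
      by (simp add: gram_inner[OF c] h_pos)
    with that show False by simp
  qed
  then have "inj (gram c q)"
    using linear_injective_0[OF linear_gram[OF c]] by blast
  then show ?thesis
    using linear_injective_imp_surjective[OF linear_gram[OF c]] by (simp add: bij_def)
qed

lemma smooth_gram:
  assumes c: "c \<in> B"
  shows "smooth_on (snd c ` fst c) (\<lambda>x. gram c (chart_inv c x) w)"
proof -
  have "smooth_on (snd c ` fst c) (\<lambda>x. h (chart_inv c x)
      (dcoord c (cB (chart_inv c x)) id (chart_inv c x) w) (dcoord c (cB (chart_inv c x)) id (chart_inv c x) b))" for b
    using metric_h c by (simp add: riemannian_metric_def Let_def tangent_of_coord_eq)
  then show ?thesis
    unfolding gram_def by (intro smooth_on_sum smooth_on_scaleR smooth_on_const open_chart_range(1)[OF c])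
qed

lemma smooth_gram_inv:
  assumes c: "c \<in> B"
  shows "smooth_on (snd c ` fst c) (\<lambda>x. inv (gram c (chart_inv c x)) w)"
proof (rule smooth_on_inverse_family[where H = "\<lambda>x. gram c (chart_inv c x)"])
  show "smooth_on (snd c ` fst c) (\<lambda>x. gram c (chart_inv c x) w)" for w
    by (rule smooth_gram[OF c])
next
  fix x assume "x \<in> snd c ` fst c"
  then have q: "chart_inv c x \<in> fst c"
    by (rule chart_inv_in[OF chart_B[OF c]])
  show "linear (gram c (chart_inv c x))"
    by (rule linear_gram[OF c q])
  show "gram c (chart_inv c x) (inv (gram c (chart_inv c x)) w) = w" for w
    using bij_gram[OF c q] by (simp add: bij_is_surj surj_f_inv_f)
  show "inv (gram c (chart_inv c x)) (gram c (chart_inv c x) w) = w" for w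
    using bij_gram[OF c q] by (simp add: bij_is_inj)
qed (rule open_chart_range(1)[OF c])

text \<open>Through this formula the smoothness of the lift reduces to that of the inverse Gram matrix.\<close>

lemma clift_inner:
  assumes c: "c \<in> B" "q \<in> fst c" and d: "d \<in> A" "\<pi> q \<in> fst d"
  shows "clift c d q u \<bullet> b = g (\<pi> q)
    (dcoord d (cA (\<pi> q)) id (\<pi> q) (dcoord c d \<pi> q (inv (gram c q) b))) (dcoord d (cA (\<pi> q)) id (\<pi> q) u)"
proof -
  let ?k = "inv (gram c q) b"
  have "clift c d q u \<bullet> b = gram c q ?k \<bullet> clift c d q u"
    using bij_gram[OF c] by (simp add: bij_is_surj surj_f_inv_f inner_commute)
  also have "\<dots> = h q (dcoord c (cB q) id q ?k) (lift q (dcoord d (cA (\<pi> q)) id (\<pi> q) u))"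
    using c cB by (simp add: gram_inner clift_def dcoord_id_inverse[OF atlas_B])
  also have "\<dots> = g (\<pi> q) (d\<pi> q (dcoord c (cB q) id q ?k)) (dcoord d (cA (\<pi> q)) id (\<pi> q) u)"
    by (rule h_lift)
  also have "d\<pi> q (dcoord c (cB q) id q ?k) =
      dcoord d (cA (\<pi> q)) id (\<pi> q) (dcoord c d \<pi> q ?k)"
    using c d cA by (simp add: dpi_chart dcoord_id_inverse[OF atlas_A])
  finally show ?thesis .
qed

lemma smooth_clift:
  assumes c: "c \<in> B" and d: "d \<in> A"
  shows "smooth_on (chart_dom c d) (\<lambda>x. clift c d (chart_inv c x) u)"
proof (rule smooth_on_componentwise[OF _ open_dom[OF c d]])
  fix b :: 'n
  \<comment> \<open>Leaving the argument \<open>w\<close> free makes \<open>G\<close> a smooth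
    family of linear functionals, into which the moving vector from \<open>clift_inner\<close> can
    be inserted by \<open>smooth_on_family_apply\<close>.\<close>
  define G where "G p w = g p (dcoord d (cA p) id p w) (dcoord d (cA p) id p u)" for p w
  have G: "smooth_on (chart_dom c d) (\<lambda>x. G (\<pi> (chart_inv c x)) w)" for w
  proof (rule smooth_on_cong[OF open_dom[OF c d]])
    have "smooth_on (snd d ` fst d) (\<lambda>y. G (chart_inv d y) w)"
      using metric_g d by (simp add: riemannian_metric_def Let_def tangent_of_coord_eq G_def)
    then show "smooth_on (chart_dom c d) (\<lambda>x. G (chart_inv d (pi_rep c d x)) w)"
      using pi_rep_point(1)[OF c d]
      by (intro smooth_on_compose[OF _ smooth_pi_rep[OF c d] _ open_dom[OF c d] open_chart_range(2)[OF d],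
            of "\<lambda>y. G (chart_inv d y) w"]) auto
    show "G (chart_inv d (pi_rep c d x)) w = G (\<pi> (chart_inv c x)) w" if "x \<in> chart_dom c d" for x
      using pi_rep_point(2)[OF c d that] by simp
  qed
  have linG: "linear (G p)" if "p \<in> fst d" for p
  proof -
    have "linear ((\<lambda>v. g p v (dcoord d (cA p) id p u)) \<circ> dcoord d (cA p) id p)"
      using d that cA by (intro linear_compose linear_g_left linear_dcoord_id[OF atlas_A]) auto
    then show ?thesis by (simp add: G_def[abs_def] comp_def)
  qed
  have sub: "chart_dom c d \<subseteq> snd c ` fst c" by (auto simp: chart_dom_def)
  have v: "smooth_on (chart_dom c d) (\<lambda>x. dcoord c d \<pi> (chart_inv c x) (inv (gram c (chart_inv c x)) b))"
    using dom_point[OF c]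
    by (intro smooth_on_family_apply[OF open_dom[OF c d] linear_dpi_chart[OF c d] smooth_dpi_chart[OF c d]
          smooth_on_subset[OF smooth_gram_inv[OF c] sub]]) auto
  have "smooth_on (chart_dom c d) (\<lambda>x. G (\<pi> (chart_inv c x))
      (dcoord c d \<pi> (chart_inv c x) (inv (gram c (chart_inv c x)) b)))"
    using dom_point[OF c] by (intro smooth_on_family_apply[OF open_dom[OF c d] linG G v]) auto
  then show "smooth_on (chart_dom c d) (\<lambda>x. clift c d (chart_inv c x) u \<bullet> b)"
  proof (rule smooth_on_cong[OF open_dom[OF c d], rotated])
    fix x assume "x \<in> chart_dom c d"
    from dom_point[OF c this]
    show "G (\<pi> (chart_inv c x)) (dcoord c d \<pi> (chart_inv c x) (inv (gram c (chart_inv c x)) b)) =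
        clift c d (chart_inv c x) u \<bullet> b"
      by (simp add: clift_inner[OF c _ d] G_def)
  qed
qed

section \<open>Flatness and integral manifolds\<close>

text \<open>In the chart \<open>c\<close>, the lifts of the coordinate fields \<open>a\<close> and \<open>b\<close> of \<open>d\<close> commute at \<open>q\<close>.\<close>

definition flat_at :: "('q, 'n) chart \<Rightarrow> ('p, 'm) chart \<Rightarrow> 'q \<Rightarrow> bool" where
  "flat_at c d q \<longleftrightarrow> (\<forall>a b.
    fderiv (\<lambda>x. clift c d (chart_inv c x) a) (snd c q) (clift c d q b) =
    fderiv (\<lambda>x. clift c d (chart_inv c x) b) (snd c q) (clift c d q a))"

lemma linear_clift_dom:
  assumes "c \<in> B" "d \<in> A" "x \<in> chart_dom c d"
  shows "linear (clift c d (chart_inv c x))"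
  using linear_clift[OF assms(1,2)] dom_point[OF assms(1,3)] by blast

text \<open>Base point and vector move independently of each other, so the product rule is applied
  to the evaluation map (x, a) \<mapsto> \<open>clift c d (chart_inv c x) a\<close> on a product
  space and then composed with (\<sigma>, v).\<close>

lemma has_derivative_clift_apply:
  assumes c: "c \<in> B" and d: "d \<in> A" and \<sigma>: "(\<sigma> has_derivative \<sigma>') (at w)" and w: "\<sigma> w \<in> chart_dom c d"
    and v: "(v has_derivative v') (at w)"
  shows "((\<lambda>y. clift c d (chart_inv c (\<sigma> y)) (v y)) has_derivative
    (\<lambda>u. fderiv (\<lambda>x. clift c d (chart_inv c x) (v w)) (\<sigma> w) (\<sigma>' u) +
      clift c d (chart_inv c (\<sigma> w)) (v' u))) (at w)"
proof -
  let ?T = "\<lambda>x. clift c d (chart_inv c x)"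
  have "((\<lambda>z. ?T (fst z) (snd z)) has_derivative
      (\<lambda>u. fderiv (\<lambda>z. ?T (fst z) (snd (\<sigma> w, v w))) (\<sigma> w, v w) u + ?T (fst (\<sigma> w, v w)) (snd u)))
      (at (\<sigma> w, v w))"
  proof (rule has_derivative_family_apply[where S = "chart_dom c d \<times> UNIV"])
    show "open (chart_dom c d \<times> UNIV)" by (intro open_Times open_dom c d open_UNIV)
    show "(\<sigma> w, v w) \<in> chart_dom c d \<times> UNIV" using w by simp
    show "linear (?T (fst z))" if "z \<in> chart_dom c d \<times> UNIV" for z
      using that by (intro linear_clift_dom c d) auto
    show "(\<lambda>z. ?T (fst z) a) differentiable at (\<sigma> w, v w)" for a
      using has_derivative_compose[OF bounded_linear_imp_has_derivative[OF bounded_linear_fst, of "at (\<sigma> w, v w)"],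
          OF smooth_on_has_fderiv[OF smooth_clift[OF c d], of "fst (\<sigma> w, v w)" a]] w
      by (auto simp: differentiable_def)
    show "(snd has_derivative snd) (at (\<sigma> w, v w))"
      by (rule bounded_linear_imp_has_derivative[OF bounded_linear_snd])
  qed
  moreover have "fderiv (\<lambda>z. ?T (fst z) a) (\<sigma> w, v w) = (\<lambda>u. fderiv (\<lambda>x. ?T x a) (\<sigma> w) (fst u))" for a
    using has_derivative_compose[OF bounded_linear_imp_has_derivative[OF bounded_linear_fst, of "at (\<sigma> w, v w)"],
          OF smooth_on_has_fderiv[OF smooth_clift[OF c d], of "fst (\<sigma> w, v w)" a]] w
    by (intro fderiv_eqI) auto
  ultimately have "((\<lambda>z. ?T (fst z) (snd z)) has_derivative
      (\<lambda>u. fderiv (\<lambda>x. ?T x (v w)) (\<sigma> w) (fst u) + ?T (\<sigma> w) (snd u))) (at (\<sigma> w, v w))"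
    by simp
  from has_derivative_compose[OF has_derivative_Pair[OF \<sigma> v] this]
  show ?thesis by simp
qed

text \<open>The two coordinate lifts are intertwined by the derivatives \<open>T\<close> and
  \<open>S\<close> of the transition maps. Differentiating that relation adds only second
  derivatives of transition maps, which are symmetric, so the commutator itself transforms like a
  tangent vector.\<close>

lemma flat_at_chart_change:
  assumes c: "c \<in> B" "q \<in> fst c" and c': "c' \<in> B" "q \<in> fst c'"
    and d: "d \<in> A" "\<pi> q \<in> fst d" and d': "d' \<in> A" "\<pi> q \<in> fst d'" and flat: "flat_at c' d' q"
  shows "flat_at c d q"
proof -
  let ?M = "\<lambda>x. clift c d (chart_inv c x)" and ?M' = "\<lambda>x. clift c' d' (chart_inv c' x)"
  let ?x = "snd c q" and ?x' = "snd c' q"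
  define \<tau> where "\<tau> = snd c' \<circ> id \<circ> chart_inv c"
  define T where "T x = dcoord c c' id (chart_inv c x)" for x
  define S where "S y = dcoord d d' id (chart_inv d y)" for y
  define Z where "Z = snd c ` ((fst c \<inter> fst c') \<inter> \<pi> -` (fst d \<inter> fst d'))"
  have Z: "open Z" "?x \<in> Z"
  proof -
    have "open ((UNIV \<inter> fst c \<inter> \<pi> -` fst d) \<inter> (UNIV \<inter> fst c' \<inter> \<pi> -` fst d'))"
      using smooth_map_on_open(1)[OF atlas_B atlas_A smooth_pi open_UNIV] c d c' d' by blast
    from open_chart_image[OF chart_B[OF c(1)] this] show "open Z"
      unfolding Z_def by (rule back_subst[where P = "open"]) blast
    show "?x \<in> Z" using c c' d d' by (auto simp: Z_def)
  qed
  have qx: "chart_inv c ?x = q" "chart_inv c' ?x' = q" "pi_rep c d ?x = snd d (\<pi> q)"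
    "chart_inv d (snd d (\<pi> q)) = \<pi> q" "\<tau> ?x = ?x'"
    using c c' d by (simp_all add: chart_inv_left chart_B chart_A pi_rep_def \<tau>_def)
  have \<tau>: "(\<tau> has_derivative T ?x) (at ?x)"
    unfolding \<tau>_def T_def qx using c c' by (intro has_derivative_dcoord[OF smooth_map_on_id[OF atlas_B]]) auto
  have smT: "smooth_on (snd c ` (fst c \<inter> fst c')) (\<lambda>x. T x w)" for w
    unfolding T_def using smooth_on_dcoord[OF atlas_B atlas_B smooth_map_on_id[OF atlas_B] open_UNIV c(1) c'(1)] by simp
  have smS: "smooth_on (snd d ` (fst d \<inter> fst d')) (\<lambda>y. S y a)" for a
    unfolding S_def using smooth_on_dcoord[OF atlas_A atlas_A smooth_map_on_id[OF atlas_A] open_UNIV d(1) d'(1)] by simp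
  have eq: "?M' (\<tau> x) (S (pi_rep c d x) a) = T x (?M x a)" if "x \<in> Z" for x a
  proof -
    obtain r where r: "x = snd c r" "r \<in> fst c" "r \<in> fst c'" "\<pi> r \<in> fst d" "\<pi> r \<in> fst d'"
      using \<open>x \<in> Z\<close> by (auto simp: Z_def)
    have "chart_inv c x = r" "chart_inv c' (\<tau> x) = r" "chart_inv d (pi_rep c d x) = \<pi> r"
      using r c c' d by (simp_all add: chart_inv_left chart_B chart_A pi_rep_def \<tau>_def)
    then show ?thesis
      using r c(1) c'(1) d(1) d'(1) cA cB
      by (simp add: S_def T_def clift_def dcoord_id_trans[OF atlas_A] dcoord_id_trans[OF atlas_B])
  qed
  have Tlin: "linear (T x)" if "x \<in> Z" for x
    using that c c' chart_inv_left[OF chart_B[OF c(1)]]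
    by (auto simp: T_def Z_def intro!: linear_dcoord_id[OF atlas_B])
  have Zsub: "Z \<subseteq> snd c ` (fst c \<inter> fst c')" by (auto simp: Z_def)
  define b' where "b' b = S (snd d (\<pi> q)) b" for b
  have Mb': "clift c' d' q (b' b) = T ?x (clift c d q b)" for b
    using eq[OF Z(2), of b] qx by (simp add: b'_def)
  \<comment> \<open>Both sides of \<open>eq\<close> are differentiated at \<open>q\<close> in the
    direction of the lift of \<open>b\<close>, which \<open>T\<close> carries to the lift of
    \<open>b' b\<close> and which \<pi> projects to \<open>b\<close>.\<close>
  have main: "fderiv (\<lambda>x. ?M' x (b' a)) ?x' (clift c' d' q (b' b)) +
      clift c' d' q (fderiv (\<lambda>y. S y a) (snd d (\<pi> q)) b) =
      fderiv (\<lambda>x. T x (clift c d q a)) ?x (clift c d q b) +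
      T ?x (fderiv (\<lambda>x. ?M x a) ?x (clift c d q b))" for a b
  proof -
    have "((\<lambda>x. S (pi_rep c d x) a) has_derivative
        (\<lambda>u. fderiv (\<lambda>y. S y a) (snd d (\<pi> q)) (dcoord c d \<pi> q u))) (at ?x)"
      using has_derivative_compose[OF has_derivative_pi_rep[OF c(1) d(1) c(2) d(2)], of "\<lambda>y. S y a"]
        smooth_on_has_fderiv[OF smS, of "snd d (\<pi> q)" a] d d' qx(3) by simp
    from has_derivative_clift_apply[OF c'(1) d'(1) \<tau> _ this]
    have 1: "((\<lambda>x. ?M' (\<tau> x) (S (pi_rep c d x) a)) has_derivative
        (\<lambda>u. fderiv (\<lambda>x. ?M' x (b' a)) ?x' (T ?x u) +
          clift c' d' q (fderiv (\<lambda>y. S y a) (snd d (\<pi> q)) (dcoord c d \<pi> q u)))) (at ?x)"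
      using in_dom[OF c'(2) d'(2)] by (simp add: qx b'_def)
    have "((\<lambda>x. T x (?M x a)) has_derivative
        (\<lambda>u. fderiv (\<lambda>x. T x (?M ?x a)) ?x u + T ?x (fderiv (\<lambda>x. ?M x a) ?x u))) (at ?x)"
      using Zsub Z(2) in_dom[OF c(2) d(2)]
      by (intro has_derivative_family_apply[OF Z Tlin] smooth_on_differentiable[OF smT]
          smooth_on_has_fderiv[OF smooth_clift[OF c(1) d(1)]]) auto
    then have 2: "((\<lambda>x. ?M' (\<tau> x) (S (pi_rep c d x) a)) has_derivative
        (\<lambda>u. fderiv (\<lambda>x. T x (?M ?x a)) ?x u + T ?x (fderiv (\<lambda>x. ?M x a) ?x u))) (at ?x)"
      by (rule has_derivative_transform_within_open[OF _ Z]) (simp add: eq)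
    have "fderiv (\<lambda>x. ?M' x (b' a)) ?x' (T ?x u) +
          clift c' d' q (fderiv (\<lambda>y. S y a) (snd d (\<pi> q)) (dcoord c d \<pi> q u)) =
        fderiv (\<lambda>x. T x (?M ?x a)) ?x u + T ?x (fderiv (\<lambda>x. ?M x a) ?x u)" for u
      by (rule fun_cong[OF has_derivative_unique[OF 1 2]])
    from this[of "clift c d q b"] show ?thesis
      using dpi_clift[OF c(1) d(1) c(2) d(2)] by (simp add: Mb' qx)
  qed
  have symT: "fderiv (\<lambda>x. T x u) ?x w = fderiv (\<lambda>x. T x w) ?x u" for u w
    unfolding T_def using c c'
    by (intro fderiv_dcoord_commute[OF atlas_B atlas_B smooth_map_on_id[OF atlas_B] open_UNIV]) auto
  have symS: "fderiv (\<lambda>y. S y u) (snd d (\<pi> q)) w = fderiv (\<lambda>y. S y w) (snd d (\<pi> q)) u" for u w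
    unfolding S_def using d d'
    by (intro fderiv_dcoord_commute[OF atlas_A atlas_A smooth_map_on_id[OF atlas_A] open_UNIV]) auto
  have cancel: "f1 = f2" if "p1 + s1 = t1 + f1" "p2 + s2 = t2 + f2" "t1 = t2" "s1 = s2" "p1 = p2"
    for f1 f2 p1 p2 s1 s2 t1 t2 :: 'n
    using that by simp
  have inv: "dcoord c' c id q (T ?x w) = w" for w
    unfolding T_def qx using c c' by (intro dcoord_id_inverse[OF atlas_B]) auto
  have symT': "clift c' d' q (fderiv (\<lambda>y. S y a) (snd d (\<pi> q)) b) =
      clift c' d' q (fderiv (\<lambda>y. S y b) (snd d (\<pi> q)) a)" for a b
    using symS by simp
  \<comment> \<open>In \<open>main\<close> for (a, b) and for (b, a) the first terms agree by
    flatness in the primed charts and the terms with derivatives of \<open>S\<close> and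
    \<open>T\<close> by symmetry; what remains is the claim after the invertible map
    \<open>T ?x\<close>.\<close>
  have "T ?x (fderiv (\<lambda>x. ?M x a) ?x (clift c d q b)) = T ?x (fderiv (\<lambda>x. ?M x b) ?x (clift c d q a))" for a b
  proof (rule cancel[OF main main symT symT'])
    show "fderiv (\<lambda>x. ?M' x (b' a)) ?x' (clift c' d' q (b' b)) =
        fderiv (\<lambda>x. ?M' x (b' b)) ?x' (clift c' d' q (b' a))"
      using flat unfolding flat_at_def by blast
  qed
  then show ?thesis
    unfolding flat_at_def using inv by metis
qed

section \<open>From integral manifolds to flatness and back\<close>

lemma integral_manifold_flat:
  assumes s: "integral_manifold B hor (W :: 'k::euclidean_space set) s" and w: "w \<in> W"
    and c: "c \<in> B" "s w \<in> fst c" and d: "d \<in> A" "\<pi> (s w) \<in> fst d"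
  shows "flat_at c d (s w)"
proof -
  let ?E = "euclidean_atlas :: ('k, 'k) chart set" and ?e = "(UNIV, \<lambda>x. x) :: ('k, 'k) chart"
  let ?M = "\<lambda>x. clift c d (chart_inv c x)"
  have W: "open W" and sm: "smooth_map_on ?E B W s"
    and range: "\<And>x. x \<in> W \<Longrightarrow> range (differential ?E B s x) = hor (s x)"
    using s by (auto simp: integral_manifold_def)
  have e: "?e \<in> ?E" by (simp add: euclidean_atlas_def)
  note atlas_E = smooth_atlas_euclidean
  define V where "V = W \<inter> s -` (fst c \<inter> \<pi> -` fst d)"
  define \<sigma> where "\<sigma> = snd c \<circ> s"
  have "open (UNIV \<inter> fst c \<inter> \<pi> -` fst d)"
    by (rule smooth_map_on_open(1)[OF atlas_B atlas_A smooth_pi open_UNIV c(1) d(1)])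
  then have "open (fst c \<inter> \<pi> -` fst d)" by simp
  then have V: "open V" "w \<in> V"
    unfolding V_def using W sm w c d continuous_open_preimage[of W s "fst c \<inter> \<pi> -` fst d"]
    by (simp_all add: smooth_map_on_def)
  have \<sigma>: "smooth_on V \<sigma>"
    using smooth_on_subset[OF smooth_map_on_rep[OF sm e c(1)], of V]
    by (auto simp: V_def \<sigma>_def euclidean_chart comp_def)
  have \<sigma>_dom: "\<sigma> ` V \<subseteq> chart_dom c d"
    by (auto simp: V_def \<sigma>_def chart_dom_def)
  have s_eq: "chart_inv c (\<sigma> x) = s x" if "x \<in> V" for x
    using that chart_inv_left[OF chart_B[OF c(1)]] by (auto simp: V_def \<sigma>_def)
  have ds: "fderiv \<sigma> x u = dcoord (cB (s x)) c id (s x) (differential ?E B s x u)" if "x \<in> V" for x u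
  proof -
    have "dcoord ?e c (id \<circ> s) x u = dcoord (cB (s x)) c id (s x) (dcoord ?e (cB (s x)) s x u)"
      using that c e cB
      by (intro dcoord_chain[OF atlas_E atlas_B sm W _ smooth_map_on_id[OF atlas_B]]) (auto simp: V_def)
    then show ?thesis
      by (simp add: dcoord_def[of ?e c] \<sigma>_def euclidean_chart differential_eq comp_def)
  qed
  define \<psi> where "\<psi> = (\<lambda>x. pi_rep c d (\<sigma> x))"
  have \<psi>: "smooth_on V \<psi>"
    unfolding \<psi>_def
    by (rule smooth_on_compose[OF smooth_pi_rep[OF c(1) d(1)] \<sigma> \<sigma>_dom V(1) open_dom[OF c(1) d(1)]])
  have d\<psi>: "fderiv \<psi> x u = dcoord c d \<pi> (s x) (fderiv \<sigma> x u)" if "x \<in> V" for x u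
  proof -
    have "(pi_rep c d has_derivative dcoord c d \<pi> (s x)) (at (\<sigma> x))"
      using that c(1) d(1) has_derivative_pi_rep[of c d "s x"] by (auto simp: V_def \<sigma>_def)
    from has_derivative_compose[OF smooth_on_has_fderiv[OF \<sigma> that] this]
    show ?thesis unfolding \<psi>_def by (simp add: fderiv_eqI)
  qed
  \<comment> \<open>Tangent vectors of the integral manifold are horizontal, so each is the lift of
    its own projection.\<close>
  have eq: "fderiv \<sigma> x u = ?M (\<sigma> x) (fderiv \<psi> x u)" if "x \<in> V" for x u
  proof -
    have "differential ?E B s x u \<in> hor (s x)"
      using range[of x] that by (auto simp: V_def)
    then show ?thesis
      using that c(1) d(1) by (simp add: s_eq d\<psi> ds clift_dpi V_def)
  qed
  have main: "fderiv (\<lambda>x. fderiv \<sigma> x u) w v =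
      fderiv (\<lambda>x. ?M x (fderiv \<psi> w u)) (\<sigma> w) (fderiv \<sigma> w v) + ?M (\<sigma> w) (fderiv (\<lambda>x. fderiv \<psi> x u) w v)" for u v
  proof -
    have "((\<lambda>x. ?M (\<sigma> x) (fderiv \<psi> x u)) has_derivative
        (\<lambda>v. fderiv (\<lambda>x. ?M x (fderiv \<psi> w u)) (\<sigma> w) (fderiv \<sigma> w v) +
          ?M (\<sigma> w) (fderiv (\<lambda>x. fderiv \<psi> x u) w v))) (at w)"
      using \<sigma>_dom V(2)
      by (intro has_derivative_clift_apply[OF c(1) d(1)] smooth_on_has_fderiv[OF \<sigma>]
          smooth_on_has_fderiv[OF smooth_on_fderiv[OF \<psi>]]) auto
    then have "((\<lambda>x. fderiv \<sigma> x u) has_derivative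
        (\<lambda>v. fderiv (\<lambda>x. ?M x (fderiv \<psi> w u)) (\<sigma> w) (fderiv \<sigma> w v) +
          ?M (\<sigma> w) (fderiv (\<lambda>x. fderiv \<psi> x u) w v))) (at w)"
      by (rule has_derivative_transform_within_open[OF _ V]) (simp add: eq)
    then show ?thesis by (simp add: fderiv_eqI)
  qed
  have "fderiv (\<lambda>x. ?M x (fderiv \<psi> w u)) (\<sigma> w) (?M (\<sigma> w) (fderiv \<psi> w v)) =
      fderiv (\<lambda>x. ?M x (fderiv \<psi> w v)) (\<sigma> w) (?M (\<sigma> w) (fderiv \<psi> w u))" for u v
    using main[of u v] main[of v u] fderiv_fderiv_commute[OF \<sigma> V, of u v]
      fderiv_fderiv_commute[OF \<psi> V, of u v] eq[OF V(2)] by (metis add_right_imp_eq)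
  \<comment> \<open>So far the lifts commute only for vectors in the image of
    \<open>fderiv \<psi> w\<close>. That image is everything, since the tangent space of the
    integral manifold is all of the horizontal space and \<pi> maps the latter onto the
    base.\<close>
  moreover have "\<exists>u. a = fderiv \<psi> w u" for a
  proof -
    have "lift (s w) (dcoord d (cA (\<pi> (s w))) id (\<pi> (s w)) a) \<in> hor (s w)"
      by (rule lift)
    then obtain u where u: "differential ?E B s w u = lift (s w) (dcoord d (cA (\<pi> (s w))) id (\<pi> (s w)) a)"
      using range[OF w] by (metis rangeE)
    then have "fderiv \<psi> w u = dcoord c d \<pi> (s w) (clift c d (s w) a)"
      by (simp add: d\<psi>[OF V(2)] ds[OF V(2)] clift_def)
    then show ?thesis
      using dpi_clift[OF c(1) d(1) c(2) d(2)] by metis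
  qed
  ultimately show ?thesis
    unfolding flat_at_def using s_eq[OF V(2)] by (metis \<sigma>_def comp_apply)
qed

lemma flat_integrable:
  assumes flat: "\<And>q. flat_at (cB q) (cA (\<pi> q)) q"
  shows "integrable_distribution TYPE('m) B hor"
  unfolding integrable_distribution_def
proof
  fix q
  define c d where "c = cB q" and "d = cA (\<pi> q)"
  have c: "c \<in> B" "q \<in> fst c" and d: "d \<in> A" "\<pi> q \<in> fst d"
    using cA cB by (auto simp: c_def d_def)
  let ?M = "\<lambda>x. clift c d (chart_inv c x)"
  let ?E = "euclidean_atlas :: ('m, 'm) chart set" and ?e = "(UNIV, \<lambda>x. x) :: ('m, 'm) chart"
  have e: "?e \<in> ?E" by (simp add: euclidean_atlas_def)
  \<comment> \<open>The hypothesis speaks at each point about that point's own preferred charts,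
    while the differential equation needs one fixed pair \<open>c\<close>, \<open>d\<close> on all
    of \<open>chart_dom c d\<close>.\<close>
  have flat': "fderiv (\<lambda>z. ?M z a) x (?M x b) = fderiv (\<lambda>z. ?M z b) x (?M x a)" if "x \<in> chart_dom c d" for x a b
  proof -
    note r = dom_point[OF c(1) that]
    have "flat_at c d (chart_inv c x)"
      using c d r cA cB by (intro flat_at_chart_change[OF _ _ _ _ _ _ _ _ flat]) auto
    then show ?thesis
      unfolding flat_at_def r(3) by blast
  qed
  obtain r \<sigma> where r: "r > 0" and \<sigma>0: "\<sigma> 0 = snd c q" and \<sigma>_dom: "\<sigma> ` ball 0 r \<subseteq> chart_dom c d"
    and \<sigma>: "smooth_on (ball 0 r) \<sigma>" and d\<sigma>: "\<And>v. v \<in> ball 0 r \<Longrightarrow> (\<sigma> has_derivative ?M (\<sigma> v)) (at v)"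
    using flat_family_integral[OF open_dom[OF c(1) d(1)] in_dom[OF c(2) d(2)]
        linear_clift_dom[OF c(1) d(1)] smooth_clift[OF c(1) d(1)] flat'] by metis
  define s where "s = chart_inv c \<circ> \<sigma>"
  let ?W = "ball (0::'m) r"
  have sx: "s x \<in> fst c" "\<pi> (s x) \<in> fst d" "snd c (s x) = \<sigma> x" if "x \<in> ?W" for x
  proof -
    have "\<sigma> x \<in> chart_dom c d" using \<sigma>_dom that by blast
    from dom_point[OF c(1) this] show "s x \<in> fst c" "\<pi> (s x) \<in> fst d" "snd c (s x) = \<sigma> x"
      by (simp_all add: s_def)
  qed
  have inj: "inj_on s ?W"
  proof (rule inj_onI)
    fix x y assume xy: "x \<in> ?W" "y \<in> ?W" "s x = s y"
    have "((\<lambda>v. pi_rep c d (\<sigma> v) - v) has_derivative (\<lambda>u. 0)) (at v within ?W)" if "v \<in> ?W" for v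
    proof -
      have "(pi_rep c d has_derivative dcoord c d \<pi> (s v)) (at (\<sigma> v))"
        using has_derivative_pi_rep[OF c(1) d(1) sx(1,2)[OF that]] sx(3)[OF that] by simp
      from has_derivative_diff[OF has_derivative_compose[OF d\<sigma>[OF that] this] has_derivative_ident]
      have "((\<lambda>v. pi_rep c d (\<sigma> v) - v) has_derivative (\<lambda>u. 0)) (at v)"
        using dpi_clift[OF c(1) d(1) sx(1,2)[OF that]] by (simp add: s_def)
      then show ?thesis by (rule has_derivative_at_withinI)
    qed
    then have "\<exists>k. \<forall>v\<in>?W. pi_rep c d (\<sigma> v) - v = k"
      by (rule has_derivative_zero_constant[OF convex_ball])
    then have "pi_rep c d (\<sigma> x) - x = pi_rep c d (\<sigma> y) - y"
      using xy(1,2) by auto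
    moreover have "\<sigma> x = \<sigma> y"
      using sx(3)[OF xy(1)] sx(3)[OF xy(2)] xy(3) by simp
    ultimately show "x = y" by simp
  qed
  have smooth: "smooth_map_on ?E B ?W s"
    unfolding smooth_map_on_def
  proof (intro conjI ballI)
    have "continuous_on (snd c ` fst c) (chart_inv c)"
      using chart_B[OF c(1)] by (simp add: is_chart_def homeomorphism_def)
    moreover have "\<sigma> ` ?W \<subseteq> snd c ` fst c"
      using \<sigma>_dom by (auto simp: chart_dom_def)
    ultimately have "continuous_on (\<sigma> ` ?W) (chart_inv c)"
      by (rule continuous_on_subset)
    then show cont: "continuous_on ?W s"
      unfolding s_def by (intro continuous_on_compose smooth_on_continuous_on[OF \<sigma>])
    fix e' f assume e': "e' \<in> ?E" and f: "f \<in> B"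
    have "open (fst f)" using chart_B[OF f] by (simp add: is_chart_def)
    then have op: "open (?W \<inter> s -` fst f)"
      by (intro continuous_open_preimage cont) auto
    have "smooth_on (?W \<inter> s -` fst f) (\<lambda>x. (snd f \<circ> chart_inv c) (\<sigma> x))"
    proof (rule smooth_on_compose[OF _ smooth_on_subset[OF \<sigma>] _ op])
      show "smooth_on (snd c ` (fst c \<inter> fst f)) (snd f \<circ> chart_inv c)"
        using atlas_B c(1) f by (simp add: smooth_atlas_def)
      show "\<sigma> ` (?W \<inter> s -` fst f) \<subseteq> snd c ` (fst c \<inter> fst f)"
      proof (rule image_subsetI)
        fix x assume "x \<in> ?W \<inter> s -` fst f"
        then show "\<sigma> x \<in> snd c ` (fst c \<inter> fst f)"
          using sx[of x] by (intro image_eqI[of _ _ "s x"]) auto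
      qed
      show "open (snd c ` (fst c \<inter> fst f))"
        using open_chart_image[OF chart_B[OF c(1)] \<open>open (fst f)\<close>] .
    qed auto
    moreover have "e' = ?e" using e' by (simp add: euclidean_atlas_def)
    ultimately show "smooth_on (snd e' ` (?W \<inter> fst e' \<inter> s -` fst f)) (snd f \<circ> s \<circ> chart_inv e')"
      by (simp add: euclidean_chart s_def comp_def)
  qed
  have ds: "differential ?E B s x u = lift (s x) (dcoord d (cA (\<pi> (s x))) id (\<pi> (s x)) u)" if x: "x \<in> ?W" for x u
  proof -
    have "dcoord ?e (cB (s x)) (id \<circ> s) x u = dcoord c (cB (s x)) id (s x) (dcoord ?e c s x u)"
      using x c(1) e cB sx
      by (intro dcoord_chain[OF smooth_atlas_euclidean atlas_B smooth open_ball _ smooth_map_on_id[OF atlas_B]]) auto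
    moreover have "dcoord ?e c s x = clift c d (s x)"
    proof -
      have "((snd c \<circ> s) has_derivative ?M (\<sigma> x)) (at x)"
        by (rule has_derivative_transform_within_open[OF d\<sigma>[OF x] open_ball x]) (simp add: sx)
      then show ?thesis
        by (simp add: dcoord_def euclidean_chart comp_def fderiv_eqI s_def)
    qed
    ultimately show ?thesis
      using x c(1) cB sx
      by (simp add: differential_eq euclidean_chart clift_def dcoord_id_inverse[OF atlas_B])
  qed
  have "integral_manifold B hor ?W s"
    unfolding integral_manifold_def
  proof (intro conjI ballI open_ball inj smooth)
    fix x assume x: "x \<in> ?W"
    let ?t = "dcoord d (cA (\<pi> (s x))) id (\<pi> (s x))" and ?t' = "dcoord (cA (\<pi> (s x))) d id (\<pi> (s x))"
    have t: "?t' (?t u) = u" "?t (?t' u) = u" for u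
      using sx(2)[OF x] cA d(1) by (auto intro: dcoord_id_inverse[OF atlas_A])
    show "inj (differential ?E B s x)"
      unfolding ds[OF x, abs_def] by (rule injI) (metis lift(2) t(1))
    have "range ?t = UNIV" using t(2) by (metis surjI)
    then show "range (differential ?E B s x) = hor (s x)"
      unfolding ds[OF x, abs_def] range_lift[symmetric] by (metis image_image)
  qed
  moreover have "q \<in> s ` ?W"
    using r chart_inv_left[OF chart_B[OF c(1)] c(2)] \<sigma>0 by (intro image_eqI[of _ _ 0]) (auto simp: s_def)
  ultimately show "\<exists>(W :: 'm set) s. integral_manifold B hor W s \<and> q \<in> s ` W"
    by blast
qed

end

section \<open>Canonical coordinates and the Poisson bracket\<close>

text \<open>\<open>Blinfun\<close> is meaningful only on bounded linear maps; over points of the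
  chart \<open>c\<close> the coordinate change is linear, and there the abstraction can be
  undone.\<close>

lemma cotangent_of_coord_apply:
  assumes A: "smooth_atlas A" and c: "c \<in> A" "x \<in> snd c ` fst c"
  shows "fst (cotangent_of_coord A c (x, \<xi>)) = chart_inv c x"
    "blinfun_apply (snd (cotangent_of_coord A c (x, \<xi>))) v =
      \<xi> \<bullet> dcoord (chart_at A (chart_inv c x)) c id (chart_inv c x) v"
proof -
  let ?p = "chart_inv c x"
  have "linear (dcoord (chart_at A ?p) c id ?p)"
    using A c(1) chart_at[OF A] chart_inv_in[OF smooth_atlas_chart[OF A c(1)] c(2)]
    by (intro linear_dcoord_id) auto
  then have "bounded_linear (\<lambda>v. \<xi> \<bullet> dcoord (chart_at A ?p) c id ?p v)"
    by (intro bounded_linear_intros) (simp add: linear_conv_bounded_linear)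
  then show "blinfun_apply (snd (cotangent_of_coord A c (x, \<xi>))) v =
      \<xi> \<bullet> dcoord (chart_at A ?p) c id ?p v"
    by (simp add: cotangent_of_coord_def tangent_coord_eq bounded_linear_Blinfun_apply)
qed (simp add: cotangent_of_coord_def)

lemma cotangent_coord_of_coord:
  assumes A: "smooth_atlas A" and c: "c \<in> A" "x \<in> snd c ` fst c"
  shows "cotangent_coord A c (cotangent_of_coord A c (x, \<xi>)) = (x, \<xi>)"
proof -
  let ?p = "chart_inv c x"
  note ic = smooth_atlas_chart[OF A c(1)]
  have "dcoord (chart_at A ?p) c id ?p (dcoord c (chart_at A ?p) id ?p b) = b" for b
    using A c(1) chart_at[OF A] chart_inv_in[OF ic c(2)] by (intro dcoord_id_inverse) auto
  then have "cotangent_coord A c (cotangent_of_coord A c (x, \<xi>)) =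
      (snd c ?p, \<Sum>b\<in>Basis. (\<xi> \<bullet> b) *\<^sub>R b)"
    using cotangent_of_coord_apply[OF A c, of \<xi>]
    by (simp add: cotangent_coord_def split_beta tangent_of_coord_eq)
  then show ?thesis
    by (simp add: euclidean_representation chart_inv_right[OF ic c(2)])
qed

lemma cotangent_of_coord_coord:
  assumes A: "smooth_atlas A" and c: "c \<in> A" "fst z \<in> fst c"
  shows "cotangent_of_coord A c (cotangent_coord A c z) = z"
proof -
  obtain p \<alpha> where z: "z = (p, \<alpha>)" by (cases z)
  note ic = smooth_atlas_chart[OF A c(1)]
  have p: "p \<in> fst c" "snd c p \<in> snd c ` fst c" "chart_inv c (snd c p) = p"
    using c(2) chart_inv_left[OF ic] by (auto simp: z)
  define \<xi> where "\<xi> = (\<Sum>b\<in>Basis. blinfun_apply \<alpha> (dcoord c (chart_at A p) id p b) *\<^sub>R b)"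
  have coord: "cotangent_coord A c z = (snd c p, \<xi>)"
    by (simp add: cotangent_coord_def z \<xi>_def tangent_of_coord_eq)
  have "blinfun_apply (snd (cotangent_of_coord A c (snd c p, \<xi>))) v = \<alpha> v" for v
  proof -
    let ?w = "dcoord (chart_at A p) c id p v"
    have "linear (blinfun_apply \<alpha> \<circ> dcoord c (chart_at A p) id p)"
      using c(1) p chart_at[OF A]
      by (intro linear_compose linear_dcoord_id[OF A] bounded_linear.linear[OF blinfun.bounded_linear_right]) auto
    then have "blinfun_apply \<alpha> (dcoord c (chart_at A p) id p ?w) =
        (\<Sum>b\<in>Basis. (?w \<bullet> b) *\<^sub>R blinfun_apply \<alpha> (dcoord c (chart_at A p) id p b))"
      unfolding comp_def by (rule linear_basis_expansion)
    moreover have "(\<Sum>b\<in>Basis. (?w \<bullet> b) *\<^sub>R blinfun_apply \<alpha> (dcoord c (chart_at A p) id p b)) = \<xi> \<bullet> ?w"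
      by (simp add: \<xi>_def inner_sum_left inner_commute[of ?w] mult.commute)
    moreover have "dcoord c (chart_at A p) id p ?w = v"
      using c(1) p chart_at[OF A] by (intro dcoord_id_inverse[OF A]) auto
    ultimately show ?thesis
      using cotangent_of_coord_apply(2)[OF A c(1) p(2)] p(3) by simp
  qed
  then show ?thesis
    unfolding coord using cotangent_of_coord_apply(1)[OF A c(1) p(2)] p(3)
    by (simp add: z prod_eq_iff blinfun_eqI)
qed

lemma smooth_on_cotangent_differentiable:
  assumes A: "smooth_atlas A" and c: "c \<in> A" and f: "smooth_on_cotangent A f"
    and x: "fst z \<in> snd c ` fst c"
  shows "((f \<circ> cotangent_of_coord A c) has_derivative fderiv (f \<circ> cotangent_of_coord A c) z) (at z)"
  using f c x by (intro smooth_on_has_fderiv[where S = "snd c ` fst c \<times> UNIV"])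
    (auto simp: smooth_on_cotangent_def mem_Times_iff)

text \<open>Pulling back along \<open>(v, \<eta>) \<mapsto> (P v, L\<^sup>T \<eta> + (K v)\<^sup>T \<xi>)\<close> with \<open>P \<circ> L = id\<close> changes the canonical
  bivector exactly by the antisymmetric part of \<open>K\<close> on the range of \<open>L\<close>.\<close>

lemma bracket_pullback:
  fixes D1 D2 :: "'m::euclidean_space \<times> 'm \<Rightarrow> real" and P :: "'n::euclidean_space \<Rightarrow> 'm"
    and L :: "'m \<Rightarrow> 'n" and K :: "'n \<Rightarrow> 'm \<Rightarrow> 'n" and \<xi> :: 'n
  assumes D: "linear D1" "linear D2" and P: "linear P" and L: "linear L" and PL: "\<And>u. P (L u) = u"
    and K: "\<And>v. linear (K v)" "\<And>a. linear (\<lambda>v. K v a)"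
  defines "E \<equiv> \<lambda>v \<eta>. (P v, \<Sum>a\<in>Basis. (\<eta> \<bullet> L a + \<xi> \<bullet> K v a) *\<^sub>R a)"
  defines "r \<equiv> \<lambda>D :: 'm \<times> 'm \<Rightarrow> real. \<Sum>a\<in>Basis. D (0, a) *\<^sub>R a"
  shows "(\<Sum>b\<in>Basis. D1 (E b 0) * D2 (E 0 b) - D1 (E 0 b) * D2 (E b 0)) =
    (\<Sum>a\<in>Basis. D1 (a, 0) * D2 (0, a) - D1 (0, a) * D2 (a, 0)) +
    \<xi> \<bullet> (K (L (r D2)) (r D1) - K (L (r D1)) (r D2))"
proof -
  \<comment> \<open>A linear form on base times fibre is its base part plus the pairing with its
    fibre gradient \<open>r D\<close>.\<close>
  have split: "D (u, \<eta>) = D (u, 0) + r D \<bullet> \<eta>" if "linear D" for D :: "'m \<times> 'm \<Rightarrow> real" and u \<eta>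
  proof -
    have "D (u, \<eta>) = D (u, 0) + D (0, \<eta>)"
      using linear_add[OF that, of "(u, 0)" "(0, \<eta>)"] by simp
    moreover have "linear (\<lambda>\<eta>. D (0, \<eta>))"
      by (rule linearI) (use linear_add[OF that, of "(0, _)" "(0, _)"] linear_cmul[OF that, of _ "(0, _)"] in auto)
    then have "D (0, \<eta>) = (\<Sum>a\<in>Basis. (\<eta> \<bullet> a) *\<^sub>R D (0, a))"
      by (rule linear_basis_expansion)
    ultimately show ?thesis
      by (simp add: r_def inner_sum_left inner_commute[of \<eta>] mult.commute)
  qed
  have sumT: "s \<bullet> (\<Sum>a\<in>Basis. (\<eta> \<bullet> T a) *\<^sub>R a) = \<eta> \<bullet> T s" if "linear T" for T :: "'m \<Rightarrow> 'n" and s \<eta>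
  proof -
    have "T s = (\<Sum>a\<in>Basis. (s \<bullet> a) *\<^sub>R T a)"
      by (rule linear_basis_expansion[OF that])
    then show ?thesis by (simp add: inner_sum_right mult.commute)
  qed
  have E: "D (E b 0) = D (P b, 0) + \<xi> \<bullet> K b (r D)" "D (E 0 b) = b \<bullet> L (r D)" if "linear D" for D b
  proof -
    show "D (E b 0) = D (P b, 0) + \<xi> \<bullet> K b (r D)"
      unfolding E_def by (subst split[OF that]) (simp add: sumT[OF K(1)])
    have "K 0 a = 0" for a using linear_0[OF K(2)] .
    then show "D (E 0 b) = b \<bullet> L (r D)"
      unfolding E_def by (subst split[OF that])
        (simp add: sumT[OF L] linear_0[OF P] linear_0[OF that, unfolded zero_prod_def])
  qed
  have expand: "(\<Sum>b\<in>Basis. F b * (b \<bullet> w)) = F w" if "linear F" for F :: "'a::euclidean_space \<Rightarrow> real" and w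
    using linear_basis_expansion[OF that, of w] by (simp add: inner_commute mult.commute)
  have lin1: "linear (\<lambda>u. D (u, 0))" if "linear D" for D :: "'m \<times> 'm \<Rightarrow> real"
    by (rule linearI) (use linear_add[OF that, of "(_, 0)" "(_, 0)"] linear_cmul[OF that, of _ "(_, 0)"] in auto)
  \<comment> \<open>The factor \<open>D' (E 0 b) = b \<bullet> L (r D')\<close> turns the sum over
    the basis into evaluation of the other factor at the single vector \<open>L (r D')\<close>,
    where \<open>PL\<close> removes \<open>P\<close>. This produces the canonical term on the
    smaller space plus the term with \<open>K\<close>.\<close>
  have lhs: "(\<Sum>b\<in>Basis. D (E b 0) * D' (E 0 b)) = D (r D', 0) + \<xi> \<bullet> K (L (r D')) (r D)"
    if "linear D" "linear D'" for D D' :: "'m \<times> 'm \<Rightarrow> real"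
  proof -
    have "linear (\<lambda>b. D (P b, 0) + \<xi> \<bullet> K b (r D))"
      using linear_compose[OF P lin1[OF that(1)]]
        linear_compose[OF K(2) bounded_linear.linear[OF bounded_linear_inner_right[of \<xi>]], of "r D"]
      by (intro linear_compose_add) (auto simp: comp_def)
    from expand[OF this, of "L (r D')"] show ?thesis
      by (simp add: E that PL)
  qed
  have rhs: "(\<Sum>a\<in>Basis. D (a, 0) * D' (0, a)) = D (r D', 0)" if "linear D" "linear D'" for D D' :: "'m \<times> 'm \<Rightarrow> real"
  proof -
    have "D' (0, a) = a \<bullet> r D'" for a
      by (subst split[OF that(2)]) (simp add: linear_0[OF that(2), unfolded zero_prod_def] inner_commute)
    then show ?thesis using expand[OF lin1[OF that(1)]] by simp
  qed
  show ?thesis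
    unfolding sum_subtractf
    using lhs[OF D] lhs[OF D(2,1)] rhs[OF D] rhs[OF D(2,1)]
    by (simp add: mult.commute inner_diff_right)
qed

section \<open>The pushforward in canonical coordinates and its bracket defect\<close>

context submersion
begin

definition \<phi> :: "'q \<times> ('n \<Rightarrow>\<^sub>L real) \<Rightarrow> 'p \<times> ('m \<Rightarrow>\<^sub>L real)" where
  "\<phi> = cotangent_pushforward B h A g \<pi>"

text \<open>Needed to give \<open>inv (flat h)\<close> its meaning. Surjectivity is invertibility of
  the Gram matrix in the preferred chart, where the change of coordinates is the identity.\<close>

lemma bij_flat: "bij (flat h)"
proof (rule bijI)
  show "inj (flat h)"
  proof (rule injI)
    fix x y assume xy: "flat h x = flat h y"
    obtain q v w where [simp]: "x = (q, v)" "y = (q, w)" and hvw: "h q v = h q w"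
      using xy by (cases x; cases y) (auto simp: flat_def)
    have "h q (v - w) (v - w) = 0"
      using hvw by (simp add: blinfun.diff_left blinfun.diff_right)
    then have "v - w = 0" using h_pos[of "v - w" q] by fastforce
    then show "x = y" by simp
  qed
  show "surj (flat h)"
  proof (rule surjI)
    fix z :: "'q \<times> ('n \<Rightarrow>\<^sub>L real)"
    define q \<alpha> where "q = fst z" and "\<alpha> = snd z"
    define w where "w = (\<Sum>b\<in>Basis. \<alpha> b *\<^sub>R b)"
    let ?v = "inv (gram (cB q) q) w"
    have "h q ?v u = \<alpha> u" for u
    proof -
      have "h q ?v u = gram (cB q) q ?v \<bullet> u"
        using gram_inner[OF cB] dcoord_id[OF atlas_B cB] by metis
      also have "\<dots> = w \<bullet> u"
        using bij_gram[OF cB] by (simp add: bij_is_surj surj_f_inv_f)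
      also have "\<dots> = \<alpha> (\<Sum>b\<in>Basis. (u \<bullet> b) *\<^sub>R b)"
        by (simp add: w_def inner_sum_left blinfun.sum_right blinfun.scaleR_right inner_commute[of u] mult.commute)
      also have "\<dots> = \<alpha> u"
        by (simp only: euclidean_representation)
      finally show ?thesis .
    qed
    then have "h q ?v = \<alpha>" by (rule blinfun_eqI)
    then show "flat h (q, inv (gram (cB (fst z)) (fst z)) (\<Sum>b\<in>Basis. snd z b *\<^sub>R b)) = z"
      by (simp add: flat_def q_def \<alpha>_def w_def)
  qed
qed

text \<open>Writing the covector as h(v, -), \<open>h_lift\<close> turns g(d\<pi> v, u) back into
  h(v, lift u), so neither metric remains visible in the formula.\<close>

lemma phi_apply: "fst (\<phi> z) = \<pi> (fst z)" "blinfun_apply (snd (\<phi> z)) u = snd z (lift (fst z) u)"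
proof -
  obtain q v where v: "inv (flat h) z = (q, v)" by (cases "inv (flat h) z")
  have "flat h (q, v) = z"
    using bij_flat v by (metis bij_inv_eq_iff)
  then have z: "z = (q, h q v)" by (simp add: flat_def)
  have "\<phi> z = flat g (tangent_map B A \<pi> (q, v))"
    by (simp add: \<phi>_def cotangent_pushforward_def v)
  then have "\<phi> z = (\<pi> q, g (\<pi> q) (d\<pi> q v))"
    by (simp add: tangent_map_def flat_def)
  then show "fst (\<phi> z) = \<pi> (fst z)" "blinfun_apply (snd (\<phi> z)) u = snd z (lift (fst z) u)"
    by (simp_all add: z h_lift)
qed

definition phi_rep :: "('q, 'n) chart \<Rightarrow> ('p, 'm) chart \<Rightarrow> 'n \<times> 'n \<Rightarrow> 'm \<times> 'm" where
  "phi_rep c d z = (pi_rep c d (fst z), \<Sum>a\<in>Basis. (snd z \<bullet> clift c d (chart_inv c (fst z)) a) *\<^sub>R a)"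

lemma phi_coord:
  assumes c: "c \<in> B" and d: "d \<in> A" and x: "fst z \<in> chart_dom c d"
  shows "\<phi> (cotangent_of_coord B c z) = cotangent_of_coord A d (phi_rep c d z)"
proof -
  obtain x \<xi> where z: "z = (x, \<xi>)" by (cases z)
  let ?q = "chart_inv c x"
  have xd: "x \<in> chart_dom c d" using x z by simp
  note q = dom_point[OF c xd]
  have xc: "x \<in> snd c ` fst c" using xd by (auto simp: chart_dom_def)
  note P = pi_rep_point[OF c d xd]
  let ?\<eta> = "\<Sum>a\<in>Basis. (\<xi> \<bullet> clift c d ?q a) *\<^sub>R a"
  note B = cotangent_of_coord_apply[OF atlas_B c xc, of \<xi>]
  note A = cotangent_of_coord_apply[OF atlas_A d P(1), of ?\<eta>]
  have "blinfun_apply (snd (\<phi> (cotangent_of_coord B c (x, \<xi>)))) u =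
      blinfun_apply (snd (cotangent_of_coord A d (pi_rep c d x, ?\<eta>))) u" for u
  proof -
    let ?w = "dcoord (cA (\<pi> ?q)) d id (\<pi> ?q) u"
    have "clift c d ?q ?w = (\<Sum>a\<in>Basis. (?w \<bullet> a) *\<^sub>R clift c d ?q a)"
      by (rule linear_basis_expansion[OF linear_clift[OF c d q(1,2)]])
    then have "?\<eta> \<bullet> ?w = \<xi> \<bullet> clift c d ?q ?w"
      by (simp add: inner_sum_left inner_sum_right inner_commute[of ?w] mult.commute)
    also have "\<dots> = \<xi> \<bullet> dcoord (cB ?q) c id ?q (lift ?q u)"
      using d q cA by (simp add: clift_def dcoord_id_inverse[OF atlas_A])
    finally show ?thesis
      by (simp add: phi_apply A B P(2))
  qed
  then show ?thesis
    using A(1) B(1) P(2) by (simp add: z phi_rep_def prod_eq_iff phi_apply blinfun_eqI)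
qed

lemma has_derivative_phi_rep:
  assumes c: "c \<in> B" "q \<in> fst c" and d: "d \<in> A" "\<pi> q \<in> fst d"
  shows "(phi_rep c d has_derivative (\<lambda>(v, \<eta>). (dcoord c d \<pi> q v,
      \<Sum>a\<in>Basis. (\<eta> \<bullet> clift c d q a + \<xi> \<bullet> fderiv (\<lambda>x. clift c d (chart_inv c x) a) (snd c q) v) *\<^sub>R a)))
    (at (snd c q, \<xi>))"
proof -
  let ?z = "(snd c q, \<xi>)"
  have f: "(fst has_derivative fst) (at ?z)" and s: "(snd has_derivative snd) (at ?z)"
    by (auto intro: bounded_linear_imp_has_derivative bounded_linear_fst bounded_linear_snd)
  have 1: "((\<lambda>z. pi_rep c d (fst z)) has_derivative (\<lambda>u. dcoord c d \<pi> q (fst u))) (at ?z)"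
    using has_derivative_compose[OF f, of "pi_rep c d"] has_derivative_pi_rep[OF c(1) d(1) c(2) d(2)] by simp
  have "((\<lambda>z. clift c d (chart_inv c (fst z)) a) has_derivative
      (\<lambda>u. fderiv (\<lambda>x. clift c d (chart_inv c x) a) (snd c q) (fst u))) (at ?z)" for a
    using has_derivative_compose[OF f, of "\<lambda>x. clift c d (chart_inv c x) a"]
      smooth_on_has_fderiv[OF smooth_clift[OF c(1) d(1)] in_dom[OF c(2) d(2)]] by simp
  from has_derivative_inner[OF s this]
  have 2: "((\<lambda>z. snd z \<bullet> clift c d (chart_inv c (fst z)) a) has_derivative
      (\<lambda>u. snd u \<bullet> clift c d q a + \<xi> \<bullet> fderiv (\<lambda>x. clift c d (chart_inv c x) a) (snd c q) (fst u))) (at ?z)" for a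
    by (simp add: chart_inv_left[OF chart_B[OF c(1)] c(2)] add.commute)
  have "(phi_rep c d has_derivative (\<lambda>u. (dcoord c d \<pi> q (fst u), \<Sum>a\<in>Basis. (snd u \<bullet> clift c d q a +
      \<xi> \<bullet> fderiv (\<lambda>x. clift c d (chart_inv c x) a) (snd c q) (fst u)) *\<^sub>R a))) (at ?z)"
    unfolding phi_rep_def
    by (intro has_derivative_Pair has_derivative_sum has_derivative_scaleR_left 1 2)
  then show ?thesis by (simp add: case_prod_unfold)
qed

text \<open>This is the vector \<open>r D\<close> of \<open>bracket_pullback\<close>: the defect of
  the bracket depends on a test function only through its derivatives along the fibre.\<close>

definition fibre_grad :: "('p \<times> ('m \<Rightarrow>\<^sub>L real) \<Rightarrow> real) \<Rightarrow> ('p, 'm) chart \<Rightarrow> 'm \<times> 'm \<Rightarrow> 'm" where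
  "fibre_grad f d z = (\<Sum>a\<in>Basis. fderiv (f \<circ> cotangent_of_coord A d) z (0, a) *\<^sub>R a)"

text \<open>\<open>c\<close> and \<open>d\<close> are the very charts in which the brackets at
  \<open>z\<close> and at \<open>\<phi> z\<close> are defined. In them \<phi> is
  \<open>phi_rep c d\<close>, and its derivative has the form \<open>E\<close> to which
  \<open>bracket_pullback\<close> applies.\<close>

lemma poisson_bracket_phi:
  fixes z :: "'q \<times> ('n \<Rightarrow>\<^sub>L real)"
  assumes f: "smooth_on_cotangent A f1" "smooth_on_cotangent A f2"
  defines "c \<equiv> cB (fst z)" and "d \<equiv> cA (\<pi> (fst z))"
  defines "K \<equiv> \<lambda>v a. fderiv (\<lambda>x. clift c d (chart_inv c x) a) (snd c (fst z)) v"
  defines "r \<equiv> \<lambda>f. fibre_grad f d (phi_rep c d (cotangent_coord B c z))"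
  shows "poisson_bracket B (f1 \<circ> \<phi>) (f2 \<circ> \<phi>) z = poisson_bracket A f1 f2 (\<phi> z) +
    snd (cotangent_coord B c z) \<bullet>
      (K (clift c d (fst z) (r f2)) (r f1) - K (clift c d (fst z) (r f1)) (r f2))"
proof -
  let ?q = "fst z"
  have c: "c \<in> B" "?q \<in> fst c" and d: "d \<in> A" "\<pi> ?q \<in> fst d"
    using cA cB by (auto simp: c_def d_def)
  define \<xi> where "\<xi> = snd (cotangent_coord B c z)"
  have zc: "cotangent_coord B c z = (snd c ?q, \<xi>)"
    by (simp add: \<xi>_def cotangent_coord_def split_beta)
  let ?x = "(snd c ?q, \<xi>)" and ?y = "phi_rep c d (snd c ?q, \<xi>)"
  have dom: "snd c ?q \<in> chart_dom c d" by (rule in_dom[OF c(2) d(2)])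
  have y: "fst ?y \<in> snd d ` fst d"
    using pi_rep_point(1)[OF c(1) d(1) dom] by (simp add: phi_rep_def)
  have "cotangent_of_coord B c ?x = z"
    using cotangent_of_coord_coord[OF atlas_B c] zc by simp
  then have phi_z: "\<phi> z = cotangent_of_coord A d ?y"
    using phi_coord[OF c(1) d(1), of ?x] dom by simp
  have zd: "cotangent_coord A d (\<phi> z) = ?y"
    unfolding phi_z using cotangent_coord_of_coord[OF atlas_A d(1), of "fst ?y" "snd ?y"] y by simp
  define E where "E v \<eta> = (dcoord c d \<pi> ?q v, \<Sum>a\<in>Basis. (\<eta> \<bullet> clift c d ?q a + \<xi> \<bullet> K v a) *\<^sub>R a)" for v \<eta>
  have deriv: "fderiv (f \<circ> \<phi> \<circ> cotangent_of_coord B c) ?x (v, \<eta>) =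
      fderiv (f \<circ> cotangent_of_coord A d) ?y (E v \<eta>)" if "smooth_on_cotangent A f" for f v \<eta>
  proof -
    have "((\<lambda>w. (f \<circ> cotangent_of_coord A d) (phi_rep c d w)) has_derivative
        (\<lambda>u. fderiv (f \<circ> cotangent_of_coord A d) ?y (case u of (v, \<eta>) \<Rightarrow> E v \<eta>))) (at ?x)"
      unfolding E_def K_def
      by (rule has_derivative_compose[OF has_derivative_phi_rep[OF c d]
            smooth_on_cotangent_differentiable[OF atlas_A d(1) that y]])
    then have "((f \<circ> \<phi> \<circ> cotangent_of_coord B c) has_derivative
        (\<lambda>u. fderiv (f \<circ> cotangent_of_coord A d) ?y (case u of (v, \<eta>) \<Rightarrow> E v \<eta>))) (at ?x)"
    proof (rule has_derivative_transform_within_open)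
      show "open (chart_dom c d \<times> UNIV)" by (intro open_Times open_dom c d open_UNIV)
      show "?x \<in> chart_dom c d \<times> UNIV" using dom by simp
      show "(f \<circ> cotangent_of_coord A d) (phi_rep c d w) = (f \<circ> \<phi> \<circ> cotangent_of_coord B c) w"
        if "w \<in> chart_dom c d \<times> UNIV" for w
        using that phi_coord[OF c(1) d(1), of w] by (auto simp: mem_Times_iff)
    qed
    then show ?thesis by (simp add: fderiv_eqI)
  qed
  let ?D = "\<lambda>f. fderiv (f \<circ> cotangent_of_coord A d) ?y"
  have linD: "linear (?D f)" if "smooth_on_cotangent A f" for f
    by (rule has_derivative_linear[OF smooth_on_cotangent_differentiable[OF atlas_A d(1) that y]])
  have chart_phi: "cA (fst (\<phi> z)) = d" by (simp add: phi_apply d_def)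
  have "poisson_bracket B (f1 \<circ> \<phi>) (f2 \<circ> \<phi>) z =
      (\<Sum>b\<in>Basis. ?D f1 (E b 0) * ?D f2 (E 0 b) - ?D f1 (E 0 b) * ?D f2 (E b 0))"
    by (simp add: poisson_bracket_def Let_def c_def[symmetric] zc deriv[OF f(1)] deriv[OF f(2)])
  also have "\<dots> = (\<Sum>a\<in>Basis. ?D f1 (a, 0) * ?D f2 (0, a) - ?D f1 (0, a) * ?D f2 (a, 0)) +
      \<xi> \<bullet> (K (clift c d ?q (r f2)) (r f1) - K (clift c d ?q (r f1)) (r f2))"
    unfolding E_def r_def fibre_grad_def zc
  proof (rule bracket_pullback)
    show "linear (K v)" for v
      unfolding K_def
      using linear_clift_dom[OF c(1) d(1)]
      by (intro fderiv_family_linear[OF open_dom[OF c(1) d(1)] dom]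
          smooth_on_differentiable[OF smooth_clift[OF c(1) d(1)] dom]) auto
    show "linear (\<lambda>v. K v a)" for a
      unfolding K_def by (rule smooth_on_linear_fderiv[OF smooth_clift[OF c(1) d(1)] dom])
  qed (rule linD[OF f(1)] linD[OF f(2)] linear_dpi_chart[OF c(1) d(1) c(2) d(2)]
      linear_clift[OF c(1) d(1) c(2) d(2)] dpi_clift[OF c(1) d(1) c(2) d(2)])+
  also have "(\<Sum>a\<in>Basis. ?D f1 (a, 0) * ?D f2 (0, a) - ?D f1 (0, a) * ?D f2 (a, 0)) =
      poisson_bracket A f1 f2 (\<phi> z)"
    by (simp add: poisson_bracket_def Let_def chart_phi zd)
  finally show ?thesis unfolding \<xi>_def .
qed

end

section \<open>Test functions\<close>

text \<open>Test functions must be smooth on the whole cotangent bundle. The fibre-linear function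
  with gradient \<open>a\<close> exists only over the chart \<open>d\<close>, so it is multiplied by
  a bump in the base and extended by zero.\<close>

lemma linear_test_function:
  fixes A :: "('p::{t2_space, second_countable_topology}, 'm::euclidean_space) chart set"
  assumes A: "smooth_atlas A" and d: "d \<in> A" "p \<in> fst d"
  obtains \<beta> :: "'m \<Rightarrow> real" and f where "\<beta> (snd d p) \<noteq> 0" "\<And>a. smooth_on_cotangent A (f a)"
    "\<And>a u \<eta>. u \<in> snd d ` fst d \<Longrightarrow> f a (cotangent_of_coord A d (u, \<eta>)) = \<beta> u * (\<eta> \<bullet> a)"
proof -
  note id = smooth_atlas_chart[OF A d(1)]
  have V: "open (snd d ` fst d)" using id by (simp add: is_chart_def)
  obtain \<beta> :: "'m \<Rightarrow> real" and r where \<beta>: "smooth_on UNIV \<beta>" "\<beta> (snd d p) \<noteq> 0"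
    and r: "r > 0" "cball (snd d p) r \<subseteq> snd d ` fst d" "\<And>y. y \<notin> cball (snd d p) r \<Longrightarrow> \<beta> y = 0"
    using smooth_bump[OF V, of "snd d p"] d(2) by blast
  define f where "f a z = (if fst z \<in> fst d
      then \<beta> (snd d (fst z)) * blinfun_apply (snd z) (dcoord d (chart_at A (fst z)) id (fst z) a) else 0)"
    for a and z :: "'p \<times> ('m \<Rightarrow>\<^sub>L real)"
  \<comment> \<open>\<open>k\<close> contains the support of the bump on the manifold. Being compact
    in a Hausdorff space it is closed, so \<open>fst d\<close> and \<open>- k\<close> are open sets
    that cover the manifold: on the first the coordinate formula is smooth, on the second the
    function is 0.\<close>
  define k where "k = chart_inv d ` cball (snd d p) r"
  have "continuous_on (cball (snd d p) r) (chart_inv d)"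
    using id r(2) by (auto simp: is_chart_def homeomorphism_def intro: continuous_on_subset)
  then have "compact k"
    unfolding k_def by (intro compact_continuous_image compact_cball)
  then have "open (- k)"
    using compact_imp_closed by blast
  have f_rep: "f a (cotangent_of_coord A c (x, \<xi>)) = \<beta> (snd d (chart_inv c x)) * (\<xi> \<bullet> dcoord d c id (chart_inv c x) a)"
    if c: "c \<in> A" and x: "x \<in> snd c ` fst c" and xd: "chart_inv c x \<in> fst d" for a c x \<xi>
  proof -
    let ?q = "chart_inv c x"
    have "dcoord (chart_at A ?q) c id ?q (dcoord d (chart_at A ?q) id ?q a) = dcoord d c id ?q a"
      using chart_at[OF A] c xd d chart_inv_in[OF smooth_atlas_chart[OF A c] x]
      by (intro dcoord_id_trans[OF A]) auto
    then show ?thesis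
      using xd cotangent_of_coord_apply[OF A c x, of \<xi>] by (simp add: f_def)
  qed
  have f_zero: "f a (cotangent_of_coord A c (x, \<xi>)) = 0"
    if c: "c \<in> A" and x: "x \<in> snd c ` fst c" and xk: "chart_inv c x \<notin> k" for a c x \<xi>
  proof (cases "chart_inv c x \<in> fst d")
    case True
    have "snd d (chart_inv c x) \<notin> cball (snd d p) r"
      using xk chart_inv_left[OF id True] unfolding k_def by (metis image_eqI)
    then show ?thesis using f_rep[OF c x True] r(3) by simp
  next
    case False
    then show ?thesis
      using cotangent_of_coord_apply(1)[OF A c x] by (simp add: f_def)
  qed
  have "smooth_on_cotangent A (f a)" for a
    unfolding smooth_on_cotangent_def
  proof (intro ballI smooth_on_local)
    fix c z assume c: "c \<in> A" and z: "z \<in> snd c ` fst c \<times> (UNIV :: 'm set)"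
    note ic = smooth_atlas_chart[OF A c]
    have zc: "chart_inv c (fst z) \<in> fst c" "snd c (chart_inv c (fst z)) = fst z"
      using z chart_inv_in[OF ic] chart_inv_right[OF ic] by auto
    show "\<exists>T. open T \<and> z \<in> T \<and> smooth_on T (f a \<circ> cotangent_of_coord A c)"
    proof (cases "chart_inv c (fst z) \<in> fst d")
      case True
      let ?S = "snd c ` (fst c \<inter> fst d)" and ?S' = "snd d ` (fst d \<inter> fst c)"
      have "open (fst c)" "open (fst d)" using ic id by (auto simp: is_chart_def)
      then have S: "open ?S" "open ?S'"
        by (simp_all add: open_chart_image[OF ic] open_chart_image[OF id])
      define \<tau> where "\<tau> x = (snd d \<circ> chart_inv c) (fst x)" for x :: "'m \<times> 'm"
      have T: "open (?S \<times> (UNIV :: 'm set))" by (intro open_Times S open_UNIV)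
      have fst: "smooth_on (?S \<times> (UNIV :: 'm set)) fst" and snd: "smooth_on (?S \<times> (UNIV :: 'm set)) snd"
        by (intro smooth_on_linear bounded_linear_fst bounded_linear_snd)+
      have "smooth_on ?S (snd d \<circ> chart_inv c)"
        using A c d(1) by (simp add: smooth_atlas_def)
      then have \<tau>: "smooth_on (?S \<times> UNIV) \<tau>"
        unfolding \<tau>_def by (rule smooth_on_compose[OF _ fst _ T S(1)]) auto
      have \<tau>S: "\<tau> ` (?S \<times> UNIV) \<subseteq> ?S'"
        using chart_inv_left[OF ic] by (auto simp: \<tau>_def)
      have 1: "smooth_on (?S \<times> UNIV) (\<lambda>x. \<beta> (\<tau> x))"
        by (rule smooth_on_compose[OF \<beta>(1) \<tau> _ T open_UNIV]) simp
      have "smooth_on ?S' (\<lambda>w. dcoord d c id (chart_inv d w) a)"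
        using smooth_on_dcoord[OF A A smooth_map_on_id[OF A] open_UNIV d(1) c] by simp
      then have 2: "smooth_on (?S \<times> UNIV) (\<lambda>x. dcoord d c id (chart_inv d (\<tau> x)) a)"
        by (rule smooth_on_compose[OF _ \<tau> \<tau>S T S(2)])
      have "smooth_on (?S \<times> UNIV) (\<lambda>x. \<beta> (\<tau> x) * (snd x \<bullet> dcoord d c id (chart_inv d (\<tau> x)) a))"
        by (rule smooth_on_mult[OF 1 smooth_on_inner[OF snd 2 T] T])
      then have "smooth_on (?S \<times> UNIV) (f a \<circ> cotangent_of_coord A c)"
      proof (rule smooth_on_cong[OF T, rotated])
        fix x :: "'m \<times> 'm" assume "x \<in> ?S \<times> UNIV"
        then have x: "fst x \<in> snd c ` fst c" "chart_inv c (fst x) \<in> fst d"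
          using chart_inv_left[OF ic] by auto
        then show "\<beta> (\<tau> x) * (snd x \<bullet> dcoord d c id (chart_inv d (\<tau> x)) a) = (f a \<circ> cotangent_of_coord A c) x"
          using f_rep[OF c x, of a "snd x"] chart_inv_left[OF id x(2)] by (simp add: \<tau>_def)
      qed
      moreover have "z \<in> ?S \<times> UNIV"
        using zc True by (metis IntI UNIV_I image_eqI mem_Times_iff)
      ultimately show ?thesis using T by blast
    next
      case False
      let ?T = "snd c ` (fst c \<inter> - k) \<times> (UNIV :: 'm set)"
      have T: "open ?T"
        by (intro open_Times open_chart_image[OF ic] \<open>open (- k)\<close> open_UNIV)
      have "smooth_on ?T (f a \<circ> cotangent_of_coord A c)"
      proof (rule smooth_on_cong[OF T _ smooth_on_const])
        fix x :: "'m \<times> 'm" assume "x \<in> ?T"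
        then have "fst x \<in> snd c ` fst c" "chart_inv c (fst x) \<notin> k"
          using chart_inv_left[OF ic] by auto
        from f_zero[OF c this, of a "snd x"] show "0 = (f a \<circ> cotangent_of_coord A c) x"
          by simp
      qed
      moreover have "k \<subseteq> fst d"
        unfolding k_def using r(2) chart_inv_in[OF id] by blast
      then have "z \<in> ?T"
        using zc False by (metis ComplI IntI UNIV_I image_eqI mem_Times_iff subsetD)
      ultimately show ?thesis using T by blast
    qed
  qed
  moreover have "f a (cotangent_of_coord A d (u, \<eta>)) = \<beta> u * (\<eta> \<bullet> a)" if u: "u \<in> snd d ` fst d" for a u \<eta>
    using f_rep[OF d(1) u chart_inv_in[OF id u]] dcoord_id[OF A d(1) chart_inv_in[OF id u]]
      chart_inv_right[OF id u] by simp
  ultimately show ?thesis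
    using that \<beta>(2) by blast
qed

section \<open>Flatness and the Poisson property\<close>

context submersion
begin

lemma flat_poisson:
  assumes "\<And>q. flat_at (cB q) (cA (\<pi> q)) q"
  shows "poisson_map B A \<phi>"
  unfolding poisson_map_def
proof (intro allI impI ext)
  fix f1 f2 z assume f: "smooth_on_cotangent A f1" "smooth_on_cotangent A f2"
  show "poisson_bracket B (f1 \<circ> \<phi>) (f2 \<circ> \<phi>) z = (poisson_bracket A f1 f2 \<circ> \<phi>) z"
    using poisson_bracket_phi[OF f, of z] assms[of "fst z"] by (simp add: flat_at_def)
qed

lemma poisson_flat:
  assumes "poisson_map B A \<phi>"
  shows "flat_at (cB q) (cA (\<pi> q)) q"
  unfolding flat_at_def
proof (intro allI)
  fix a b
  define c d where "c = cB q" and "d = cA (\<pi> q)"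
  have c: "c \<in> B" "q \<in> fst c" and d: "d \<in> A" "\<pi> q \<in> fst d"
    using cA cB by (auto simp: c_def d_def)
  obtain \<beta> :: "'m \<Rightarrow> real" and f where \<beta>: "\<beta> (snd d (\<pi> q)) \<noteq> 0" and f: "\<And>a. smooth_on_cotangent A (f a)"
    "\<And>a u \<eta>. u \<in> snd d ` fst d \<Longrightarrow> f a (cotangent_of_coord A d (u, \<eta>)) = \<beta> u * (\<eta> \<bullet> a)"
    using linear_test_function[OF atlas_A d] by blast
  let ?u = "snd d (\<pi> q)"
  have grad: "fibre_grad (f a) d (?u, \<eta>) = \<beta> ?u *\<^sub>R a" for a \<eta>
  proof -
    have "fderiv (f a \<circ> cotangent_of_coord A d) (?u, \<eta>) (0, e) = \<beta> ?u * (a \<bullet> e)" for e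
    proof -
      have u: "?u \<in> snd d ` fst d" using d by blast
      have "((\<lambda>t. (?u, \<eta> + t *\<^sub>R e)) has_derivative (\<lambda>t. (0, t *\<^sub>R e))) (at (0::real))"
        by (auto intro!: derivative_eq_intros)
      from has_derivative_compose[OF this, of "f a \<circ> cotangent_of_coord A d"]
        smooth_on_cotangent_differentiable[OF atlas_A d(1) f(1), of "(?u, \<eta>)" a] u
      have 1: "((\<lambda>t. (f a \<circ> cotangent_of_coord A d) (?u, \<eta> + t *\<^sub>R e)) has_derivative
          (\<lambda>t. fderiv (f a \<circ> cotangent_of_coord A d) (?u, \<eta>) (0, t *\<^sub>R e))) (at (0::real))"
        by simp
      have 2: "((\<lambda>t. (f a \<circ> cotangent_of_coord A d) (?u, \<eta> + t *\<^sub>R e)) has_derivative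
          (\<lambda>t. t * (\<beta> ?u * (a \<bullet> e)))) (at (0::real))"
        unfolding comp_apply f(2)[OF u]
        by (auto intro!: derivative_eq_intros simp: inner_add_left inner_commute[of a e] algebra_simps)
      show ?thesis
        using fun_cong[OF has_derivative_unique[OF 1 2], of 1] by simp
    qed
    then show ?thesis
      unfolding fibre_grad_def
      by (simp add: euclidean_representation flip: scaleR_scaleR scaleR_sum_right)
  qed
  let ?K = "\<lambda>v a. fderiv (\<lambda>x. clift c d (chart_inv c x) a) (snd c q) v" and ?L = "clift c d q"
  note dom = in_dom[OF c(2) d(2)]
  have K: "linear (?K v)" "linear (\<lambda>v. ?K v a)" for v a
    using linear_clift_dom[OF c(1) d(1)]
    by (auto intro!: fderiv_family_linear[OF open_dom[OF c(1) d(1)] dom]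
        smooth_on_differentiable[OF smooth_clift[OF c(1) d(1)] dom]
        smooth_on_linear_fderiv[OF smooth_clift[OF c(1) d(1)] dom])
  \<comment> \<open>The covector is chosen equal to the commutator of the two lifts, so that its
    pairing with the commutator is the square of the norm.\<close>
  define \<xi> where "\<xi> = ?K (?L b) a - ?K (?L a) b"
  define z where "z = cotangent_of_coord B c (snd c q, \<xi>)"
  have xc: "snd c q \<in> snd c ` fst c" using c by blast
  have z: "fst z = q" "cotangent_coord B c z = (snd c q, \<xi>)"
    unfolding z_def
    using cotangent_of_coord_apply(1)[OF atlas_B c(1) xc] cotangent_coord_of_coord[OF atlas_B c(1) xc]
    by (simp_all add: chart_inv_left[OF chart_B[OF c(1)] c(2)])
  have y: "fst (phi_rep c d (snd c q, \<xi>)) = ?u"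
    by (simp add: phi_rep_def pi_rep_def chart_inv_left[OF chart_B[OF c(1)] c(2)])
  have r: "fibre_grad (f a) d (phi_rep c d (snd c q, \<xi>)) = \<beta> ?u *\<^sub>R a" for a
    using grad[of a "snd (phi_rep c d (snd c q, \<xi>))"] y by (metis prod.collapse)
  have "poisson_bracket B (f a \<circ> \<phi>) (f b \<circ> \<phi>) z = poisson_bracket A (f a) (f b) (\<phi> z)"
    using assms f(1) unfolding poisson_map_def by (metis comp_apply)
  then have "\<xi> \<bullet> (?K (?L (\<beta> ?u *\<^sub>R b)) (\<beta> ?u *\<^sub>R a) - ?K (?L (\<beta> ?u *\<^sub>R a)) (\<beta> ?u *\<^sub>R b)) = 0"
    using poisson_bracket_phi[OF f(1) f(1), of a b z] by (simp add: z r flip: c_def d_def)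
  \<comment> \<open>The bump enters through the fibre gradients of both test functions, hence as a
    square; it is nonzero at the base point and can be cancelled.\<close>
  moreover have "?K (?L (\<beta> ?u *\<^sub>R b)) (\<beta> ?u *\<^sub>R a) = (\<beta> ?u * \<beta> ?u) *\<^sub>R ?K (?L b) a" for a b
    by (simp only: linear_cmul[OF K(1)] linear_cmul[OF K(2)]
        linear_cmul[OF linear_clift[OF c(1) d(1) c(2) d(2)]] scaleR_scaleR)
  ultimately have "(\<beta> ?u * \<beta> ?u) * (\<xi> \<bullet> \<xi>) = 0"
    by (simp add: \<xi>_def flip: scaleR_diff_right)
  then have "\<xi> = 0" using \<beta> by simp
  then show "fderiv (\<lambda>x. clift (cB q) (cA (\<pi> q)) (chart_inv (cB q) x) a) (snd (cB q) q) (clift (cB q) (cA (\<pi> q)) q b) =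
      fderiv (\<lambda>x. clift (cB q) (cA (\<pi> q)) (chart_inv (cB q) x) b) (snd (cB q) q) (clift (cB q) (cA (\<pi> q)) q a)"
    by (simp add: \<xi>_def c_def d_def)
qed

theorem poisson_iff_integrable:
  "poisson_map B A (cotangent_pushforward B h A g \<pi>) \<longleftrightarrow> integrable_distribution TYPE('m) B hor"
proof
  assume "poisson_map B A (cotangent_pushforward B h A g \<pi>)"
  then show "integrable_distribution TYPE('m) B hor"
    using poisson_flat flat_integrable by (simp add: \<phi>_def)
next
  assume int: "integrable_distribution TYPE('m) B hor"
  have "flat_at (cB q) (cA (\<pi> q)) q" for q
  proof -
    obtain W :: "'m set" and s where s: "integral_manifold B hor W s" "q \<in> s ` W"
      using int unfolding integrable_distribution_def by blast
    then obtain w where "w \<in> W" "q = s w" by blast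
    then show ?thesis
      using integral_manifold_flat[OF s(1)] cA cB by metis
  qed
  then show "poisson_map B A (cotangent_pushforward B h A g \<pi>)"
    using flat_poisson by (simp add: \<phi>_def)
qed

end

theorem proposition6p7:
  fixes B :: "('q::{t2_space, second_countable_topology}, 'n::euclidean_space) chart set"
    and h :: "'q \<Rightarrow> 'n \<Rightarrow>\<^sub>L 'n \<Rightarrow>\<^sub>L real"
    and A :: "('p::{t2_space, second_countable_topology}, 'm::euclidean_space) chart set"
    and g :: "'p \<Rightarrow> 'm \<Rightarrow>\<^sub>L 'm \<Rightarrow>\<^sub>L real"
    and \<pi> :: "'q \<Rightarrow> 'p"
  assumes "smooth_atlas B" and "riemannian_metric B h"
    and "smooth_atlas A" and "riemannian_metric A g"
    and "riemannian_submersion B h A g \<pi>"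
  shows "poisson_map B A (cotangent_pushforward B h A g \<pi>) \<longleftrightarrow>
         integrable_distribution TYPE('m) B (horizontal B h A \<pi>)"
proof -
  interpret submersion B h A g \<pi>
    using assms by unfold_locales
  show ?thesis by (rule poisson_iff_integrable)
qed

end
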